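(* Let $X$ be an infinite dimensional complex Banach space and let $T\in B(X)$. Suppose that $T$ or its adjoint $T^{*}\in B(X^{*})$ has the single valued extension property (SVEP). Then $$\omega(f(T))=f(\omega(T))\quad\text{for every } f\in H(\sigma(T)).$$
   Context: $B(X)$ is the algebra of bounded linear operators on $X$; $X^*$ is the dual space of $X$; $N(T)$ and $R(T)$ denote the null space and range of $T$; $\alpha(T):=\dim N(T)$, $\beta(T):=\dim X/R(T)$; $\sigma(T)$ is the spectrum of $T$. $T$ is Fredholm if $R(T)$ is closed and $\alpha(T),\beta(T)<\infty$; its index is $i(T)=\alpha(T)-\beta(T)$; $T$ is Weyl if it is Fredholm of index zero. The Weyl spectrum is $\omega(T):=\{\lambda\in\mathbb{C}:T-\lambda\text{ is not Weyl}\}$. An operator $T$ on a Banach space $X$ has SVEP if for every open set $U\subseteq\mathbb{C}$ the only analytic function $f:U\to X$ with $(T-\lambda)f(\lambda)=0$ for all $\lambda\in U$ is the zero function. $H(\sigma(T))$ is the space of functions analytic in an open neighborhood of $\sigma(T)$, and $f(T)$ is defined by the holomorphic functional calculus. *)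

theory Defs
  imports "HOL-Complex_Analysis.Complex_Analysis" "HOL-Library.Extended_Nat"
begin

section \<open>Complex Banach spaces\<close>

class complex_normed_vector = real_normed_vector +
  fixes scaleC :: "complex \<Rightarrow> 'a \<Rightarrow> 'a"  (infixr "*\<^sub>C" 75)
  assumes scaleC_add_right: "c *\<^sub>C (x + y) = c *\<^sub>C x + c *\<^sub>C y"
    and scaleC_add_left: "(c + d) *\<^sub>C x = c *\<^sub>C x + d *\<^sub>C x"
    and scaleC_scaleC: "c *\<^sub>C d *\<^sub>C x = (c * d) *\<^sub>C x"
    and scaleR_scaleC: "scaleR r x = complex_of_real r *\<^sub>C x"
    and norm_scaleC: "norm (c *\<^sub>C x) = cmod c * norm x"

class complex_banach = complex_normed_vector + banach

global_interpretation complex_vector: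
  vector_space "scaleC :: complex \<Rightarrow> 'a \<Rightarrow> 'a :: complex_normed_vector"
  defines cspan = complex_vector.span
    and cdim = complex_vector.dim
    and csubspace = complex_vector.subspace
    and cdependent = complex_vector.dependent
    and crepresentation = complex_vector.representation
    and cextend_basis = complex_vector.extend_basis
proof
  fix x :: 'a
  show "1 *\<^sub>C x = x"
    using scaleR_scaleC[of 1 x] by simp
qed (simp_all add: scaleC_add_right scaleC_add_left scaleC_scaleC)

instantiation complex :: complex_banach
begin

definition scaleC_complex :: "complex \<Rightarrow> complex \<Rightarrow> complex" where
  "scaleC_complex c x = c * x"

instance
  by standard (simp_all add: scaleC_complex_def algebra_simps norm_mult scaleR_conv_of_real)

end

lemma bounded_linear_scaleC: "bounded_linear (\<lambda>x :: 'a :: complex_normed_vector. c *\<^sub>C x)"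
proof (rule bounded_linear_intro)
  fix x y :: 'a and r :: real
  show "c *\<^sub>C (x + y) = c *\<^sub>C x + c *\<^sub>C y"
    by (rule scaleC_add_right)
  show "c *\<^sub>C scaleR r x = scaleR r (c *\<^sub>C x)"
    by (simp add: scaleR_scaleC scaleC_scaleC mult.commute)
  show "norm (c *\<^sub>C x) \<le> norm x * cmod c"
    by (simp add: norm_scaleC mult.commute)
qed


section \<open>Bounded complex-linear maps\<close>

typedef (overloaded) ('a, 'b) cblinfun =
  "{f :: 'a :: complex_normed_vector \<Rightarrow>\<^sub>L 'b :: complex_normed_vector.
      \<forall>c x. blinfun_apply f (c *\<^sub>C x) = c *\<^sub>C blinfun_apply f x}"
  morphisms blinfun_of_cblinfun Abs_cblinfun
  by (intro exI[of _ 0]) simp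

type_notation cblinfun ("(_ \<Rightarrow>\<^sub>C\<^sub>L /_)" [22, 21] 21)

setup_lifting type_definition_cblinfun

lift_definition cblinfun_apply ::
    "('a :: complex_normed_vector \<Rightarrow>\<^sub>C\<^sub>L 'b :: complex_normed_vector) \<Rightarrow> 'a \<Rightarrow> 'b"
  is blinfun_apply .

declare [[coercion cblinfun_apply]]

lift_definition blinfun_scaleC :: "complex \<Rightarrow>
    ('a :: real_normed_vector \<Rightarrow>\<^sub>L 'b :: complex_normed_vector) \<Rightarrow> ('a \<Rightarrow>\<^sub>L 'b)"
  is "\<lambda>c f x. c *\<^sub>C f x"
  by (rule bounded_linear_compose[OF bounded_linear_scaleC])

lemma norm_blinfun_scaleC: "norm (blinfun_scaleC c f) = cmod c * norm f"
proof -
  have le: "norm (blinfun_scaleC d g) \<le> cmod d * norm g" for d and g :: "'a \<Rightarrow>\<^sub>L 'b"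
    by (rule norm_blinfun_bound)
      (auto simp: blinfun_scaleC.rep_eq norm_scaleC mult.assoc
        intro!: mult_left_mono norm_blinfun)
  show ?thesis
  proof (cases "c = 0")
    case True
    then show ?thesis using le[of c f] by simp
  next
    case False
    have "blinfun_scaleC (inverse c) (blinfun_scaleC c f) = f"
      by (rule blinfun_eqI) (simp add: blinfun_scaleC.rep_eq scaleC_scaleC False)
    then have "norm f \<le> cmod (inverse c) * norm (blinfun_scaleC c f)"
      using le[of "inverse c" "blinfun_scaleC c f"] by simp
    then have "cmod c * norm f \<le> norm (blinfun_scaleC c f)"
      using False by (simp add: norm_inverse norm_divide divide_simps mult.commute)
    with le[of c f] show ?thesis by simp
  qed
qed

instantiation cblinfun :: (complex_normed_vector, complex_normed_vector) complex_normed_vector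
begin

lift_definition norm_cblinfun :: "('a \<Rightarrow>\<^sub>C\<^sub>L 'b) \<Rightarrow> real" is norm .

lift_definition zero_cblinfun :: "'a \<Rightarrow>\<^sub>C\<^sub>L 'b" is 0
  by simp

lift_definition plus_cblinfun :: "('a \<Rightarrow>\<^sub>C\<^sub>L 'b) \<Rightarrow> ('a \<Rightarrow>\<^sub>C\<^sub>L 'b) \<Rightarrow> ('a \<Rightarrow>\<^sub>C\<^sub>L 'b)" is "(+)"
  by (simp add: blinfun.bilinear_simps scaleC_add_right)

lift_definition minus_cblinfun :: "('a \<Rightarrow>\<^sub>C\<^sub>L 'b) \<Rightarrow> ('a \<Rightarrow>\<^sub>C\<^sub>L 'b) \<Rightarrow> ('a \<Rightarrow>\<^sub>C\<^sub>L 'b)" is "(-)"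
  by (simp add: blinfun.bilinear_simps complex_vector.scale_right_diff_distrib)

lift_definition uminus_cblinfun :: "('a \<Rightarrow>\<^sub>C\<^sub>L 'b) \<Rightarrow> ('a \<Rightarrow>\<^sub>C\<^sub>L 'b)" is uminus
  by (simp add: blinfun.bilinear_simps complex_vector.scale_minus_right)

lift_definition scaleR_cblinfun :: "real \<Rightarrow> ('a \<Rightarrow>\<^sub>C\<^sub>L 'b) \<Rightarrow> ('a \<Rightarrow>\<^sub>C\<^sub>L 'b)" is scaleR
  by (simp add: blinfun.bilinear_simps scaleR_scaleC scaleC_scaleC mult.commute)

lift_definition scaleC_cblinfun :: "complex \<Rightarrow> ('a \<Rightarrow>\<^sub>C\<^sub>L 'b) \<Rightarrow> ('a \<Rightarrow>\<^sub>C\<^sub>L 'b)" is blinfun_scaleC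
  by (simp add: blinfun_scaleC.rep_eq scaleC_scaleC mult.commute)

definition dist_cblinfun :: "('a \<Rightarrow>\<^sub>C\<^sub>L 'b) \<Rightarrow> ('a \<Rightarrow>\<^sub>C\<^sub>L 'b) \<Rightarrow> real" where
  "dist_cblinfun a b = norm (a - b)"

definition uniformity_cblinfun :: "(('a \<Rightarrow>\<^sub>C\<^sub>L 'b) \<times> ('a \<Rightarrow>\<^sub>C\<^sub>L 'b)) filter" where
  "uniformity_cblinfun = (INF e\<in>{0<..}. principal {(x, y). dist x y < e})"

definition open_cblinfun :: "('a \<Rightarrow>\<^sub>C\<^sub>L 'b) set \<Rightarrow> bool" where
  "open_cblinfun S = (\<forall>x\<in>S. \<forall>\<^sub>F (x', y) in uniformity. x' = x \<longrightarrow> y \<in> S)"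

definition sgn_cblinfun :: "('a \<Rightarrow>\<^sub>C\<^sub>L 'b) \<Rightarrow> ('a \<Rightarrow>\<^sub>C\<^sub>L 'b)" where
  "sgn_cblinfun x = scaleR (inverse (norm x)) x"

instance
proof
  fix x y :: "'a \<Rightarrow>\<^sub>C\<^sub>L 'b" and c d :: complex and r :: real
  show "c *\<^sub>C (x + y) = c *\<^sub>C x + c *\<^sub>C y"
    by transfer (rule blinfun_eqI, simp add: blinfun_scaleC.rep_eq blinfun.bilinear_simps scaleC_add_right)
  show "(c + d) *\<^sub>C x = c *\<^sub>C x + d *\<^sub>C x"
    by transfer (rule blinfun_eqI, simp add: blinfun_scaleC.rep_eq blinfun.bilinear_simps scaleC_add_left)
  show "c *\<^sub>C d *\<^sub>C x = (c * d) *\<^sub>C x"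
    by transfer (rule blinfun_eqI, simp add: blinfun_scaleC.rep_eq scaleC_scaleC)
  show "scaleR r x = complex_of_real r *\<^sub>C x"
    by transfer (rule blinfun_eqI, simp add: blinfun_scaleC.rep_eq blinfun.bilinear_simps scaleR_scaleC)
  show "norm (c *\<^sub>C x) = cmod c * norm x"
    by transfer (rule norm_blinfun_scaleC)
qed (unfold dist_cblinfun_def open_cblinfun_def sgn_cblinfun_def uniformity_cblinfun_def,
    (rule refl | (transfer, simp add: algebra_simps norm_triangle_ineq))+)

end

lemma blinfun_of_cblinfun_tendsto:
  fixes X :: "nat \<Rightarrow> 'a :: complex_normed_vector \<Rightarrow>\<^sub>C\<^sub>L 'b :: complex_normed_vector"
  shows "X \<longlonglongrightarrow> L \<longleftrightarrow> (\<lambda>n. blinfun_of_cblinfun (X n)) \<longlonglongrightarrow> blinfun_of_cblinfun L"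
  unfolding LIMSEQ_iff by (simp add: norm_cblinfun.rep_eq minus_cblinfun.rep_eq)

instance cblinfun :: (complex_normed_vector, complex_banach) complex_banach
proof
  fix X :: "nat \<Rightarrow> 'a \<Rightarrow>\<^sub>C\<^sub>L 'b"
  let ?Y = "\<lambda>n. blinfun_of_cblinfun (X n)"
  assume "Cauchy X"
  then have "Cauchy ?Y"
    unfolding Cauchy_iff by (simp add: norm_cblinfun.rep_eq minus_cblinfun.rep_eq)
  then obtain L where L: "?Y \<longlonglongrightarrow> L"
    using Cauchy_convergent_iff convergent_def by blast
  have pointwise: "(\<lambda>n. blinfun_apply (?Y n) x) \<longlonglongrightarrow> blinfun_apply L x" for x
    by (rule bounded_linear.tendsto[OF blinfun.bounded_linear_left L])
  have "blinfun_apply L (c *\<^sub>C x) = c *\<^sub>C blinfun_apply L x" for c x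
  proof (rule LIMSEQ_unique)
    show "(\<lambda>n. blinfun_apply (?Y n) (c *\<^sub>C x)) \<longlonglongrightarrow> blinfun_apply L (c *\<^sub>C x)"
      by (rule pointwise)
    have "(\<lambda>n. c *\<^sub>C blinfun_apply (?Y n) x) \<longlonglongrightarrow> c *\<^sub>C blinfun_apply L x"
      by (rule bounded_linear.tendsto[OF bounded_linear_scaleC pointwise])
    then show "(\<lambda>n. blinfun_apply (?Y n) (c *\<^sub>C x)) \<longlonglongrightarrow> c *\<^sub>C blinfun_apply L x"
      using blinfun_of_cblinfun[of "X n" for n] by simp
  qed
  then have "X \<longlonglongrightarrow> Abs_cblinfun L"
    using L by (simp add: blinfun_of_cblinfun_tendsto Abs_cblinfun_inverse)
  then show "convergent X"
    by (rule convergentI)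
qed

lift_definition id_cblinfun :: "'a :: complex_normed_vector \<Rightarrow>\<^sub>C\<^sub>L 'a" is id_blinfun
  by simp

lift_definition cblinfun_compose :: "('b :: complex_normed_vector \<Rightarrow>\<^sub>C\<^sub>L 'c :: complex_normed_vector) \<Rightarrow>
    ('a :: complex_normed_vector \<Rightarrow>\<^sub>C\<^sub>L 'b) \<Rightarrow> ('a \<Rightarrow>\<^sub>C\<^sub>L 'c)"  (infixl "o\<^sub>C" 67)
  is blinfun_compose
  by simp

type_synonym 'a cdual = "('a, complex) cblinfun"

lemma bounded_linear_precompose:
  fixes T :: "'a :: complex_normed_vector \<Rightarrow>\<^sub>C\<^sub>L 'b :: complex_normed_vector"
  shows "bounded_linear (\<lambda>\<phi> :: 'b \<Rightarrow>\<^sub>C\<^sub>L 'c :: complex_normed_vector. \<phi> o\<^sub>C T)"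
proof (rule bounded_linear_intro)
  fix \<phi> \<psi> :: "'b \<Rightarrow>\<^sub>C\<^sub>L 'c" and r :: real
  show "(\<phi> + \<psi>) o\<^sub>C T = \<phi> o\<^sub>C T + \<psi> o\<^sub>C T"
    by transfer (rule blinfun_eqI, simp add: blinfun.bilinear_simps)
  show "scaleR r \<phi> o\<^sub>C T = scaleR r (\<phi> o\<^sub>C T)"
    by transfer (rule blinfun_eqI, simp add: blinfun.bilinear_simps)
  show "norm (\<phi> o\<^sub>C T) \<le> norm \<phi> * norm T"
    by transfer (rule norm_blinfun_compose)
qed

lift_definition adjoint_blinfun :: "('a :: complex_normed_vector \<Rightarrow>\<^sub>C\<^sub>L 'b :: complex_normed_vector) \<Rightarrow>
    ('b cdual \<Rightarrow>\<^sub>L 'a cdual)"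
  is "\<lambda>T \<phi>. \<phi> o\<^sub>C T"
  by (rule bounded_linear_precompose)

text \<open>The Banach space adjoint, \<open>T\<^sup>* \<phi> = \<phi> \<circ> T\<close>; it is complex-linear, not conjugate-linear, in \<open>T\<close>.\<close>

lift_definition banach_adjoint :: "('a :: complex_normed_vector \<Rightarrow>\<^sub>C\<^sub>L 'b :: complex_normed_vector) \<Rightarrow>
    ('b cdual \<Rightarrow>\<^sub>C\<^sub>L 'a cdual)"
  is adjoint_blinfun
proof -
  fix T :: "'a \<Rightarrow>\<^sub>C\<^sub>L 'b" and c and \<phi> :: "'b cdual"
  have "(c *\<^sub>C \<phi>) o\<^sub>C T = c *\<^sub>C (\<phi> o\<^sub>C T)"
    by transfer (rule blinfun_eqI, simp add: blinfun_scaleC.rep_eq)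
  then show "blinfun_apply (adjoint_blinfun T) (c *\<^sub>C \<phi>) = c *\<^sub>C blinfun_apply (adjoint_blinfun T) \<phi>"
    by (simp add: adjoint_blinfun.rep_eq)
qed

lemma banach_adjoint_apply: "banach_adjoint T \<phi> x = \<phi> (T x)"
proof -
  have "banach_adjoint T \<phi> = \<phi> o\<^sub>C T"
    by (simp add: cblinfun_apply.rep_eq banach_adjoint.rep_eq adjoint_blinfun.rep_eq)
  then show ?thesis
    by (simp add: cblinfun_apply.rep_eq cblinfun_compose.rep_eq)
qed


section \<open>Spectrum, Fredholm and Weyl operators\<close>

definition invertible_cblinfun :: "('a :: complex_normed_vector \<Rightarrow>\<^sub>C\<^sub>L 'a) \<Rightarrow> bool" where
  "invertible_cblinfun T \<longleftrightarrow> (\<exists>S. S o\<^sub>C T = id_cblinfun \<and> T o\<^sub>C S = id_cblinfun)"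

definition cblinfun_inverse :: "('a :: complex_normed_vector \<Rightarrow>\<^sub>C\<^sub>L 'a) \<Rightarrow> ('a \<Rightarrow>\<^sub>C\<^sub>L 'a)" where
  "cblinfun_inverse T = (THE S. S o\<^sub>C T = id_cblinfun \<and> T o\<^sub>C S = id_cblinfun)"

definition spectrum :: "('a :: complex_normed_vector \<Rightarrow>\<^sub>C\<^sub>L 'a) \<Rightarrow> complex set" where
  "spectrum T = {z. \<not> invertible_cblinfun (T - z *\<^sub>C id_cblinfun)}"

definition null_space :: "('a :: complex_normed_vector \<Rightarrow>\<^sub>C\<^sub>L 'b :: complex_normed_vector) \<Rightarrow> 'a set" where
  "null_space T = {x. T x = 0}"

text \<open>The library dimension \<^const>\<open>cdim\<close> is \<open>0\<close> on infinite dimensional subspaces.\<close>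

definition edim :: "'a :: complex_normed_vector set \<Rightarrow> enat" where
  "edim V = (if \<exists>B. finite B \<and> V \<subseteq> cspan B then enat (cdim V) else \<infinity>)"

text \<open>
  \<open>quotient_basis M B\<close>: the cosets \<open>b + M\<close> for \<open>b \<in> B\<close> are pairwise distinct and form a
  (Hamel) basis of the quotient vector space \<open>X / M\<close>. A linear combination of these cosets is
  zero in \<open>X / M\<close> iff the same combination of representatives lies in \<open>M\<close>. All such \<open>B\<close> have
  the same cardinality when \<open>M\<close> is a subspace.
\<close>

definition quotient_basis :: "'a :: complex_normed_vector set \<Rightarrow> 'a set \<Rightarrow> bool" where
  "quotient_basis M B \<longleftrightarrow>
     (\<forall>F u. finite F \<and> F \<subseteq> B \<and> (\<Sum>b\<in>F. u b *\<^sub>C b) \<in> M \<longrightarrow> (\<forall>b\<in>F. u b = 0)) \<and>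
     (\<forall>x. \<exists>F u. finite F \<and> F \<subseteq> B \<and> x - (\<Sum>b\<in>F. u b *\<^sub>C b) \<in> M)"

definition quotient_edim :: "'a :: complex_normed_vector set \<Rightarrow> enat" where
  "quotient_edim M =
     (if \<exists>B. finite B \<and> quotient_basis M B
      then enat (card (SOME B. finite B \<and> quotient_basis M B)) else \<infinity>)"

definition nullity :: "('a :: complex_normed_vector \<Rightarrow>\<^sub>C\<^sub>L 'b :: complex_normed_vector) \<Rightarrow> enat" where
  "nullity T = edim (null_space T)"

definition deficiency :: "('a :: complex_normed_vector \<Rightarrow>\<^sub>C\<^sub>L 'b :: complex_normed_vector) \<Rightarrow> enat" where
  "deficiency T = quotient_edim (range T)"

definition fredholm :: "('a :: complex_normed_vector \<Rightarrow>\<^sub>C\<^sub>L 'b :: complex_normed_vector) \<Rightarrow> bool" where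
  "fredholm T \<longleftrightarrow> closed (range T) \<and> nullity T < \<infinity> \<and> deficiency T < \<infinity>"

definition fredholm_index :: "('a :: complex_normed_vector \<Rightarrow>\<^sub>C\<^sub>L 'b :: complex_normed_vector) \<Rightarrow> int" where
  "fredholm_index T = int (the_enat (nullity T)) - int (the_enat (deficiency T))"

definition weyl :: "('a :: complex_normed_vector \<Rightarrow>\<^sub>C\<^sub>L 'a) \<Rightarrow> bool" where
  "weyl T \<longleftrightarrow> fredholm T \<and> fredholm_index T = 0"

definition weyl_spectrum :: "('a :: complex_normed_vector \<Rightarrow>\<^sub>C\<^sub>L 'a) \<Rightarrow> complex set" where
  "weyl_spectrum T = {z. \<not> weyl (T - z *\<^sub>C id_cblinfun)}"


section \<open>Single valued extension property\<close>

text \<open>For open \<open>U\<close>, analyticity of a vector-valued function is complex differentiability on \<open>U\<close>.\<close>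

definition vector_analytic_on :: "(complex \<Rightarrow> 'a :: complex_normed_vector) \<Rightarrow> complex set \<Rightarrow> bool" where
  "vector_analytic_on f U \<longleftrightarrow>
     (\<forall>z\<in>U. \<exists>D. ((\<lambda>w. inverse (w - z) *\<^sub>C (f w - f z)) \<longlongrightarrow> D) (at z))"

definition SVEP :: "('a :: complex_normed_vector \<Rightarrow>\<^sub>C\<^sub>L 'a) \<Rightarrow> bool" where
  "SVEP T \<longleftrightarrow>
     (\<forall>U f. open U \<and> vector_analytic_on f U \<and> (\<forall>z\<in>U. (T - z *\<^sub>C id_cblinfun) (f z) = 0)
        \<longrightarrow> (\<forall>z\<in>U. f z = 0))"


section \<open>Holomorphic functional calculus\<close>

definition vector_contour_integral ::
    "(real \<Rightarrow> complex) \<Rightarrow> (complex \<Rightarrow> 'a :: complex_normed_vector) \<Rightarrow> 'a" where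
  "vector_contour_integral \<gamma> F =
     integral {0..1} (\<lambda>t. vector_derivative \<gamma> (at t within {0..1}) *\<^sub>C F (\<gamma> t))"

text \<open>
  A cycle is a list of closed piecewise \<open>C\<^sup>1\<close> paths. It surrounds \<open>K\<close> in \<open>U\<close> if it runs in
  \<open>U - K\<close> and its total winding number is \<open>1\<close> about every point of \<open>K\<close> and \<open>0\<close> about every
  point outside \<open>U\<close>. Several paths are needed because neither \<open>K\<close> nor \<open>U\<close> has to be connected.
\<close>

definition surrounds_in :: "(real \<Rightarrow> complex) list \<Rightarrow> complex set \<Rightarrow> complex set \<Rightarrow> bool" where
  "surrounds_in \<Gamma> K U \<longleftrightarrow>
     (\<forall>\<gamma>\<in>set \<Gamma>. valid_path \<gamma> \<and> pathfinish \<gamma> = pathstart \<gamma> \<and> path_image \<gamma> \<subseteq> U - K) \<and>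
     (\<forall>z\<in>K. (\<Sum>\<gamma>\<leftarrow>\<Gamma>. winding_number \<gamma> z) = 1) \<and>
     (\<forall>z. z \<notin> U \<longrightarrow> (\<Sum>\<gamma>\<leftarrow>\<Gamma>. winding_number \<gamma> z) = 0)"

text \<open>
  \<open>f(T) = (1 / 2\<pi>i) \<integral>\<^sub>\<Gamma> f(z) (z - T)\<^sup>-\<^sup>1 dz\<close>. By Cauchy's theorem the integral does not depend on
  the neighbourhood \<open>U\<close> of the spectrum on which \<open>f\<close> is holomorphic or on the cycle \<open>\<Gamma>\<close>, so
  one is picked by choice. Such \<open>U\<close> and \<open>\<Gamma>\<close> exist iff \<open>f\<close> is \<^const>\<open>analytic_on\<close> the
  spectrum.
\<close>

definition hol_calculus :: "(complex \<Rightarrow> complex) \<Rightarrow> ('a :: complex_banach \<Rightarrow>\<^sub>C\<^sub>L 'a) \<Rightarrow> ('a \<Rightarrow>\<^sub>C\<^sub>L 'a)" where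
  "hol_calculus f T =
     (let \<Gamma> = (SOME \<Gamma>. \<exists>U. open U \<and> spectrum T \<subseteq> U \<and> f holomorphic_on U \<and>
                         surrounds_in \<Gamma> (spectrum T) U)
      in (1 / (2 * of_real pi * \<i>)) *\<^sub>C
         (\<Sum>\<gamma>\<leftarrow>\<Gamma>. vector_contour_integral \<gamma>
            (\<lambda>z. f z *\<^sub>C cblinfun_inverse (z *\<^sub>C id_cblinfun - T))))"

end

theory Submission
  imports Defs
begin

text \<open>
  An operator is Weyl iff it is the sum of an invertible operator and one of finite rank. If \<open>T\<close> has SVEP and a Weyl
  operator \<open>S\<close> commutes with \<open>T\<close> and is divisible by \<open>T - l\<close> for each eigenvalue \<open>l\<close> of \<open>T\<close> on \<open>N(S)\<close>, then \<open>S\<close> has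
  finite ascent: \<open>S\<close> maps \<open>W = \<Inter>\<^sub>n R(S\<^sup>n)\<close> onto itself, so \<open>T - l\<close> does too, and an eigenvector of \<open>T\<close> in \<open>N(S) \<inter> W\<close> would
  extend to an analytic family of eigenvectors. As the index is zero, \<open>S\<close> then becomes invertible after the finite
  dimensional space \<open>N(S\<^sup>p)\<close> has been split off by a projection that commutes with everything commuting with \<open>S\<close>.

  For \<open>S = f(T) - f(l) = (T - l) g(T)\<close> this makes \<open>T - l\<close> Weyl whenever \<open>f(T) - f(l)\<close> is. For \<open>S = T - l\<close> it shows that a
  Weyl point \<open>l\<close> of the spectrum is isolated with Riesz projection of finite rank. Hence, if every zero of \<open>f - c\<close> on
  the spectrum is a Weyl point, there are finitely many of them, and redefining \<open>f\<close> near these zeros changes \<open>f(T)\<close>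
  by an operator of finite rank and makes \<open>f(T) - c\<close> invertible.

  The case of the adjoint follows from \<open>f(T\<^sup>*) = f(T)\<^sup>*\<close> and the fact that \<open>S\<close> is Weyl iff \<open>S\<^sup>*\<close> is.
\<close>


section \<open>Bounded complex-linear maps as functions\<close>

text \<open>When \<open>f(T) - c\<close> splits into factors \<open>T - l\<close> and an invertible
  operator, the indices of the factors can cancel, so a product may be Weyl although no factor is.
  SVEP excludes this through finite ascent and no index is ever computed: once a generalized kernel
  is split off, a commuting factor of an invertible operator is itself invertible. For the same
  reason Weyl operators are handled as \<open>A + F\<close>, where products and perturbations are
  plain algebra.

  \<open>hol_calculus\<close> integrates over an unspecified cycle of piecewise smooth paths. That
  its value does not depend on this choice takes the homology form of Cauchy's theorem, and hence
  the construction of at least one well understood cycle around any compact set. Operator identities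
  of the calculus are tested on bounded functionals, which turns them into identities between scalar
  contour integrals. The Hahn-Banach theorem supplies enough functionals for this; it also gives the
  dual bases behind finite rank operators and the link between \<open>T\<close> and its
  adjoint.\<close>

definition bounded_clinear :: "('a :: complex_normed_vector \<Rightarrow> 'b :: complex_normed_vector) \<Rightarrow> bool" where
  "bounded_clinear f \<longleftrightarrow> bounded_linear f \<and> (\<forall>c x. f (c *\<^sub>C x) = c *\<^sub>C f x)"

definition CBlinfun :: "('a :: complex_normed_vector \<Rightarrow> 'b :: complex_normed_vector) \<Rightarrow> ('a \<Rightarrow>\<^sub>C\<^sub>L 'b)" where
  "CBlinfun f = Abs_cblinfun (Blinfun f)"

lemma CBlinfun_apply: "bounded_clinear f \<Longrightarrow> cblinfun_apply (CBlinfun f) x = f x"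
  unfolding CBlinfun_def cblinfun_apply.rep_eq
  by (subst Abs_cblinfun_inverse) (auto simp: bounded_clinear_def bounded_linear_Blinfun_apply)

lemma bounded_clinear_apply: "bounded_clinear (cblinfun_apply T)"
  unfolding bounded_clinear_def
  by (auto simp: cblinfun_apply.rep_eq[abs_def] blinfun.bounded_linear_right)
    (use blinfun_of_cblinfun in auto)

lemma bounded_linear_apply: "bounded_linear (cblinfun_apply T)"
  using bounded_clinear_apply bounded_clinear_def by blast

lemma bounded_clinearI:
  assumes "\<And>x y. f (x + y) = f x + f y" "\<And>c x. f (c *\<^sub>C x) = c *\<^sub>C f x" "\<And>x. norm (f x) \<le> norm x * K"
  shows "bounded_clinear f"
  unfolding bounded_clinear_def
  by (intro conjI bounded_linear_intro[where K = K]) (use assms in \<open>auto simp: scaleR_scaleC\<close>)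

lemma bounded_clinear_linear: "bounded_clinear f \<Longrightarrow> bounded_linear f"
  by (simp add: bounded_clinear_def)

lemma bounded_clinear_scaleC: "bounded_clinear f \<Longrightarrow> f (c *\<^sub>C x) = c *\<^sub>C f x"
  by (simp add: bounded_clinear_def)

lemma bounded_clinear_compose:
  "bounded_clinear f \<Longrightarrow> bounded_clinear g \<Longrightarrow> bounded_clinear (\<lambda>x. f (g x))"
  by (auto simp: bounded_clinear_def intro: bounded_linear_compose)

lemma cblinfun_eqI: "(\<And>x. cblinfun_apply S x = cblinfun_apply T x) \<Longrightarrow> S = T"
  by transfer (auto intro: blinfun_eqI)

lemma apply_add_left [simp]: "cblinfun_apply (S + T) x = S x + T x"
  and apply_diff_left [simp]: "cblinfun_apply (S - T) x = S x - T x"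
  and apply_minus_left [simp]: "cblinfun_apply (- T) x = - T x"
  and apply_zero_left [simp]: "cblinfun_apply 0 x = 0"
  and apply_scaleC_left [simp]: "cblinfun_apply (c *\<^sub>C T) x = c *\<^sub>C T x"
  and apply_id [simp]: "cblinfun_apply id_cblinfun x = x"
  by (transfer, simp add: blinfun.bilinear_simps blinfun_scaleC.rep_eq)+

lemma apply_compose [simp]: "cblinfun_apply (S o\<^sub>C T) x = S (T x)"
  by transfer simp

lemma apply_add [simp]: "cblinfun_apply T (x + y) = T x + T y"
  and apply_diff [simp]: "cblinfun_apply T (x - y) = T x - T y"
  and apply_minus [simp]: "cblinfun_apply T (- x) = - T x"
  and apply_zero [simp]: "cblinfun_apply T 0 = 0"
  and apply_scaleC [simp]: "cblinfun_apply T (c *\<^sub>C x) = c *\<^sub>C T x"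
  by (transfer, simp add: blinfun.bilinear_simps)+

lemma apply_sum: "cblinfun_apply T (\<Sum>i\<in>I. f i) = (\<Sum>i\<in>I. T (f i))"
  by (induction I rule: infinite_finite_induct) auto

lemma norm_apply: "norm (cblinfun_apply T x) \<le> norm T * norm x"
  by transfer (rule norm_blinfun)

lemma norm_cblinfun_bound:
  "0 \<le> b \<Longrightarrow> (\<And>x. norm (cblinfun_apply T x) \<le> b * norm x) \<Longrightarrow> norm T \<le> b"
  by transfer (rule norm_blinfun_bound)

lemma norm_compose: "norm (S o\<^sub>C T) \<le> norm S * norm T"
  by transfer (rule norm_blinfun_compose)

lemma norm_id_le: "norm (id_cblinfun :: 'a :: complex_normed_vector \<Rightarrow>\<^sub>C\<^sub>L 'a) \<le> 1"
  by (rule norm_cblinfun_bound) auto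

lemma bounded_clinear_apply_left: "bounded_clinear (\<lambda>T. cblinfun_apply T x)"
  by (rule bounded_clinearI[where K = "norm x"]) (auto simp: norm_apply)

lemma bounded_clinear_compose_left: "bounded_clinear (\<lambda>S. S o\<^sub>C T)"
  by (rule bounded_clinearI[where K = "norm T"])
    (auto intro!: cblinfun_eqI simp: norm_compose)

lemma bounded_clinear_compose_right: "bounded_clinear (\<lambda>S. T o\<^sub>C S)"
  by (rule bounded_clinearI[where K = "norm T"])
    (auto intro!: cblinfun_eqI simp: mult.commute[of "norm _" "norm T"] norm_compose)

lemma compose_assoc: "(A o\<^sub>C B) o\<^sub>C C = A o\<^sub>C (B o\<^sub>C C)"
  by (rule cblinfun_eqI) simp

lemma compose_id [simp]: "A o\<^sub>C id_cblinfun = A" "id_cblinfun o\<^sub>C A = A"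
  by (auto intro: cblinfun_eqI)

lemma invertible_inverse:
  assumes "invertible_cblinfun T"
  shows "cblinfun_inverse T o\<^sub>C T = id_cblinfun \<and> T o\<^sub>C cblinfun_inverse T = id_cblinfun"
proof -
  have "\<exists>!S. S o\<^sub>C T = id_cblinfun \<and> T o\<^sub>C S = id_cblinfun"
    using assms unfolding invertible_cblinfun_def by (metis compose_assoc compose_id)
  then show ?thesis
    unfolding cblinfun_inverse_def by (rule theI')
qed

lemma inverse_apply [simp]:
  assumes "invertible_cblinfun T"
  shows "cblinfun_inverse T (T x) = x" "T (cblinfun_inverse T x) = x"
  using invertible_inverse[OF assms] by (metis apply_compose apply_id)+

lemma inverse_unique:
  assumes "S o\<^sub>C T = id_cblinfun" "T o\<^sub>C S = id_cblinfun"
  shows "cblinfun_inverse T = S" "invertible_cblinfun T"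
proof -
  show "invertible_cblinfun T"
    using assms invertible_cblinfun_def by blast
  then show "cblinfun_inverse T = S"
    using invertible_inverse assms by (metis compose_assoc compose_id)
qed

lemma invertible_compose:
  "invertible_cblinfun S \<Longrightarrow> invertible_cblinfun T \<Longrightarrow> invertible_cblinfun (S o\<^sub>C T)"
  by (rule inverse_unique(2)[where S = "cblinfun_inverse T o\<^sub>C cblinfun_inverse S"])
    (auto intro: cblinfun_eqI)

lemma commute_inverse:
  assumes "invertible_cblinfun A" "\<And>x. A (B x) = B (A x)"
  shows "cblinfun_inverse A (B x) = B (cblinfun_inverse A x)"
  by (metis assms inverse_apply)


section \<open>The Hahn--Banach theorem\<close>

text \<open>Homogeneity is asked only as an inequality for positive scalars: in this form it passes
  to infima, and the inverse scalar turns it back into an equality.\<close>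

definition sublinear :: "('a :: real_vector \<Rightarrow> real) \<Rightarrow> bool" where
  "sublinear p \<longleftrightarrow> (\<forall>x y. p (x + y) \<le> p x + p y) \<and> (\<forall>c>0. \<forall>x. p (c *\<^sub>R x) \<le> c * p x)"

lemma sublinear_zero: "sublinear p \<Longrightarrow> p 0 = 0"
proof -
  assume p: "sublinear p"
  have "p (2 *\<^sub>R 0) \<le> 2 * p 0" "p ((1/2) *\<^sub>R 0) \<le> (1/2) * p 0"
    using p unfolding sublinear_def by (meson half_gt_zero_iff zero_less_numeral zero_less_one)+
  then show ?thesis by simp
qed

lemma sublinear_scale: "sublinear p \<Longrightarrow> 0 \<le> c \<Longrightarrow> p (c *\<^sub>R x) = c * p x"
proof (cases "c = 0")
  case False
  assume p: "sublinear p" and "0 \<le> c"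
  with False have c: "0 < c" by simp
  have "p (inverse c *\<^sub>R (c *\<^sub>R x)) \<le> inverse c * p (c *\<^sub>R x)"
    using p c unfolding sublinear_def by (meson positive_imp_inverse_positive)
  then have "c * p x \<le> p (c *\<^sub>R x)"
    using c by (simp add: field_simps)
  moreover have "p (c *\<^sub>R x) \<le> c * p x"
    using p c unfolding sublinear_def by blast
  ultimately show ?thesis by simp
qed (simp add: sublinear_zero)

lemma sublinear_lower: "sublinear p \<Longrightarrow> - p (- x) \<le> p x"
  using sublinear_zero[of p] unfolding sublinear_def
  by (metis add.right_inverse add.commute le_add_same_cancel1 minus_le_iff add_le_cancel_left
      ab_group_add_class.ab_left_minus diff_ge_0_iff_ge diff_minus_eq_add)

text \<open>The largest sublinear functional below \<open>p\<close> that is affine in direction \<open>y\<close> from \<open>0\<close>; a minimal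
  sublinear functional is a fixed point for every \<open>y\<close>, hence odd, hence linear.\<close>

definition sublinear_cut :: "('a :: real_vector \<Rightarrow> real) \<Rightarrow> 'a \<Rightarrow> 'a \<Rightarrow> real" where
  "sublinear_cut p y x = (INF t\<in>{0..}. p (x + t *\<^sub>R y) - t * p y)"

lemma sublinear_cut_lower:
  assumes p: "sublinear p" and t: "0 \<le> t"
  shows "- p (- x) \<le> p (x + t *\<^sub>R y) - t * p y"
proof -
  have "p (t *\<^sub>R y) \<le> p (x + t *\<^sub>R y) + p (- x)"
    using p unfolding sublinear_def by (metis add.commute add_diff_cancel_left' diff_conv_add_uminus)
  then show ?thesis
    using sublinear_scale[OF p t, of y] by simp
qed

lemma sublinear_cut_le:
  assumes p: "sublinear p" and t: "0 \<le> t"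
  shows "sublinear_cut p y x \<le> p (x + t *\<^sub>R y) - t * p y"
  unfolding sublinear_cut_def
  by (rule cINF_lower) (use t sublinear_cut_lower[OF p] in \<open>auto intro!: bdd_belowI2[where m = "- p (- x)"]\<close>)

lemma sublinear_cut_greatest:
  "(\<And>t. 0 \<le> t \<Longrightarrow> m \<le> p (x + t *\<^sub>R y) - t * p y) \<Longrightarrow> m \<le> sublinear_cut p y x"
  unfolding sublinear_cut_def by (rule cINF_greatest) auto

lemma sublinear_cut:
  assumes p: "sublinear p"
  shows "sublinear (sublinear_cut p y)"
  unfolding sublinear_def
proof (intro conjI allI impI)
  fix x x'
  have "sublinear_cut p y (x + x') - sublinear_cut p y x \<le> sublinear_cut p y x'"
  proof (rule sublinear_cut_greatest)
    fix s :: real assume s: "0 \<le> s"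
    \<comment> \<open>One infimum at a time: the parameters \<open>s\<close> and \<open>t\<close> of
      the two summands combine to \<open>t + s\<close> for the sum.\<close>
    have "sublinear_cut p y (x + x') - (p (x' + s *\<^sub>R y) - s * p y) \<le> sublinear_cut p y x"
    proof (rule sublinear_cut_greatest)
      fix t :: real assume t: "0 \<le> t"
      have "p ((x + t *\<^sub>R y) + (x' + s *\<^sub>R y)) \<le> p (x + t *\<^sub>R y) + p (x' + s *\<^sub>R y)"
        using p unfolding sublinear_def by blast
      moreover have "(x + t *\<^sub>R y) + (x' + s *\<^sub>R y) = x + x' + (t + s) *\<^sub>R y"
        by (simp add: algebra_simps)
      ultimately show "sublinear_cut p y (x + x') - (p (x' + s *\<^sub>R y) - s * p y) \<le> p (x + t *\<^sub>R y) - t * p y"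
        using sublinear_cut_le[OF p, of "t + s" y "x + x'"] s t by (simp add: algebra_simps)
    qed
    then show "sublinear_cut p y (x + x') - sublinear_cut p y x \<le> p (x' + s *\<^sub>R y) - s * p y"
      by simp
  qed
  then show "sublinear_cut p y (x + x') \<le> sublinear_cut p y x + sublinear_cut p y x'"
    by simp
next
  fix c :: real and x assume c: "0 < c"
  have "sublinear_cut p y (c *\<^sub>R x) / c \<le> sublinear_cut p y x"
  proof (rule sublinear_cut_greatest)
    fix t :: real assume t: "0 \<le> t"
    have "c *\<^sub>R x + (c * t) *\<^sub>R y = c *\<^sub>R (x + t *\<^sub>R y)"
      by (simp add: algebra_simps)
    then have "p (c *\<^sub>R x + (c * t) *\<^sub>R y) = c * p (x + t *\<^sub>R y)"
      using sublinear_scale[OF p, of c "x + t *\<^sub>R y"] c by simp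
    then show "sublinear_cut p y (c *\<^sub>R x) / c \<le> p (x + t *\<^sub>R y) - t * p y"
      using sublinear_cut_le[OF p, of "c * t" y "c *\<^sub>R x"] c t by (simp add: field_simps)
  qed
  then show "sublinear_cut p y (c *\<^sub>R x) \<le> c * sublinear_cut p y x"
    using c by (simp add: field_simps)
qed

text \<open>Zorn's lemma for the reversed pointwise order. The infimum over a chain is finite
  because every member is bounded below by \<open>- p (- x)\<close>, and it is subadditive because
  any two members of the chain are comparable.\<close>

lemma sublinear_minimal:
  fixes p :: "'a :: real_vector \<Rightarrow> real"
  assumes p: "sublinear p"
  obtains m where "sublinear m" "m \<le> p" "\<And>q. sublinear q \<Longrightarrow> q \<le> m \<Longrightarrow> q = m"
proof -
  define A where "A = {q. sublinear q \<and> q \<le> p}"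
  define P where "P = (\<lambda>f g :: 'a \<Rightarrow> real. g \<le> f)"
  have "\<exists>m\<in>A. \<forall>a\<in>A. P m a \<longrightarrow> a = m"
  proof (rule predicate_Zorn)
    show "partial_order_on A (relation_of P A)"
      by (rule partial_order_on_relation_ofI) (auto simp: P_def)
    fix C assume C: "C \<in> Chains (relation_of P A)"
    have CA: "q \<in> A" if "q \<in> C" for q
      using C that unfolding Chains_def relation_of_def by auto
    have chain: "q \<le> r \<or> r \<le> q" if "q \<in> C" "r \<in> C" for q r
      using C that unfolding Chains_def relation_of_def P_def by auto
    show "\<exists>u\<in>A. \<forall>a\<in>C. P a u"
    proof (cases "C = {}")
      case True
      then show ?thesis using p by (auto simp: A_def)
    next
      case False
      define g where "g x = (INF q\<in>C. q x)" for x
      have lower: "- p (- x) \<le> q x" if "q \<in> C" for q x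
        using sublinear_lower[of q x] CA[OF that] le_funD[of q p "- x"] by (auto simp: A_def)
      have g_le: "g x \<le> q x" if "q \<in> C" for q x
        unfolding g_def by (rule cINF_lower[OF _ that]) (use lower in \<open>auto intro!: bdd_belowI2\<close>)
      have g_ge: "b \<le> g x" if "\<And>q. q \<in> C \<Longrightarrow> b \<le> q x" for b x
        unfolding g_def by (rule cINF_greatest[OF False that])
      have "sublinear g"
        unfolding sublinear_def
      proof (intro conjI allI impI)
        fix x y
        have "g (x + y) - g x \<le> g y"
        proof (rule g_ge)
          fix r assume r: "r \<in> C"
          have "g (x + y) - r y \<le> g x"
          proof (rule g_ge)
            fix q assume q: "q \<in> C"
            have *: "s (x + y) \<le> s x + s y" if "s \<in> C" for s
              using CA[OF that] by (auto simp: A_def sublinear_def)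
            show "g (x + y) - r y \<le> q x"
              using chain[OF q r] *[OF q] *[OF r] g_le[OF q, of "x + y"] g_le[OF r, of "x + y"]
              by (auto dest: le_funD[of _ _ x] le_funD[of _ _ y])
          qed
          then show "g (x + y) - g x \<le> r y" by simp
        qed
        then show "g (x + y) \<le> g x + g y" by simp
      next
        fix c :: real and x assume c: "0 < c"
        have "g (c *\<^sub>R x) / c \<le> g x"
        proof (rule g_ge)
          fix q assume q: "q \<in> C"
          then have "q (c *\<^sub>R x) \<le> c * q x"
            using CA[OF q] c by (auto simp: A_def sublinear_def)
          then show "g (c *\<^sub>R x) / c \<le> q x"
            using g_le[OF q, of "c *\<^sub>R x"] c by (simp add: field_simps)
        qed
        then show "g (c *\<^sub>R x) \<le> c * g x" using c by (simp add: field_simps)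
      qed
      moreover have "g \<le> p"
      proof (rule le_funI)
        fix x
        obtain q where q: "q \<in> C" using False by blast
        then show "g x \<le> p x"
          using g_le[OF q, of x] CA[OF q] le_funD[of q p x] by (auto simp: A_def)
      qed
      ultimately show ?thesis
        using g_le by (auto simp: A_def P_def le_fun_def)
    qed
  qed
  then obtain m where m: "m \<in> A" "\<And>a. a \<in> A \<Longrightarrow> a \<le> m \<Longrightarrow> a = m"
    unfolding P_def by blast
  show thesis
    by (rule that[of m]) (use m in \<open>auto simp: A_def\<close>)
qed

text \<open>The minimal functional is taken below \<open>sublinear_cut p x0\<close> instead of below
  \<open>p\<close>: the cut forces the value at \<open>- x0\<close> down to \<open>- p x0\<close>,
  so that the odd functional attains \<open>p\<close> at \<open>x0\<close>.\<close>

theorem Hahn_Banach_sublinear: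
  fixes p :: "'a :: real_vector \<Rightarrow> real"
  assumes p: "sublinear p"
  obtains u where "linear u" "\<And>x. u x \<le> p x" "u x0 = p x0"
proof -
  obtain m where m: "sublinear m" "m \<le> sublinear_cut p x0"
      and min: "\<And>q. sublinear q \<Longrightarrow> q \<le> m \<Longrightarrow> q = m"
    using sublinear_minimal[OF sublinear_cut[OF p]] by blast
  have odd: "m (- y) = - m y" for y
  proof -
    have "sublinear_cut m y \<le> m"
      using sublinear_cut_le[OF m(1), of 0] by (auto simp: le_fun_def)
    then have "sublinear_cut m y = m"
      by (intro min sublinear_cut m(1))
    then have "m (- y) \<le> - m y"
      using sublinear_cut_le[OF m(1), of 1 y "- y"] sublinear_zero[OF m(1)] by simp
    moreover have "- m y \<le> m (- y)"
      using sublinear_lower[OF m(1), of "- y"] by simp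
    ultimately show ?thesis by simp
  qed
  have add: "m (x + y) = m x + m y" for x y
  proof -
    have "m (x + y) \<le> m x + m y" "m (- x + - y) \<le> m (- x) + m (- y)"
      using m(1) unfolding sublinear_def by blast+
    then show ?thesis
      using odd[of "x + y"] odd[of x] odd[of y] by simp
  qed
  have scale: "m (c *\<^sub>R x) = c * m x" for c x
    using sublinear_scale[OF m(1), of c x] sublinear_scale[OF m(1), of "- c" x] odd[of "c *\<^sub>R x"]
    by (cases "0 \<le> c") auto
  have le: "m x \<le> p x" for x
    using le_funD[OF m(2), of x] sublinear_cut_le[OF p, of 0 x0 x] by simp
  have "m (- x0) \<le> - p x0"
    using le_funD[OF m(2), of "- x0"] sublinear_cut_le[OF p, of 1 x0 "- x0"] sublinear_zero[OF p] by simp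
  then have "m x0 = p x0"
    using le[of x0] odd[of x0] by simp
  moreover have "linear m"
    by (rule linearI) (auto simp: add scale)
  ultimately show thesis
    using le that by blast
qed

text \<open>The complexification \<open>u x - i * u (i x)\<close> of a real functional
  \<open>u\<close>. Bounding the modulus by the sum of real and imaginary part gives the factor 2;
  only boundedness with a fixed constant matters later.\<close>

theorem complex_Hahn_Banach:
  fixes p :: "'a :: complex_normed_vector \<Rightarrow> real"
  assumes p: "sublinear p" and le: "\<And>x. p x \<le> norm x"
  obtains \<phi> :: "'a \<Rightarrow> complex" where
    "bounded_clinear \<phi>" "\<And>x. Re (\<phi> x) \<le> p x" "Re (\<phi> x0) = p x0" "\<And>x. norm (\<phi> x) \<le> 2 * norm x"
proof -
  obtain u where u: "linear u" "\<And>x. u x \<le> p x" "u x0 = p x0"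
    using Hahn_Banach_sublinear[OF p] by blast
  define \<phi> where "\<phi> x = Complex (u x) (- u (\<i> *\<^sub>C x))" for x
  have u_norm: "\<bar>u x\<bar> \<le> norm x" for x
    using u(2)[of x] u(2)[of "- x"] le[of x] le[of "- x"] linear_neg[OF u(1), of x] by simp
  have nb: "norm (\<phi> x) \<le> 2 * norm x" for x
    using cmod_le[of "\<phi> x"] u_norm[of x] u_norm[of "\<i> *\<^sub>C x"]
    by (simp add: \<phi>_def norm_scaleC)
  have sc: "c *\<^sub>C x = Re c *\<^sub>R x + Im c *\<^sub>R (\<i> *\<^sub>C x)" for c and x :: 'a
    by (simp add: scaleR_scaleC scaleC_scaleC flip: scaleC_add_left)
      (metis complex_eq mult.commute)
  have ii: "\<i> *\<^sub>C (\<i> *\<^sub>C x) = - x" for x :: 'a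
    by (simp add: scaleC_scaleC)
  have "bounded_clinear \<phi>"
  proof (rule bounded_clinearI[where K = 2])
    fix c :: complex and x :: 'a
    have "\<i> *\<^sub>C (c *\<^sub>C x) = Re c *\<^sub>R (\<i> *\<^sub>C x) + Im c *\<^sub>R (- x)"
      using sc[of c "\<i> *\<^sub>C x"] ii[of x] by (simp add: scaleC_scaleC mult.commute)
    then have "u (\<i> *\<^sub>C (c *\<^sub>C x)) = Re c * u (\<i> *\<^sub>C x) - Im c * u x"
      using u(1) by (simp add: linear_add linear_cmul linear_neg linear_diff)
    moreover have "u (c *\<^sub>C x) = Re c * u x + Im c * u (\<i> *\<^sub>C x)"
      using sc[of c x] u(1) by (simp add: linear_add linear_cmul)
    ultimately show "\<phi> (c *\<^sub>C x) = c *\<^sub>C \<phi> x"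
      by (simp add: \<phi>_def scaleC_complex_def complex_eq_iff)
  qed (use nb u(1) in \<open>simp_all add: \<phi>_def scaleC_add_right linear_add complex_eq_iff mult.commute\<close>)
  then show thesis
    using that[of \<phi>] u nb by (simp add: \<phi>_def)
qed

section \<open>Separation by functionals, closed subspaces and dual bases\<close>

lemma norming_functional:
  fixes x0 :: "'a :: complex_normed_vector"
  obtains \<phi> :: "'a \<Rightarrow> complex" where
    "bounded_clinear \<phi>" "norm x0 \<le> norm (\<phi> x0)" "\<And>x. norm (\<phi> x) \<le> 2 * norm x"
proof -
  have "sublinear (norm :: 'a \<Rightarrow> real)"
    by (auto simp: sublinear_def norm_triangle_ineq)
  then obtain \<phi> :: "'a \<Rightarrow> complex" where \<phi>: "bounded_clinear \<phi>" "Re (\<phi> x0) = norm x0" "\<And>x. norm (\<phi> x) \<le> 2 * norm x"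
    by (rule complex_Hahn_Banach[where p = norm and ?x0.0 = x0]) auto
  show thesis
    using that[OF \<phi>(1) _ \<phi>(3)] complex_Re_le_cmod[of "\<phi> x0"] \<phi>(2) by simp
qed

lemma functionals_separate:
  assumes "\<And>\<phi> :: 'a :: complex_normed_vector \<Rightarrow> complex. bounded_clinear \<phi> \<Longrightarrow> \<phi> x = \<phi> y"
  shows "x = y"
proof -
  obtain \<phi> :: "'a \<Rightarrow> complex" where \<phi>: "bounded_clinear \<phi>" "norm (x - y) \<le> norm (\<phi> (x - y))"
    using norming_functional[of "x - y"] by blast
  have "\<phi> (x - y) = \<phi> x - \<phi> y"
    using \<phi>(1) bounded_clinear_linear bounded_linear.linear linear_diff by blast
  with \<phi> assms[OF \<phi>(1)] show ?thesis by simp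
qed

lemma closed_subspace_functional:
  fixes M :: "'a :: complex_normed_vector set"
  assumes M: "csubspace M" "closed M" and x0: "x0 \<notin> M"
  obtains \<phi> :: "'a \<Rightarrow> complex" where "bounded_clinear \<phi>" "\<And>x. x \<in> M \<Longrightarrow> \<phi> x = 0" "\<phi> x0 = 1"
proof -
  have M0: "0 \<in> M" using M(1) by (rule complex_vector.subspace_0)
  \<comment> \<open>The distance to \<open>M\<close> vanishes on \<open>M\<close>, is positive at
    \<open>x0\<close> because \<open>M\<close> is closed, and is dominated by the norm.\<close>
  define p where "p x = infdist x M" for x
  have p_le: "p x \<le> norm (x - m)" if "m \<in> M" for x m
    using infdist_le[OF that, of x] by (simp add: p_def dist_norm)
  have p_ge: "b \<le> p x" if "\<And>m. m \<in> M \<Longrightarrow> b \<le> norm (x - m)" for b x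
    unfolding p_def using M0 that
    by (subst infdist_notempty) (auto intro!: cINF_greatest simp: dist_norm)
  have "sublinear p"
    unfolding sublinear_def
  proof (intro conjI allI impI)
    fix x y
    have "p (x + y) - p x \<le> p y"
    proof (rule p_ge)
      fix m assume m: "m \<in> M"
      have "p (x + y) - norm (y - m) \<le> p x"
      proof (rule p_ge)
        fix n assume n: "n \<in> M"
        have "p (x + y) \<le> norm (x + y - (n + m))"
          by (rule p_le) (use M(1) n m in \<open>auto intro: complex_vector.subspace_add\<close>)
        also have "\<dots> \<le> norm (x - n) + norm (y - m)"
          by (metis add_diff_add norm_triangle_ineq)
        finally show "p (x + y) - norm (y - m) \<le> norm (x - n)" by simp
      qed
      then show "p (x + y) - p x \<le> norm (y - m)" by simp
    qed
    then show "p (x + y) \<le> p x + p y" by simp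
  next
    fix c :: real and x assume c: "0 < c"
    have "p (c *\<^sub>R x) / c \<le> p x"
    proof (rule p_ge)
      fix m assume m: "m \<in> M"
      have "p (c *\<^sub>R x) \<le> norm (c *\<^sub>R x - c *\<^sub>R m)"
        by (rule p_le) (use M(1) m in \<open>auto simp: scaleR_scaleC intro: complex_vector.subspace_scale\<close>)
      also have "\<dots> = c * norm (x - m)"
        using c by (metis norm_scaleR abs_of_pos real_vector.scale_right_diff_distrib)
      finally show "p (c *\<^sub>R x) / c \<le> norm (x - m)" using c by (simp add: field_simps)
    qed
    then show "p (c *\<^sub>R x) \<le> c * p x" using c by (simp add: field_simps)
  qed
  moreover have "p x \<le> norm x" for x
    using p_le[OF M0, of x] by simp
  ultimately obtain \<phi> :: "'a \<Rightarrow> complex"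
    where \<phi>: "bounded_clinear \<phi>" "\<And>x. Re (\<phi> x) \<le> p x" "Re (\<phi> x0) = p x0"
    by (rule complex_Hahn_Banach[where p = p and ?x0.0 = x0]) auto
  have scale: "\<phi> (c *\<^sub>C x) = c * \<phi> x" for c x
    using bounded_clinear_scaleC[OF \<phi>(1)] by (simp add: scaleC_complex_def)
  \<comment> \<open>\<open>M\<close> is closed under multiplication by -1 and by the imaginary unit,
    so the one-sided bound on the real part kills both parts on \<open>M\<close>.\<close>
  have Re0: "Re (\<phi> x) = 0" if "x \<in> M" for x
  proof -
    have "Re (\<phi> x) \<le> 0" "Re (\<phi> ((-1) *\<^sub>C x)) \<le> 0"
      using \<phi>(2)[of x] \<phi>(2)[of "(-1) *\<^sub>C x"] that complex_vector.subspace_scale[OF M(1) that, of "-1"]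
      by (simp_all only: p_def infdist_zero)
    then show ?thesis unfolding scale by simp
  qed
  have M_zero: "\<phi> x = 0" if "x \<in> M" for x
    using Re0[OF that] Re0[OF complex_vector.subspace_scale[OF M(1) that, of \<i>]]
    unfolding scale by (simp add: complex_eq_iff)
  have "p x0 \<noteq> 0"
    using in_closed_iff_infdist_zero[OF M(2), of x0] M0 x0 by (auto simp: p_def)
  then have nz: "\<phi> x0 \<noteq> 0" using \<phi>(3) by auto
  show thesis
  proof (rule that[of "\<lambda>x. \<phi> ((1 / \<phi> x0) *\<^sub>C x)"])
    have "bounded_clinear (\<lambda>x :: 'a. (1 / \<phi> x0) *\<^sub>C x)"
      by (auto simp: bounded_clinear_def bounded_linear_scaleC scaleC_scaleC mult.commute)
    then show "bounded_clinear (\<lambda>x. \<phi> ((1 / \<phi> x0) *\<^sub>C x))"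
      by (rule bounded_clinear_compose[OF \<phi>(1)])
  qed (use M_zero nz in \<open>auto simp: scale\<close>)
qed

text \<open>When a vector \<open>v\<close> outside a closed subspace \<open>N\<close> is added, a
  bounded functional that vanishes on \<open>N\<close> and is 1 at \<open>v\<close> reads off the
  coefficient of \<open>v\<close>. The larger span is therefore the preimage of \<open>N\<close>
  under a continuous map.\<close>

lemma closed_span_Un:
  fixes M :: "'a :: complex_normed_vector set"
  assumes "csubspace M" "closed M" "finite B"
  shows "closed (cspan (M \<union> B))"
  using assms(3)
proof (induction B)
  case empty
  then show ?case
    by (simp add: complex_vector.span_eq_iff[THEN iffD2, OF assms(1)] assms(2))
next
  case (insert v B)
  define N where "N = cspan (M \<union> B)"
  have N: "csubspace N" "closed N"
    using insert.IH by (auto simp: N_def)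
  have eq: "cspan (M \<union> insert v B) = {x. \<exists>k. x - k *\<^sub>C v \<in> N}"
    using complex_vector.span_insert[of v "M \<union> B"] by (simp add: N_def)
  show ?case
  proof (cases "v \<in> N")
    case True
    then have "cspan (M \<union> insert v B) = N"
      unfolding N_def by (simp add: complex_vector.span_redundant)
    with N show ?thesis by simp
  next
    case False
    obtain \<phi> :: "'a \<Rightarrow> complex" where \<phi>: "bounded_clinear \<phi>" "\<And>x. x \<in> N \<Longrightarrow> \<phi> x = 0" "\<phi> v = 1"
      using closed_subspace_functional[OF N False] by blast
    have lin: "bounded_linear \<phi>" using \<phi>(1) by (rule bounded_clinear_linear)
    have k: "k = \<phi> x" if "x - k *\<^sub>C v \<in> N" for x k
      using \<phi>(2)[OF that] \<phi>(3) bounded_clinear_scaleC[OF \<phi>(1), of k v]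
        linear_diff[OF bounded_linear.linear[OF lin], of x "k *\<^sub>C v"]
      by (simp add: scaleC_complex_def)
    have "cspan (M \<union> insert v B) = (\<lambda>x. x - \<phi> x *\<^sub>C v) -` N"
      unfolding eq using k by auto
    moreover have "continuous_on UNIV (\<lambda>x. x - \<phi> x *\<^sub>C v)"
    proof -
      have "bounded_clinear (\<lambda>c. c *\<^sub>C v)"
        by (rule bounded_clinearI[where K = "norm v"])
          (simp_all add: scaleC_add_left scaleC_scaleC norm_scaleC scaleC_complex_def)
      then have "bounded_linear (\<lambda>c. c *\<^sub>C v)"
        by (rule bounded_clinear_linear)
      then show ?thesis
        using linear_continuous_on[OF bounded_linear_compose[OF _ lin]]
        by (intro continuous_on_diff continuous_on_id) blast
    qed
    ultimately show ?thesis
      using N(2) by (simp add: continuous_on_closed_vimage[OF closed_UNIV])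
  qed
qed

lemma closed_span_finite:
  fixes B :: "'a :: complex_normed_vector set"
  shows "finite B \<Longrightarrow> closed (cspan B)"
  using closed_span_Un[of "{0}" B] complex_vector.subspace_single_0
    complex_vector.span_insert_0[of B] by simp

text \<open>The span of the other basis vectors is closed, being finite dimensional, and misses
  \<open>b\<close>; hence a functional separates \<open>b\<close> from it.\<close>

lemma dual_basis:
  fixes B :: "'a :: complex_normed_vector set"
  assumes B: "finite B" "\<not> cdependent B"
  obtains \<phi> :: "'a \<Rightarrow> 'a \<Rightarrow> complex" where
    "\<And>b. b \<in> B \<Longrightarrow> bounded_clinear (\<phi> b)" "\<And>b c. b \<in> B \<Longrightarrow> c \<in> B \<Longrightarrow> \<phi> b c = (if b = c then 1 else 0)"
proof -
  have "\<exists>\<psi> :: 'a \<Rightarrow> complex. bounded_clinear \<psi> \<and> (\<forall>c\<in>B. \<psi> c = (if b = c then 1 else 0))" if b: "b \<in> B" for b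
  proof -
    have "b \<notin> cspan (B - {b})"
      using B(2) b complex_vector.dependent_def by blast
    moreover have "closed (cspan (B - {b}))"
      using B(1) by (intro closed_span_finite) auto
    ultimately obtain \<psi> :: "'a \<Rightarrow> complex" where
      "bounded_clinear \<psi>" "\<And>x. x \<in> cspan (B - {b}) \<Longrightarrow> \<psi> x = 0" "\<psi> b = 1"
      using closed_subspace_functional[of "cspan (B - {b})" b] by auto
    then show ?thesis
      by (intro exI[of _ \<psi>]) (auto intro: complex_vector.span_base)
  qed
  then obtain \<phi> :: "'a \<Rightarrow> 'a \<Rightarrow> complex" where
    "\<forall>b\<in>B. bounded_clinear (\<phi> b) \<and> (\<forall>c\<in>B. \<phi> b c = (if b = c then 1 else 0))"
    by metis
  then show thesis using that[of \<phi>] by blast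
qed


section \<open>The open mapping theorem\<close>

text \<open>In the relative topology of \<open>V\<close>, because the open mapping theorem below has
  to cover images that are proper closed subspaces.\<close>

lemma Baire_closed:
  fixes V :: "'a :: {real_normed_vector, banach} set" and F :: "nat \<Rightarrow> 'a set"
  assumes V: "closed V" "V \<noteq> {}" and F: "\<And>n. closed (F n)" "V \<subseteq> (\<Union>n. F n)"
  obtains n v e where "v \<in> V" "0 < e" "V \<inter> ball v e \<subseteq> F n"
proof -
  have compl: "completely_metrizable_space (top_of_set V)"
    using V(1) completely_metrizable_space_closedin completely_metrizable_space_euclidean
    by (metis closed_closedin)
  have "\<exists>n. top_of_set V interior_of (V \<inter> F n) \<noteq> {}"
  proof (rule ccontr)
    assume "\<not> ?thesis"
    then have "top_of_set V interior_of \<Union> (range (\<lambda>n. V \<inter> F n)) = {}"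
      by (intro Baire_category_alt) (use compl F(1) in \<open>auto simp: closedin_closed_Int\<close>)
    moreover have "\<Union> (range (\<lambda>n. V \<inter> F n)) = topspace (top_of_set V)"
      using F(2) by auto
    ultimately show False
      using V(2) by (metis interior_of_topspace topspace_euclidean_subtopology)
  qed
  then obtain n v U where U: "openin (top_of_set V) U" "v \<in> U" "U \<subseteq> V \<inter> F n"
    unfolding interior_of_def by blast
  then obtain e where "0 < e" "ball v e \<inter> V \<subseteq> U" "v \<in> V"
    by (metis openin_contains_ball le_inf_iff subset_iff)
  then show thesis
    using that[of v e n] U(3) by blast
qed

text \<open>Stated for the restriction to a closed subspace because it is applied to the
  intersection of the ranges of all powers of an operator, which \<open>T - l\<close> maps onto
  itself. By category, images of a ball are dense in some relative ball; successive corrections then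
  turn approximate preimages into exact ones.\<close>

theorem open_mapping:
  fixes T :: "'a :: complex_banach \<Rightarrow>\<^sub>C\<^sub>L 'b :: complex_banach"
  assumes W: "csubspace W" "closed W" and TW: "closed (T ` W)"
  obtains C where "0 < C" "\<And>y. y \<in> T ` W \<Longrightarrow> \<exists>x\<in>W. T x = y \<and> norm x \<le> C * norm y"
proof -
  define V where "V = T ` W"
  note add = complex_vector.subspace_add[OF W(1)] and diff = complex_vector.subspace_diff[OF W(1)]
    and scale = complex_vector.subspace_scale[OF W(1)] and zero = complex_vector.subspace_0[OF W(1)]
  have V_diff: "x - y \<in> V" and V_add: "x + y \<in> V" if xy: "x \<in> V" "y \<in> V" for x y
  proof -
    obtain a b where ab: "a \<in> W" "b \<in> W" "x = T a" "y = T b"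
      using xy by (auto simp: V_def)
    show "x - y \<in> V" "x + y \<in> V"
      using imageI[OF diff[OF ab(1,2)], of T] imageI[OF add[OF ab(1,2)], of T] ab(3,4)
      by (simp_all add: V_def)
  qed
  have V_scale: "c *\<^sub>C x \<in> V" if x: "x \<in> V" for c x
  proof -
    obtain a where a: "a \<in> W" "x = T a"
      using x by (auto simp: V_def)
    show ?thesis
      using imageI[OF scale[OF a(1), of c], of T] a(2) by (simp add: V_def)
  qed
  have "V \<noteq> {}" using zero by (auto simp: V_def)
  have "V \<subseteq> (\<Union>n. closure (T ` (W \<inter> cball 0 (real n))))"
  proof
    fix y assume "y \<in> V"
    then obtain x where x: "x \<in> W" "y = T x" by (auto simp: V_def)
    obtain n where "norm x \<le> real n" using real_arch_simple by blast
    with x have "y \<in> T ` (W \<inter> cball 0 (real n))" by auto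
    then show "y \<in> (\<Union>n. closure (T ` (W \<inter> cball 0 (real n))))"
      using closure_subset[of "T ` (W \<inter> cball 0 (real n))"] by auto
  qed
  then obtain n v e where v: "v \<in> V" and e: "0 < e" and ball: "V \<inter> ball v e \<subseteq> closure (T ` (W \<inter> cball 0 (real n)))"
    using Baire_closed[of V "\<lambda>n. closure (T ` (W \<inter> cball 0 (real n)))"] TW \<open>V \<noteq> {}\<close>
    unfolding V_def by (metis closed_closure)
  have approx: "\<exists>x\<in>W. norm x \<le> real n \<and> norm (y - T x) < d" if "y \<in> V" "norm (y - v) < e" "0 < d" for y d
  proof -
    have "y \<in> closure (T ` (W \<inter> cball 0 (real n)))"
      using ball that by (auto simp: dist_norm norm_minus_commute)
    then obtain z where z: "z \<in> T ` (W \<inter> cball 0 (real n))" "dist z y < d"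
      using \<open>0 < d\<close> unfolding closure_approachable by blast
    then obtain x where "x \<in> W" "norm x \<le> real n" "z = T x"
      by auto
    with z(2) show ?thesis
      by (intro bexI[of _ x]) (simp_all add: dist_norm norm_minus_commute)
  qed
  \<comment> \<open>\<open>y\<close> is scaled to length \<open>e / 2\<close> and approximated by a
    difference of approximants of \<open>v + z\<close> and \<open>v\<close>, each with error
    \<open>e / 8\<close>. The preimage has norm at most \<open>2 * n\<close>, and undoing the
    scaling multiplies by \<open>2 * norm y / e\<close>.\<close>
  define K where "K = 4 * real n / e"
  have "0 \<le> K" using e by (simp add: K_def)
  have half: "\<exists>x\<in>W. norm x \<le> K * norm y \<and> norm (y - T x) \<le> norm y / 2" if y: "y \<in> V" for y
  proof (cases "y = 0")
    case True
    then show ?thesis using zero by (intro bexI[of _ 0]) auto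
  next
    case False
    define t where "t = e / (2 * norm y)"
    have t: "0 < t" using e False by (simp add: t_def)
    define z where "z = complex_of_real t *\<^sub>C y"
    have z: "z \<in> V" "norm z = e / 2"
    proof -
      show "z \<in> V" using V_scale[OF y] by (simp add: z_def)
      have "norm z = t * norm y" using t by (simp add: z_def norm_scaleC)
      then show "norm z = e / 2" using False by (simp add: t_def)
    qed
    have e8: "0 < e / 8" and vz: "norm (v + z - v) < e" and vv: "norm (v - v) < e"
      using e z(2) by simp_all
    obtain x1 where x1: "x1 \<in> W" "norm x1 \<le> real n" "norm (v + z - T x1) < e / 8"
      using approx[OF V_add[OF v z(1)] vz e8] by blast
    obtain x2 where x2: "x2 \<in> W" "norm x2 \<le> real n" "norm (v - T x2) < e / 8"
      using approx[OF v vv e8] by blast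
    define x where "x = complex_of_real (1 / t) *\<^sub>C (x1 - x2)"
    have "norm (x1 - x2) \<le> 2 * real n"
      using norm_triangle_ineq4[of x1 x2] x1 x2 by simp
    then have "norm x \<le> (1 / t) * (2 * real n)"
      using t by (simp add: x_def norm_scaleC norm_divide divide_right_mono)
    also have "\<dots> = K * norm y"
      using e False by (simp add: t_def K_def field_simps)
    finally have "norm x \<le> K * norm y" .
    have "norm (z - T (x1 - x2)) \<le> e / 4"
      using norm_triangle_ineq4[of "v + z - T x1" "v - T x2"] x1(3) x2(3) by (simp add: algebra_simps)
    moreover have "y - T x = complex_of_real (1 / t) *\<^sub>C (z - T (x1 - x2))"
      using t by (simp add: x_def z_def complex_vector.scale_right_diff_distrib scaleC_scaleC)
    ultimately have "norm (y - T x) \<le> (1 / t) * (e / 4)"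
      using t mult_left_mono[of "norm (z - T (x1 - x2))" "e / 4" "1 / t"]
      by (simp only: norm_scaleC) (simp add: norm_divide)
    also have "\<dots> = norm y / 2"
    proof -
      have eq: "e = t * (2 * norm y)" using False by (simp add: t_def)
      show ?thesis using t unfolding eq by simp
    qed
    finally show ?thesis
      using \<open>norm x \<le> K * norm y\<close> scale[OF diff[OF x1(1) x2(1)]] by (auto simp: x_def)
  qed
  obtain g where g: "\<And>y. y \<in> V \<Longrightarrow> g y \<in> W" "\<And>y. y \<in> V \<Longrightarrow> norm (g y) \<le> K * norm y"
      "\<And>y. y \<in> V \<Longrightarrow> norm (y - T (g y)) \<le> norm y / 2"
    using half by metis
  show thesis
  \<comment> \<open>The errors halve, so the corrections sum to at most
    \<open>2 * K * norm y\<close>; the added 1 keeps the constant positive when \<open>K\<close> is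
    0.\<close>
  proof (rule that[of "2 * K + 1"])
    fix y assume "y \<in> T ` W"
    then have y: "y \<in> V" by (simp add: V_def)
    \<comment> \<open>The error that remains after \<open>k\<close> corrections.\<close>
    define r where "r k = ((\<lambda>y. y - T (g y)) ^^ k) y" for k
    have r_Suc: "r (Suc k) = r k - T (g (r k))" for k
      by (simp add: r_def)
    have rV: "r k \<in> V" for k
    proof (induction k)
      case (Suc k)
      have "T (g (r k)) \<in> V" using g(1)[OF Suc] by (auto simp: V_def)
      then show ?case using Suc V_diff by (simp add: r_Suc)
    qed (simp add: r_def y)
    have r_norm: "norm (r k) \<le> norm y * (1 / 2) ^ k" for k
    proof (induction k)
      case (Suc k)
      then show ?case using g(3)[OF rV[of k]] by (simp add: r_Suc)
    qed (simp add: r_def)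
    have g_norm: "norm (g (r k)) \<le> K * norm y * (1 / 2) ^ k" for k
      using order_trans[OF g(2)[OF rV[of k]] mult_left_mono[OF r_norm[of k] \<open>0 \<le> K\<close>]]
      by (simp add: mult.assoc)
    have sm: "summable (\<lambda>k. K * norm y * (1 / 2) ^ k)"
      by (intro summable_mult) (simp add: summable_geometric)
    have sn: "summable (\<lambda>k. norm (g (r k)))"
      by (rule summable_comparison_test'[OF sm]) (use g_norm in simp)
    then have s: "summable (\<lambda>k. g (r k))"
      by (rule summable_norm_cancel)
    define x where "x = (\<Sum>k. g (r k))"
    have "x \<in> W"
      unfolding x_def suminf_eq_lim
    proof (rule Lim_in_closed_set[OF W(2)])
      show "(\<lambda>n. \<Sum>i<n. g (r i)) \<longlonglongrightarrow> lim (\<lambda>n. \<Sum>i<n. g (r i))"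
        using s by (simp add: summable_iff_convergent convergent_LIMSEQ_iff)
      show "\<forall>\<^sub>F n in sequentially. (\<Sum>i<n. g (r i)) \<in> W"
        using g(1)[OF rV] by (auto intro!: always_eventually complex_vector.subspace_sum[OF W(1)])
    qed auto
    moreover have "T x = y"
    proof (rule LIMSEQ_unique)
      show "(\<lambda>n. T (\<Sum>i<n. g (r i))) \<longlonglongrightarrow> T x"
        unfolding x_def by (rule bounded_linear.tendsto[OF bounded_linear_apply summable_LIMSEQ[OF s]])
      have "T (\<Sum>i<n. g (r i)) = y - r n" for n
        by (induction n) (simp_all add: r_Suc, simp add: r_def)
      moreover have "r \<longlonglongrightarrow> 0"
      proof (rule Lim_null_comparison)
        show "\<forall>\<^sub>F k in sequentially. norm (r k) \<le> norm y * (1 / 2) ^ k"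
          using r_norm by (intro always_eventually) auto
        show "(\<lambda>k. norm y * (1 / 2) ^ k) \<longlonglongrightarrow> 0"
          by (intro tendsto_mult_right_zero LIMSEQ_power_zero) auto
      qed
      ultimately show "(\<lambda>n. T (\<Sum>i<n. g (r i))) \<longlonglongrightarrow> y"
        using tendsto_diff[OF tendsto_const[of y], of r 0] by simp
    qed
    moreover have "norm x \<le> (2 * K + 1) * norm y"
    proof -
      have "norm x \<le> (\<Sum>k. norm (g (r k)))"
        unfolding x_def by (rule summable_norm[OF sn])
      also have "\<dots> \<le> (\<Sum>k. K * norm y * (1 / 2) ^ k)"
        by (rule suminf_le[OF g_norm sn sm])
      also have "\<dots> = 2 * K * norm y"
        by (simp add: suminf_mult suminf_geometric summable_geometric)
      also have "\<dots> \<le> (2 * K + 1) * norm y"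
        by (simp add: algebra_simps)
      finally show ?thesis .
    qed
    ultimately show "\<exists>x\<in>W. T x = y \<and> norm x \<le> (2 * K + 1) * norm y" by blast
  qed (use \<open>0 \<le> K\<close> in simp)
qed

corollary bij_invertible:
  fixes T :: "'a :: complex_banach \<Rightarrow>\<^sub>C\<^sub>L 'a"
  assumes "bij (cblinfun_apply T)"
  shows "invertible_cblinfun T"
proof -
  have inj: "x = y" if "T x = T y" for x y
    using assms that by (meson bij_def injD)
  have surj: "range (cblinfun_apply T) = UNIV"
    using assms by (simp add: bij_def)
  obtain C where C: "0 < C" "\<And>y. \<exists>x. T x = y \<and> norm x \<le> C * norm y"
    by (rule open_mapping[of UNIV T]) (use surj in auto)
  define g where "g = inv (cblinfun_apply T)"
  have Tg: "T (g y) = y" for y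
    unfolding g_def by (simp add: surj surj_f_inv_f)
  have gT: "g (T x) = x" for x
    by (rule inj) (rule Tg)
  have "bounded_clinear g"
  proof (rule bounded_clinearI[where K = C])
    show "norm (g y) \<le> norm y * C" for y
      using C(2)[of y] Tg[of y] inj by (metis mult.commute)
    show "g (x + y) = g x + g y" for x y by (rule inj) (simp only: apply_add Tg)
    show "g (c *\<^sub>C x) = c *\<^sub>C g x" for c x by (rule inj) (simp only: apply_scaleC Tg)
  qed
  then have G: "CBlinfun g x = g x" for x
    by (rule CBlinfun_apply)
  have "CBlinfun g o\<^sub>C T = id_cblinfun" "T o\<^sub>C CBlinfun g = id_cblinfun"
    by (rule cblinfun_eqI, simp only: apply_compose apply_id G gT Tg)+
  then show ?thesis
    by (rule inverse_unique(2))
qed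


section \<open>Weyl operators as finite rank perturbations of invertible operators\<close>

lemma image_cspan: "cblinfun_apply T ` cspan S = cspan (cblinfun_apply T ` S)"
proof (rule antisym)
  have "csubspace {x. T x \<in> cspan (cblinfun_apply T ` S)}"
    by (rule complex_vector.subspaceI)
      (auto intro: complex_vector.span_zero complex_vector.span_add complex_vector.span_scale)
  moreover have "S \<subseteq> {x. T x \<in> cspan (cblinfun_apply T ` S)}"
    by (auto intro: complex_vector.span_base)
  ultimately have "cspan S \<subseteq> {x. T x \<in> cspan (cblinfun_apply T ` S)}"
    by (intro complex_vector.span_minimal)
  then show "cblinfun_apply T ` cspan S \<subseteq> cspan (cblinfun_apply T ` S)" by blast
  have "csubspace (cblinfun_apply T ` cspan S)"
  proof (rule complex_vector.subspaceI)
    show "0 \<in> cblinfun_apply T ` cspan S"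
      using imageI[OF complex_vector.span_zero, of T S] by simp
    show "x + y \<in> cblinfun_apply T ` cspan S"
      if xy: "x \<in> cblinfun_apply T ` cspan S" "y \<in> cblinfun_apply T ` cspan S" for x y
    proof -
      obtain a b where ab: "a \<in> cspan S" "x = T a" "b \<in> cspan S" "y = T b"
        using xy by blast
      show ?thesis
        using imageI[OF complex_vector.span_add[OF ab(1,3)], of T] ab(2,4) by simp
    qed
    show "c *\<^sub>C x \<in> cblinfun_apply T ` cspan S" if x: "x \<in> cblinfun_apply T ` cspan S" for c x
    proof -
      obtain a where a: "a \<in> cspan S" "x = T a"
        using x by blast
      show ?thesis
        using imageI[OF complex_vector.span_scale[OF a(1), of c], of T] a(2) by simp
    qed
  qed
  then show "cspan (cblinfun_apply T ` S) \<subseteq> cblinfun_apply T ` cspan S"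
    by (intro complex_vector.span_minimal image_mono) (auto intro: complex_vector.span_base)
qed

lemma csubspace_range: "csubspace (range (cblinfun_apply T))"
proof -
  have "csubspace (cblinfun_apply T ` cspan UNIV)"
    unfolding image_cspan by (rule complex_vector.subspace_span)
  then show ?thesis by (simp only: complex_vector.span_UNIV)
qed

lemma csubspace_null_space: "csubspace (null_space T)"
  by (rule complex_vector.subspaceI) (simp_all add: null_space_def)

lemma closed_null_space: "closed (null_space T)"
proof -
  have "null_space T = cblinfun_apply T -` {0}"
    by (auto simp: null_space_def)
  moreover have "continuous_on UNIV (cblinfun_apply T)"
    by (intro linear_continuous_on bounded_linear_apply)
  ultimately show ?thesis
    using continuous_on_closed_vimage[OF closed_UNIV, of "cblinfun_apply T"] closed_singleton[of 0] by simp
qed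

lemma cspan_finite_sum:
  "finite B \<Longrightarrow> x \<in> cspan B \<longleftrightarrow> (\<exists>u. x = (\<Sum>b\<in>B. u b *\<^sub>C b))"
  by (simp add: complex_vector.span_finite image_iff)

lemma cindependent_sum_zero:
  assumes "finite B" "\<not> cdependent B" "(\<Sum>b\<in>B. u b *\<^sub>C b) = 0" "b \<in> B"
  shows "u b = 0"
  by (rule complex_vector.independentD[OF assms(2,1) subset_refl assms(3,4)])

lemma cspan_Int_disjoint:
  assumes B: "finite B" "\<not> cdependent B" and A: "A \<subseteq> B"
    and x: "x \<in> cspan A" "x \<in> cspan (B - A)"
  shows "x = 0"
proof -
  have fin: "finite A" "finite (B - A)"
    using B(1) A finite_subset by auto
  obtain u where u: "x = (\<Sum>b\<in>A. u b *\<^sub>C b)"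
    using x(1) cspan_finite_sum[OF fin(1)] by blast
  obtain w where w: "x = (\<Sum>b\<in>B - A. w b *\<^sub>C b)"
    using x(2) cspan_finite_sum[OF fin(2)] by blast
  define v where "v b = (if b \<in> A then u b else - w b)" for b
  have "(\<Sum>b\<in>B. v b *\<^sub>C b) = (\<Sum>b\<in>B - A. v b *\<^sub>C b) + (\<Sum>b\<in>A. v b *\<^sub>C b)"
    by (rule sum.subset_diff[OF A B(1)])
  also have "(\<Sum>b\<in>A. v b *\<^sub>C b) = x"
    unfolding u by (rule sum.cong) (auto simp: v_def)
  also have "(\<Sum>b\<in>B - A. v b *\<^sub>C b) = (\<Sum>b\<in>B - A. - (w b *\<^sub>C b))"
    by (rule sum.cong) (auto simp: v_def complex_vector.scale_minus_left)
  also have "\<dots> = - x"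
    unfolding w by (rule sum_negf)
  finally have "(\<Sum>b\<in>B. v b *\<^sub>C b) = 0" by simp
  then have "v b = 0" if "b \<in> B" for b
    using cindependent_sum_zero[OF B] that by blast
  then have "(\<Sum>b\<in>A. u b *\<^sub>C b) = 0"
    using A by (intro sum.neutral) (auto simp: v_def, metis complex_vector.scale_zero_left subsetD)
  with u show ?thesis by simp
qed

lemma cindependent_image:
  fixes T :: "'a :: complex_normed_vector \<Rightarrow>\<^sub>C\<^sub>L 'b :: complex_normed_vector"
  assumes B: "finite B" "\<not> cdependent B" and T: "\<And>x. x \<in> cspan B \<Longrightarrow> T x = 0 \<Longrightarrow> x = 0"
  shows "\<not> cdependent (cblinfun_apply T ` B)" "inj_on (cblinfun_apply T) B"
proof -
  show inj: "inj_on (cblinfun_apply T) B"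
  proof (rule inj_onI)
    fix x y assume xy: "x \<in> B" "y \<in> B" "T x = T y"
    then have "x - y = 0"
      by (intro T complex_vector.span_diff) (auto intro: complex_vector.span_base)
    then show "x = y" by simp
  qed
  show "\<not> cdependent (cblinfun_apply T ` B)"
  proof (rule complex_vector.independent_if_scalars_zero)
    fix f x assume sum: "(\<Sum>y\<in>cblinfun_apply T ` B. f y *\<^sub>C y) = 0" and x: "x \<in> cblinfun_apply T ` B"
    have "T (\<Sum>b\<in>B. f (T b) *\<^sub>C b) = 0"
      using sum by (simp add: sum.reindex[OF inj] apply_sum)
    then have "(\<Sum>b\<in>B. f (T b) *\<^sub>C b) = 0"
      by (intro T complex_vector.span_sum complex_vector.span_scale) (auto intro: complex_vector.span_base)
    then have "f (T b) = 0" if "b \<in> B" for b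
      using cindependent_sum_zero[OF B, of "\<lambda>b. f (T b)"] that by simp
    with x show "f x = 0" by auto
  qed (use B in auto)
qed

section \<open>Dimensions of subspaces and of quotients\<close>

lemma edim_finite:
  assumes "finite B" "V \<subseteq> cspan B"
  shows "edim V = enat (cdim V)"
  using assms by (auto simp: edim_def)

lemma finite_cbasis:
  assumes "finite B" "V \<subseteq> cspan B"
  obtains N where "finite N" "N \<subseteq> V" "\<not> cdependent N" "V \<subseteq> cspan N" "card N = cdim V"
proof -
  obtain N where N: "N \<subseteq> V" "\<not> cdependent N" "V \<subseteq> cspan N" "card N = cdim V"
    using complex_vector.basis_exists by blast
  moreover have "finite N"
    using complex_vector.independent_span_bound[OF assms(1) N(2)] N(1) assms(2) by blast
  ultimately show thesis using that by blast
qed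

lemma quotient_basis_independent:
  "quotient_basis M B \<Longrightarrow> finite F \<Longrightarrow> F \<subseteq> B \<Longrightarrow> (\<Sum>b\<in>F. u b *\<^sub>C b) \<in> M \<Longrightarrow> b \<in> F \<Longrightarrow> u b = 0"
  unfolding quotient_basis_def by metis

lemma quotient_basis_spanning:
  assumes "quotient_basis M B"
  obtains F u where "finite F" "F \<subseteq> B" "x - (\<Sum>b\<in>F. u b *\<^sub>C b) \<in> M"
  using assms unfolding quotient_basis_def by metis

text \<open>Makes the choice inside \<open>quotient_edim\<close> harmless. \<open>\<pi>\<close>
  moves each vector within its coset into the span of \<open>B\<close>; independence of
  \<open>C\<close> modulo \<open>M\<close> makes \<open>\<pi>\<close> injective on \<open>C\<close>
  with independent image, so a count in the span of \<open>B\<close> applies.\<close>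

lemma quotient_basis_card_le:
  assumes M: "csubspace M" and B: "quotient_basis M B" "finite B" and C: "quotient_basis M C" "finite C"
  shows "card C \<le> card B"
proof -
  have "\<exists>u. x - (\<Sum>b\<in>B. u b *\<^sub>C b) \<in> M" for x
  proof -
    obtain F u where F: "finite F" "F \<subseteq> B" "x - (\<Sum>b\<in>F. u b *\<^sub>C b) \<in> M"
      using B(1) unfolding quotient_basis_def by metis
    have "(\<Sum>b\<in>F. u b *\<^sub>C b) = (\<Sum>b\<in>B. (if b \<in> F then u b else 0) *\<^sub>C b)"
      using F(2) B(2) by (intro sum.mono_neutral_cong_left) auto
    with F(3) show ?thesis by metis
  qed
  then obtain u where u: "\<And>x. x - (\<Sum>b\<in>B. u x b *\<^sub>C b) \<in> M" by metis
  define \<pi> where "\<pi> x = (\<Sum>b\<in>B. u x b *\<^sub>C b)" for x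
  have \<pi>: "x - \<pi> x \<in> M" for x
    using u by (simp add: \<pi>_def)
  have indep: "v c = 0" if "(\<Sum>c\<in>C. v c *\<^sub>C \<pi> c) = 0" "c \<in> C" for v c
  proof -
    have "(\<Sum>c\<in>C. v c *\<^sub>C (c - \<pi> c)) \<in> M"
      using \<pi> by (intro complex_vector.subspace_sum[OF M] complex_vector.subspace_scale[OF M])
    moreover have "(\<Sum>c\<in>C. v c *\<^sub>C (c - \<pi> c)) = (\<Sum>c\<in>C. v c *\<^sub>C c)"
      using that(1) by (simp add: complex_vector.scale_right_diff_distrib sum_subtractf)
    ultimately show ?thesis
      using C that(2) unfolding quotient_basis_def by (metis order_refl)
  qed
  have inj: "inj_on \<pi> C"
  proof (rule inj_onI, rule ccontr)
    fix c d assume cd: "c \<in> C" "d \<in> C" "\<pi> c = \<pi> d" "c \<noteq> d"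
    define v where "v x = (if x = c then 1 else if x = d then - 1 else 0 :: complex)" for x
    have "(\<Sum>x\<in>C. v x *\<^sub>C \<pi> x) = (\<Sum>x\<in>{c, d}. v x *\<^sub>C \<pi> x)"
      using cd C(2) by (intro sum.mono_neutral_right) (auto simp: v_def)
    also have "\<dots> = 0" using cd(3,4) by (simp add: v_def complex_vector.scale_minus_left)
    finally have "v c = 0" using indep cd(1) by blast
    then show False by (simp add: v_def)
  qed
  have "\<not> cdependent (\<pi> ` C)"
  proof (rule complex_vector.independent_if_scalars_zero)
    fix f x assume sum: "(\<Sum>y\<in>\<pi> ` C. f y *\<^sub>C y) = 0" and x: "x \<in> \<pi> ` C"
    then have "f (\<pi> c) = 0" if "c \<in> C" for c
      using indep[of "\<lambda>c. f (\<pi> c)"] that by (simp add: sum.reindex[OF inj])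
    with x show "f x = 0" by auto
  qed (use C in auto)
  moreover have "\<pi> ` C \<subseteq> cspan B"
    by (auto simp: \<pi>_def intro!: complex_vector.span_sum complex_vector.span_scale intro: complex_vector.span_base)
  ultimately have "card (\<pi> ` C) \<le> card B"
    using complex_vector.independent_span_bound[OF B(2)] by blast
  then show ?thesis by (simp add: card_image inj)
qed

lemma quotient_edim_eq:
  assumes M: "csubspace M" and B: "quotient_basis M B" "finite B"
  shows "quotient_edim M = enat (card B)"
proof -
  define C where "C = (SOME C. finite C \<and> quotient_basis M C)"
  have "finite C \<and> quotient_basis M C"
    unfolding C_def by (rule someI_ex) (use B in blast)
  then have "card C = card B"
    using quotient_basis_card_le[OF M] B by (meson antisym)
  then show ?thesis
    using B unfolding quotient_edim_def C_def by auto
qed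

section \<open>Finite rank operators\<close>

definition finite_rank :: "('a :: complex_normed_vector \<Rightarrow>\<^sub>C\<^sub>L 'b :: complex_normed_vector) \<Rightarrow> bool" where
  "finite_rank F \<longleftrightarrow> (\<exists>B. finite B \<and> range (cblinfun_apply F) \<subseteq> cspan B)"

lemma finite_rank_compose_right: "finite_rank F \<Longrightarrow> finite_rank (F o\<^sub>C T)"
  unfolding finite_rank_def by (auto simp: image_subset_iff)

lemma finite_rank_compose_left:
  assumes "finite_rank F"
  shows "finite_rank (T o\<^sub>C F)"
proof -
  obtain B where B: "finite B" "range (cblinfun_apply F) \<subseteq> cspan B"
    using assms unfolding finite_rank_def by blast
  have "range (cblinfun_apply (T o\<^sub>C F)) \<subseteq> cspan (cblinfun_apply T ` B)"
    unfolding image_cspan[symmetric] using B(2) by auto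
  with B(1) show ?thesis unfolding finite_rank_def by blast
qed

lemma finite_rank_add:
  assumes "finite_rank F" "finite_rank G"
  shows "finite_rank (F + G)"
proof -
  obtain B C where B: "finite B" "range (cblinfun_apply F) \<subseteq> cspan B"
    and C: "finite C" "range (cblinfun_apply G) \<subseteq> cspan C"
    using assms unfolding finite_rank_def by (elim exE conjE) (rule that)
  have "F x + G x \<in> cspan (B \<union> C)" for x
    using B(2) C(2) complex_vector.span_mono[of B "B \<union> C"] complex_vector.span_mono[of C "B \<union> C"]
    by (intro complex_vector.span_add) blast+
  then have "range (cblinfun_apply (F + G)) \<subseteq> cspan (B \<union> C)" by auto
  with B(1) C(1) show ?thesis unfolding finite_rank_def by blast
qed

lemma finite_rank_minus: "finite_rank F \<Longrightarrow> finite_rank (- F)"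
proof -
  assume F: "finite_rank F"
  have "- F = (- id_cblinfun) o\<^sub>C F"
    by (rule cblinfun_eqI) simp
  then show ?thesis
    using finite_rank_compose_left[OF F] by simp
qed

lemma finite_rank_diff: "finite_rank F \<Longrightarrow> finite_rank G \<Longrightarrow> finite_rank (F - G)"
  using finite_rank_add[OF _ finite_rank_minus, of F G] by simp

text \<open>For \<open>G\<close> of finite rank the nullity and deficiency of \<open>1 + G\<close> are those of its restriction to
  a finite dimensional space containing the range of \<open>G\<close>.\<close>

lemma id_plus_finite_rank:
  fixes G :: "'a :: complex_normed_vector \<Rightarrow>\<^sub>C\<^sub>L 'a"
  assumes "finite_rank G"
  obtains C where "finite C" "quotient_basis (range (cblinfun_apply (id_cblinfun + G))) C"
    "nullity (id_cblinfun + G) = enat (card C)"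
proof -
  define J where "J = id_cblinfun + G"
  have J: "J x = x + G x" for x by (simp add: J_def)
  obtain B where B: "finite B" "range (cblinfun_apply G) \<subseteq> cspan B"
    using assms unfolding finite_rank_def by blast
  define V where "V = cspan B"
  have G_V: "G x \<in> V" for x using B(2) by (auto simp: V_def)
  have V: "csubspace V" by (simp add: V_def)
  have J_V: "J x \<in> V \<longleftrightarrow> x \<in> V" for x
    using complex_vector.subspace_add[OF V _ G_V[of x], of x]
      complex_vector.subspace_diff[OF V _ G_V[of x], of "J x"] by (auto simp: J)
  have null_V: "null_space J \<subseteq> V"
    using J_V complex_vector.subspace_0[OF V] by (metis (mono_tags) mem_Collect_eq null_space_def subsetI)
  obtain N where N: "finite N" "N \<subseteq> null_space J" "\<not> cdependent N" "null_space J \<subseteq> cspan N"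
      "card N = cdim (null_space J)"
    using finite_cbasis[OF B(1)] null_V V_def by blast
  have span_N: "cspan N = null_space J"
    using N(2,4) complex_vector.span_minimal[OF N(2) csubspace_null_space] by blast
  obtain D where D: "N \<subseteq> D" "D \<subseteq> V" "\<not> cdependent D" "V \<subseteq> cspan D"
    using complex_vector.maximal_independent_subset_extend[of N V] N(2,3) null_V by blast
  have "finite D"
    using complex_vector.independent_span_bound[OF B(1) D(3)] D(2) V_def by blast
  have span_D: "cspan D = V"
    using D(2,4) complex_vector.span_minimal[OF D(2) V] by blast
  have D_N: "finite (D - N)" "\<not> cdependent (D - N)"
    using \<open>finite D\<close> D(3) complex_vector.independent_mono by blast+
  have inj: "x = 0" if "x \<in> cspan (D - N)" "J x = 0" for x
    using cspan_Int_disjoint[OF \<open>finite D\<close> D(3,1)] that span_N by (simp add: null_space_def)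
  define E where "E = cblinfun_apply J ` (D - N)"
  have E: "\<not> cdependent E" "card E = card (D - N)" "finite E"
    using cindependent_image[OF D_N inj] card_image D_N by (auto simp: E_def)
  have "E \<subseteq> V" using D(2) J_V by (auto simp: E_def)
  obtain E' where E': "E \<subseteq> E'" "E' \<subseteq> V" "\<not> cdependent E'" "V \<subseteq> cspan E'"
    using complex_vector.maximal_independent_subset_extend[OF \<open>E \<subseteq> V\<close> E(1)] by blast
  have "finite E'"
    using complex_vector.independent_span_bound[OF B(1) E'(3)] E'(2) V_def by blast
  \<comment> \<open>Rank and nullity inside \<open>V\<close>: \<open>D\<close> and \<open>E'\<close>
    are bases of \<open>V\<close>, and \<open>E\<close> is the bijective image of
    \<open>D - N\<close>, so \<open>C\<close> has exactly as many elements as the kernel basis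
    \<open>N\<close>.\<close>
  define C where "C = E' - E"
  have "finite C" using \<open>finite E'\<close> by (simp add: C_def)
  have "card E' = card D"
    using complex_vector.basis_card_eq_dim[OF E'(2,4,3)] complex_vector.basis_card_eq_dim[OF D(2,4,3)] by simp
  then have card_C: "card C = card N"
    using card_Diff_subset[OF N(1) D(1)] card_Diff_subset[OF E(3) E'(1)] E(2)
      card_mono[OF \<open>finite D\<close> D(1)] by (simp add: C_def)
  have "J x \<in> cspan E" if "x \<in> V" for x
  proof -
    have "cspan E' = cspan E'" ..
    have "x \<in> cspan (N \<union> (D - N))"
      using that span_D D(1) by (simp add: Un_absorb1)
    then obtain a b where ab: "x = a + b" "a \<in> cspan N" "b \<in> cspan (D - N)"
      unfolding complex_vector.span_Un by blast
    then have "J x = J b" using span_N by (simp add: null_space_def)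
    then show ?thesis
      using ab(3) unfolding E_def image_cspan[symmetric] by auto
  qed
  note J_span = this
  have "quotient_basis (range (cblinfun_apply J)) C"
    unfolding quotient_basis_def
  proof (intro conjI allI impI)
    fix F u assume F: "finite F \<and> F \<subseteq> C \<and> (\<Sum>b\<in>F. u b *\<^sub>C b) \<in> range (cblinfun_apply J)"
    then have F: "finite F" "F \<subseteq> C" "(\<Sum>b\<in>F. u b *\<^sub>C b) \<in> range (cblinfun_apply J)" by auto
    let ?s = "\<Sum>b\<in>F. u b *\<^sub>C b"
    obtain x where x: "?s = J x" using F(3) by auto
    have C_span: "?s \<in> cspan (E' - E)"
      using F(2) by (intro complex_vector.span_sum complex_vector.span_scale)
        (auto simp: C_def intro: complex_vector.span_base)
    moreover have "cspan (E' - E) \<subseteq> V"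
      using E'(2) V by (intro complex_vector.span_minimal) auto
    ultimately have "x \<in> V" using J_V x by auto
    then have "?s \<in> cspan E" using J_span x by simp
    then have "?s = 0"
      using cspan_Int_disjoint[OF \<open>finite E'\<close> E'(3,1)] C_span by blast
    moreover have "\<not> cdependent F"
      using E'(3) F(2) complex_vector.independent_mono C_def by (metis Diff_subset subset_trans)
    ultimately show "\<forall>b\<in>F. u b = 0"
      using cindependent_sum_zero[OF F(1)] by blast
  next
    fix x
    \<comment> \<open>Since \<open>x = J x - G x\<close>, only the \<open>C\<close> part of
      \<open>G x\<close> survives modulo the range of \<open>J\<close>; the \<open>E\<close> part
      already lies in that range.\<close>
    have "G x \<in> cspan (E \<union> C)"
      using G_V E'(4,1) by (auto simp: C_def Un_absorb1)
    then obtain a b where ab: "G x = a + b" "a \<in> cspan E" "b \<in> cspan C"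
      unfolding complex_vector.span_Un by blast
    obtain u where u: "b = (\<Sum>c\<in>C. u c *\<^sub>C c)"
      using ab(3) cspan_finite_sum[OF \<open>finite C\<close>] by blast
    obtain a' where a': "a = J a'"
      using ab(2) unfolding E_def image_cspan[symmetric] by blast
    have "x - (\<Sum>c\<in>C. - u c *\<^sub>C c) = J (x - a')"
      using ab(1) a' u by (simp add: J complex_vector.scale_minus_left sum_negf algebra_simps)
    then have "x - (\<Sum>c\<in>C. - u c *\<^sub>C c) \<in> range (cblinfun_apply J)" by blast
    then show "\<exists>F u. finite F \<and> F \<subseteq> C \<and> x - (\<Sum>b\<in>F. u b *\<^sub>C b) \<in> range (cblinfun_apply J)"
      using \<open>finite C\<close> by (intro exI[of _ C] exI[of _ "\<lambda>c. - u c"]) auto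
  qed
  moreover have "nullity J = enat (card C)"
    unfolding nullity_def using edim_finite[OF B(1)] null_V N(5) card_C V_def by simp
  ultimately show thesis
    using that \<open>finite C\<close> J_def by blast
qed

text \<open>\<open>id_cblinfun + G\<close> is the identity on the closed null space of
  \<open>G\<close>, and a finite set \<open>D\<close> spans the whole space together with it. The
  range is thus a closed subspace plus a finite dimensional one.\<close>

lemma closed_range_id_plus_finite_rank:
  fixes G :: "'a :: complex_normed_vector \<Rightarrow>\<^sub>C\<^sub>L 'a"
  assumes "finite_rank G"
  shows "closed (range (cblinfun_apply (id_cblinfun + G)))"
proof -
  let ?J = "id_cblinfun + G"
  obtain B where B: "finite B" "range (cblinfun_apply G) \<subseteq> cspan B"
    using assms unfolding finite_rank_def by blast
  obtain K where K: "finite K" "K \<subseteq> range (cblinfun_apply G)" "range (cblinfun_apply G) \<subseteq> cspan K"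
    using finite_cbasis[OF B] by metis
  obtain D where D: "finite D" "cblinfun_apply G ` D = K"
    using K(1,2) by (metis finite_subset_image)
  have "x \<in> cspan (null_space G \<union> D)" for x
  proof -
    have "G x \<in> cblinfun_apply G ` cspan D"
      using K(3) D(2) by (auto simp: image_cspan)
    then obtain d where d: "d \<in> cspan D" "G x = G d" by blast
    then have "x - d \<in> cspan (null_space G)"
      by (intro complex_vector.span_base) (simp add: null_space_def)
    then have "(x - d) + d \<in> cspan (null_space G \<union> D)"
      using d(1) complex_vector.span_mono[of D "null_space G \<union> D"]
        complex_vector.span_mono[of "null_space G" "null_space G \<union> D"]
      by (intro complex_vector.span_add) blast+
    then show ?thesis by simp
  qed
  then have "cspan (null_space G \<union> D) = UNIV" by blast
  then have "range (cblinfun_apply ?J) = cspan (cblinfun_apply ?J ` (null_space G \<union> D))"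
    using image_cspan[of ?J "null_space G \<union> D"] by metis
  also have "cblinfun_apply ?J ` (null_space G \<union> D) = null_space G \<union> cblinfun_apply ?J ` D"
    unfolding image_Un by (simp add: null_space_def cong: image_cong_simp)
  finally have "range (cblinfun_apply ?J) = cspan (null_space G \<union> cblinfun_apply ?J ` D)" .
  then show ?thesis
    using closed_span_Un[OF csubspace_null_space closed_null_space finite_imageI[OF D(1)]] by metis
qed

section \<open>Sums of an invertible and a finite rank operator\<close>

definition fin_perturbed :: "('a :: complex_normed_vector \<Rightarrow>\<^sub>C\<^sub>L 'a) \<Rightarrow> bool" where
  "fin_perturbed S \<longleftrightarrow> (\<exists>A F. invertible_cblinfun A \<and> finite_rank F \<and> S = A + F)"

text \<open>Factor \<open>A + F\<close> as \<open>A\<close> times the identity plus a finite rank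
  operator, and transport range and quotient basis by \<open>A\<close>. One set \<open>C\<close>
  serves for nullity and deficiency, which is the vanishing of the index.\<close>

lemma fin_perturbed_structure:
  fixes S :: "'a :: complex_normed_vector \<Rightarrow>\<^sub>C\<^sub>L 'a"
  assumes "fin_perturbed S"
  obtains C where "finite C" "quotient_basis (range (cblinfun_apply S)) C"
    "nullity S = enat (card C)" "closed (range (cblinfun_apply S))"
proof -
  obtain A F where A: "invertible_cblinfun A" and F: "finite_rank F" and S: "S = A + F"
    using assms unfolding fin_perturbed_def by blast
  define G where "G = cblinfun_inverse A o\<^sub>C F"
  have G: "finite_rank G" by (simp add: G_def F finite_rank_compose_left)
  have SA: "S x = A ((id_cblinfun + G) x)" for x
    using A by (simp add: S G_def)
  have inv: "cblinfun_inverse A (A x) = x" "A (cblinfun_inverse A x) = x" for x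
    using A by simp_all
  have A0: "A x = 0 \<longleftrightarrow> x = 0" for x
    using inv(1)[of x] by auto
  have range_S: "x \<in> range (cblinfun_apply S) \<longleftrightarrow> cblinfun_inverse A x \<in> range (cblinfun_apply (id_cblinfun + G))" for x
    using SA inv by (metis (no_types, lifting) rangeE rangeI)
  obtain C where C: "finite C" "quotient_basis (range (cblinfun_apply (id_cblinfun + G))) C"
    "nullity (id_cblinfun + G) = enat (card C)"
    using id_plus_finite_rank[OF G] by blast
  have "null_space S = null_space (id_cblinfun + G)"
    unfolding null_space_def SA A0 ..
  moreover have "closed (range (cblinfun_apply S))"
  proof -
    have "range (cblinfun_apply S) = cblinfun_apply (cblinfun_inverse A) -` range (cblinfun_apply (id_cblinfun + G))"
      using range_S by auto
    moreover have "continuous_on UNIV (cblinfun_apply (cblinfun_inverse A))"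
      by (intro linear_continuous_on bounded_linear_apply)
    ultimately show ?thesis
      using continuous_on_closed_vimage[OF closed_UNIV, of "cblinfun_apply (cblinfun_inverse A)"]
        closed_range_id_plus_finite_rank[OF G] by simp
  qed
  moreover have inj_A: "inj_on (cblinfun_apply A) C"
    by (metis inj_onI inv(1))
  moreover have "quotient_basis (range (cblinfun_apply S)) (cblinfun_apply A ` C)"
    unfolding quotient_basis_def
  proof (intro conjI allI impI)
    fix F u assume F: "finite F \<and> F \<subseteq> cblinfun_apply A ` C \<and> (\<Sum>b\<in>F. u b *\<^sub>C b) \<in> range (cblinfun_apply S)"
    then obtain F' where F': "F' \<subseteq> C" "F = cblinfun_apply A ` F'"
      by (metis subset_imageE)
    have fin: "finite F'" using F' C(1) finite_subset by blast
    have inj: "inj_on (cblinfun_apply A) F'" using inj_A F'(1) inj_on_subset by blast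
    have "cblinfun_inverse A (\<Sum>b\<in>F. u b *\<^sub>C b) = (\<Sum>b\<in>F'. u (A b) *\<^sub>C b)"
      unfolding F'(2) sum.reindex[OF inj] apply_sum by (simp add: inv)
    then have "(\<Sum>b\<in>F'. u (A b) *\<^sub>C b) \<in> range (cblinfun_apply (id_cblinfun + G))"
      using F range_S by metis
    then have "\<forall>b\<in>F'. u (A b) = 0"
      using quotient_basis_independent[OF C(2) fin F'(1), of "\<lambda>b. u (A b)"] by blast
    then show "\<forall>b\<in>F. u b = 0" using F'(2) by blast
  next
    fix x
    obtain F u where F: "finite F" "F \<subseteq> C"
      "cblinfun_inverse A x - (\<Sum>b\<in>F. u b *\<^sub>C b) \<in> range (cblinfun_apply (id_cblinfun + G))"
      using quotient_basis_spanning[OF C(2)] by metis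
    have inj: "inj_on (cblinfun_apply A) F" using inj_A F(2) inj_on_subset by blast
    have "cblinfun_inverse A (x - (\<Sum>b\<in>cblinfun_apply A ` F. u (cblinfun_inverse A b) *\<^sub>C b)) =
        cblinfun_inverse A x - (\<Sum>b\<in>F. u b *\<^sub>C b)"
      unfolding apply_diff sum.reindex[OF inj] apply_sum by (simp add: inv)
    then have "x - (\<Sum>b\<in>cblinfun_apply A ` F. u (cblinfun_inverse A b) *\<^sub>C b) \<in> range (cblinfun_apply S)"
      using F(3) range_S by metis
    then show "\<exists>F u. finite F \<and> F \<subseteq> cblinfun_apply A ` C \<and> x - (\<Sum>b\<in>F. u b *\<^sub>C b) \<in> range (cblinfun_apply S)"
      using F(1,2) by (metis finite_imageI image_mono)
  qed
  ultimately show thesis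
    using that[of "cblinfun_apply A ` C"] C(1,3) card_image[OF inj_A] by (simp add: nullity_def)
qed

lemma fin_perturbed_imp_weyl:
  assumes "fin_perturbed S"
  shows "weyl S"
proof -
  obtain C where C: "finite C" "quotient_basis (range (cblinfun_apply S)) C"
    "nullity S = enat (card C)" "closed (range (cblinfun_apply S))"
    using fin_perturbed_structure[OF assms] by blast
  have "deficiency S = enat (card C)"
    unfolding deficiency_def by (rule quotient_edim_eq[OF csubspace_range C(2,1)])
  with C show ?thesis
    by (simp add: weyl_def fredholm_def fredholm_index_def)
qed

text \<open>The Fredholm alternative: nullity 0 forces the quotient basis to be empty.\<close>

lemma fin_perturbed_inj_bij:
  assumes S: "fin_perturbed S" and inj: "\<And>x. S x = 0 \<Longrightarrow> x = 0"
  shows "bij (cblinfun_apply S)"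
proof -
  obtain C where C: "finite C" "quotient_basis (range (cblinfun_apply S)) C" "nullity S = enat (card C)"
    using fin_perturbed_structure[OF S] by blast
  have null: "null_space S = {0}" using inj by (auto simp: null_space_def)
  have "cdim {0 :: 'a} = 0"
    using complex_vector.dim_le_card[of "{0}" "{}"] by simp
  then have "nullity S = 0"
    unfolding nullity_def null using edim_finite[of "{}" "{0 :: 'a}"] by (simp add: zero_enat_def)
  then have "C = {}" using C(1,3) by (simp add: zero_enat_def)
  then have "x \<in> range (cblinfun_apply S)" for x
    using C(2) unfolding quotient_basis_def by auto
  moreover have "inj (cblinfun_apply S)"
    by (rule injI) (metis apply_diff inj eq_iff_diff_eq_0)
  ultimately show ?thesis by (auto simp: bij_def)
qed

lemma invertible_fin_perturbed: "invertible_cblinfun A \<Longrightarrow> fin_perturbed A"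
  unfolding fin_perturbed_def
  by (intro exI[of _ A] exI[of _ 0]) (auto simp: finite_rank_def intro: exI[of _ "{}"])

lemma fin_perturbed_add: "fin_perturbed S \<Longrightarrow> finite_rank F \<Longrightarrow> fin_perturbed (S + F)"
  unfolding fin_perturbed_def by (metis add.assoc finite_rank_add)

text \<open>Takes the place of the additivity of the index.\<close>

lemma fin_perturbed_compose:
  assumes "fin_perturbed S" "fin_perturbed T"
  shows "fin_perturbed (S o\<^sub>C T)"
proof -
  obtain A F where A: "invertible_cblinfun A" "finite_rank F" "S = A + F"
    using assms(1) unfolding fin_perturbed_def by blast
  obtain B G where B: "invertible_cblinfun B" "finite_rank G" "T = B + G"
    using assms(2) unfolding fin_perturbed_def by blast
  have "S o\<^sub>C T = A o\<^sub>C B + (F o\<^sub>C T + A o\<^sub>C G)"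
    by (rule cblinfun_eqI) (simp add: A(3) B(3) algebra_simps)
  then show ?thesis
    unfolding fin_perturbed_def
    using invertible_compose[OF A(1) B(1)] finite_rank_add[OF finite_rank_compose_right[OF A(2), of T]
        finite_rank_compose_left[OF B(2), of A]] by blast
qed

lemma bounded_clinear_sum:
  assumes "\<And>i. i \<in> I \<Longrightarrow> bounded_clinear (f i)"
  shows "bounded_clinear (\<lambda>x. \<Sum>i\<in>I. f i x)"
  using assms unfolding bounded_clinear_def
  by (auto intro!: bounded_linear_sum simp: complex_vector.scale_sum_right)

lemma bounded_clinear_scale_left:
  fixes \<phi> :: "'a :: complex_normed_vector \<Rightarrow> complex"
  assumes "bounded_clinear \<phi>"
  shows "bounded_clinear (\<lambda>x. \<phi> x *\<^sub>C v)"
proof -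
  have "bounded_clinear (\<lambda>c :: complex. c *\<^sub>C v)"
    by (rule bounded_clinearI[where K = "norm v"])
      (simp_all add: scaleC_add_left scaleC_scaleC norm_scaleC scaleC_complex_def)
  then show ?thesis by (rule bounded_clinear_compose) (rule assms)
qed

lemma finite_rank_operator:
  fixes \<phi> :: "'i \<Rightarrow> 'a :: complex_normed_vector \<Rightarrow> complex" and v :: "'i \<Rightarrow> 'b :: complex_normed_vector"
  assumes "finite I" "\<And>i. i \<in> I \<Longrightarrow> bounded_clinear (\<phi> i)"
  obtains F where "finite_rank F" "\<And>x. cblinfun_apply F x = (\<Sum>i\<in>I. \<phi> i x *\<^sub>C v i)"
proof -
  define F where "F = CBlinfun (\<lambda>x. \<Sum>i\<in>I. \<phi> i x *\<^sub>C v i)"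
  have F: "F x = (\<Sum>i\<in>I. \<phi> i x *\<^sub>C v i)" for x
    unfolding F_def
    by (rule CBlinfun_apply) (intro bounded_clinear_sum bounded_clinear_scale_left assms(2))
  have "range (cblinfun_apply F) \<subseteq> cspan (v ` I)"
    unfolding F by (auto intro!: complex_vector.span_sum complex_vector.span_scale intro: complex_vector.span_base)
  then have "finite_rank F"
    unfolding finite_rank_def using assms(1) by blast
  then show thesis using that F by blast
qed

text \<open>Equal nullity and deficiency give a bijection \<open>g\<close> from a basis of the
  kernel to representatives of a basis of the quotient by the range. The finite rank operator
  \<open>F\<close> that extends \<open>g\<close> through dual functionals repairs both defects:
  \<open>S + F\<close> is bijective, and its inverse is bounded by the open mapping theorem.\<close>

lemma weyl_imp_fin_perturbed:
  fixes S :: "'a :: complex_banach \<Rightarrow>\<^sub>C\<^sub>L 'a"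
  assumes "weyl S"
  shows "fin_perturbed S"
proof -
  have fin: "nullity S < \<infinity>" "deficiency S < \<infinity>" and eq: "the_enat (nullity S) = the_enat (deficiency S)"
    using assms unfolding weyl_def fredholm_def fredholm_index_def by simp_all
  have "\<exists>B. finite B \<and> null_space S \<subseteq> cspan B"
  proof (rule ccontr)
    assume "\<not> ?thesis"
    then have "nullity S = \<infinity>" unfolding nullity_def edim_def by (rule if_not_P)
    with fin(1) show False by simp
  qed
  then obtain B where B: "finite B" "null_space S \<subseteq> cspan B" by blast
  obtain N where N: "finite N" "N \<subseteq> null_space S" "\<not> cdependent N" "null_space S \<subseteq> cspan N"
      "card N = cdim (null_space S)"
    using finite_cbasis[OF B] by blast
  have "\<exists>C. finite C \<and> quotient_basis (range (cblinfun_apply S)) C"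
  proof (rule ccontr)
    assume "\<not> ?thesis"
    then have "deficiency S = \<infinity>" unfolding deficiency_def quotient_edim_def by (rule if_not_P)
    with fin(2) show False by simp
  qed
  then obtain C where C: "finite C" "quotient_basis (range (cblinfun_apply S)) C" by blast
  have "card N = card C"
    using eq edim_finite[OF B] quotient_edim_eq[OF csubspace_range C(2,1)] N(5)
    by (simp add: nullity_def deficiency_def)
  then obtain g where g: "bij_betw g N C"
    using N(1) C(1) finite_same_card_bij by blast
  obtain \<phi> :: "'a \<Rightarrow> 'a \<Rightarrow> complex" where \<phi>: "\<And>b. b \<in> N \<Longrightarrow> bounded_clinear (\<phi> b)"
      "\<And>b c. b \<in> N \<Longrightarrow> c \<in> N \<Longrightarrow> \<phi> b c = (if b = c then 1 else 0)"
    using dual_basis[OF N(1,3)] by blast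
  obtain F where F: "finite_rank F" "\<And>x. cblinfun_apply F x = (\<Sum>b\<in>N. \<phi> b x *\<^sub>C g b)"
    using finite_rank_operator[OF N(1), of \<phi> g] \<phi>(1) by blast
  have \<phi>_sum: "\<phi> b (\<Sum>c\<in>N. u c *\<^sub>C c) = u b" if b: "b \<in> N" for b u
  proof -
    have "\<phi> b (\<Sum>c\<in>N. u c *\<^sub>C c) = (\<Sum>c\<in>N. \<phi> b (u c *\<^sub>C c))"
      using bounded_clinear_linear[OF \<phi>(1)[OF b]] bounded_linear.linear linear_sum by blast
    also have "\<dots> = (\<Sum>c\<in>N. if b = c then u c else 0)"
      using \<phi>(2)[OF b] bounded_clinear_scaleC[OF \<phi>(1)[OF b]]
      by (intro sum.cong) (auto simp: scaleC_complex_def)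
    finally show ?thesis using b N(1) by simp
  qed
  have F_null: "F (\<Sum>c\<in>N. u c *\<^sub>C c) = (\<Sum>c\<in>N. u c *\<^sub>C g c)" for u
    unfolding F(2) by (intro sum.cong) (simp_all add: \<phi>_sum)
  have reindex: "(\<Sum>b\<in>N. u (g b) *\<^sub>C g b) = (\<Sum>c\<in>C. u c *\<^sub>C c)" for u
    using sum.reindex_bij_betw[OF g, of "\<lambda>c. u c *\<^sub>C c"] .
  have S_null: "S (\<Sum>c\<in>N. u c *\<^sub>C c) = 0" for u
    using N(2) by (auto simp: apply_sum null_space_def intro!: sum.neutral)
  have inj: "x = 0" if x: "(S + F) x = 0" for x
  proof -
    define u where "u c = \<phi> (inv_into N g c) x" for c
    have u: "u (g b) = \<phi> b x" if "b \<in> N" for b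
      using that g by (simp add: u_def bij_betw_def)
    have "F x = (\<Sum>c\<in>C. u c *\<^sub>C c)"
      unfolding F(2) reindex[symmetric] by (intro sum.cong) (simp_all add: u)
    \<comment> \<open>Now \<open>F x\<close> lies in the range of \<open>S\<close> and is a
      combination of vectors independent modulo that range, so all its coefficients vanish.\<close>
    moreover have "F x = S (- x)"
      using x by (simp add: eq_neg_iff_add_eq_0 add.commute)
    ultimately have "(\<Sum>c\<in>C. u c *\<^sub>C c) \<in> range (cblinfun_apply S)" by (metis rangeI)
    then have "\<forall>c\<in>C. u c = 0"
      using quotient_basis_independent[OF C(2,1) subset_refl, of u] by blast
    then have \<phi>0: "\<phi> b x = 0" if "b \<in> N" for b
      using u[OF that] that g by (auto simp: bij_betw_def)
    then have "F x = 0" unfolding F(2) by simp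
    then have "x \<in> cspan N" using x N(4) by (auto simp: null_space_def)
    then obtain w where w: "x = (\<Sum>c\<in>N. w c *\<^sub>C c)"
      using cspan_finite_sum[OF N(1)] by blast
    then have "w b = 0" if "b \<in> N" for b
      using \<phi>_sum[OF that, of w] \<phi>0[OF that] by simp
    then show "x = 0" unfolding w by simp
  qed
  have surj: "y \<in> range (cblinfun_apply (S + F))" for y
  proof -
    obtain D u where D: "finite D" "D \<subseteq> C" "y - (\<Sum>b\<in>D. u b *\<^sub>C b) \<in> range (cblinfun_apply S)"
      using quotient_basis_spanning[OF C(2)] by metis
    define w where "w c = (if c \<in> D then u c else 0)" for c
    have "(\<Sum>b\<in>D. u b *\<^sub>C b) = (\<Sum>c\<in>C. w c *\<^sub>C c)"
      using D(2) C(1) by (intro sum.mono_neutral_cong_left) (auto simp: w_def)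
    then obtain x where x: "y = S x + (\<Sum>c\<in>C. w c *\<^sub>C c)"
      using D(3) by (auto simp: algebra_simps)
    \<comment> \<open>Both corrections lie in the kernel of \<open>S\<close>: subtracting
      \<open>a\<close> cancels \<open>F x\<close>, and \<open>F\<close> sends \<open>b\<close> to
      the part of \<open>y\<close> that \<open>S\<close> cannot reach.\<close>
    define a where "a = (\<Sum>b\<in>N. \<phi> b x *\<^sub>C b)"
    define b where "b = (\<Sum>b\<in>N. w (g b) *\<^sub>C b)"
    have "(S + F) (x - a + b) = S x + F b"
      by (simp add: a_def b_def S_null F_null) (simp add: F(2))
    also have "F b = (\<Sum>c\<in>C. w c *\<^sub>C c)"
      unfolding b_def F_null reindex ..
    finally have "(S + F) (x - a + b) = y" using x by simp
    then show ?thesis by blast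
  qed
  have "inj (cblinfun_apply (S + F))"
    by (rule injI) (metis apply_diff inj eq_iff_diff_eq_0)
  with surj have "bij (cblinfun_apply (S + F))"
    by (auto simp: bij_def)
  then have "invertible_cblinfun (S + F)" by (rule bij_invertible)
  moreover have "S = (S + F) + (- F)" by simp
  ultimately show ?thesis
    unfolding fin_perturbed_def using finite_rank_minus[OF F(1)] by blast
qed

theorem weyl_iff_fin_perturbed:
  fixes S :: "'a :: complex_banach \<Rightarrow>\<^sub>C\<^sub>L 'a"
  shows "weyl S \<longleftrightarrow> fin_perturbed S"
  using weyl_imp_fin_perturbed fin_perturbed_imp_weyl by blast

lemma fin_perturbed_inj_invertible:
  fixes S :: "'a :: complex_banach \<Rightarrow>\<^sub>C\<^sub>L 'a"
  assumes "fin_perturbed S" "\<And>x. S x = 0 \<Longrightarrow> x = 0"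
  shows "invertible_cblinfun S"
  by (rule bij_invertible[OF fin_perturbed_inj_bij[OF assms]])


section \<open>Ascent of operators commuting with an operator that has SVEP\<close>

text \<open>The difference quotients of the series are summed term by term; the M-test makes their
  sum \<open>g\<close> continuous, so \<open>g z\<close> is the derivative. In the quotient
  \<open>q n\<close> there are \<open>n\<close> summands, and \<open>n\<close> is bounded by
  \<open>2 ^ n\<close>: a radius of a quarter of \<open>1 / C\<close> absorbs this and leaves a
  geometric series of ratio 1/2.\<close>

lemma vector_power_series_analytic:
  fixes x :: "nat \<Rightarrow> 'a :: complex_banach" and l :: complex
  assumes C: "0 < C" and x: "\<And>n. norm (x n) \<le> a * C ^ n"
  defines "f \<equiv> \<lambda>z. \<Sum>n. (z - l) ^ n *\<^sub>C x n"
  shows "vector_analytic_on f (ball l (1 / (4 * C)))"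
    and "\<And>z. z \<in> ball l (1 / (4 * C)) \<Longrightarrow> summable (\<lambda>n. (z - l) ^ n *\<^sub>C x n)"
proof -
  let ?r = "1 / (4 * C)" and ?U = "ball l (1 / (4 * C))"
  have a: "0 \<le> a" using order_trans[OF norm_ge_zero x[of 0]] by simp
  have small: "cmod (z - l) \<le> ?r" if "z \<in> ?U" for z
    using that by (simp add: dist_norm norm_minus_commute)
  have term_le: "norm ((z - l) ^ n *\<^sub>C x n) \<le> a * (1 / 4) ^ n" if z: "z \<in> ?U" for z n
  proof -
    have "norm ((z - l) ^ n *\<^sub>C x n) \<le> ?r ^ n * (a * C ^ n)"
      unfolding norm_scaleC norm_power using small[OF z] x[of n] C by (intro mult_mono power_mono) auto
    also have "\<dots> = a * (?r * C) ^ n" by (simp only: power_mult_distrib mult_ac)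
    finally show ?thesis using C by simp
  qed
  show summ: "summable (\<lambda>n. (z - l) ^ n *\<^sub>C x n)" if z: "z \<in> ?U" for z
    by (rule summable_norm_cancel, rule summable_comparison_test'[where g = "\<lambda>n. a * (1 / 4) ^ n" and N = 0])
      (use term_le[OF z] in \<open>auto intro!: summable_mult summable_geometric\<close>)
  show "vector_analytic_on f ?U"
    unfolding vector_analytic_on_def
  proof
    fix z assume z: "z \<in> ?U"
    define q where "q n w = (\<Sum>k<n. (w - l) ^ k * (z - l) ^ (n - Suc k))" for n w
    define g where "g w = (\<Sum>n. q n w *\<^sub>C x n)" for w
    have q_mult: "(w - z) * q n w = (w - l) ^ n - (z - l) ^ n" for n w
      using power_diff_sumr2[of "w - l" n "z - l"] by (simp add: q_def mult.commute)
    have q_norm: "norm (q n w *\<^sub>C x n) \<le> (4 * C * a) * (1 / 2) ^ n" if w: "w \<in> ?U" for n w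
    proof (cases n)
      case 0
      then show ?thesis using a C by (simp add: q_def)
    next
      case (Suc m)
      have "cmod (q n w) \<le> (\<Sum>k<n. ?r ^ m)"
        unfolding q_def
      proof (rule sum_norm_le)
        fix k assume k: "k \<in> {..<n}"
        have "cmod ((w - l) ^ k * (z - l) ^ (n - Suc k)) \<le> ?r ^ k * ?r ^ (n - Suc k)"
          unfolding norm_mult norm_power using small[OF w] small[OF z] C by (intro mult_mono power_mono) auto
        also have "\<dots> = ?r ^ m" using k Suc by (simp flip: power_add)
        finally show "cmod ((w - l) ^ k * (z - l) ^ (n - Suc k)) \<le> ?r ^ m" .
      qed
      also have "\<dots> = real n * ?r ^ m" by simp
      also have "\<dots> \<le> 2 ^ n * ?r ^ m"
        using C of_nat_less_two_power[of n, where 'a = real] by (intro mult_right_mono) auto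
      finally have "norm (q n w *\<^sub>C x n) \<le> (2 ^ n * ?r ^ m) * (a * C ^ n)"
        unfolding norm_scaleC using x[of n] C by (intro mult_mono) auto
      also have "\<dots> = (4 * C * a) * (2 ^ n * ?r ^ n * C ^ n)"
        using C Suc by simp
      also have "2 ^ n * ?r ^ n * C ^ n = (2 * ?r * C) ^ n" by (simp only: power_mult_distrib)
      also have "2 * ?r * C = 1 / 2" using C by simp
      finally show ?thesis .
    qed
    have "uniform_limit ?U (\<lambda>n w. \<Sum>i<n. q i w *\<^sub>C x i) g sequentially"
      unfolding g_def[abs_def]
      by (rule Weierstrass_m_test[OF q_norm]) (auto intro!: summable_mult summable_geometric)
    moreover have "\<forall>\<^sub>F n in sequentially. continuous_on ?U (\<lambda>w. \<Sum>i<n. q i w *\<^sub>C x i)"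
    proof (intro always_eventually allI continuous_on_sum)
      fix n i
      have "bounded_linear (\<lambda>c :: complex. c *\<^sub>C x i)"
        by (rule bounded_linear_intro[where K = "norm (x i)"])
          (simp_all add: scaleC_add_left scaleR_scaleC[of _ "_ *\<^sub>C _"] scaleC_scaleC norm_scaleC scaleR_conv_of_real)
      moreover have "continuous_on ?U (q i)"
        unfolding q_def[abs_def] by (intro continuous_intros)
      ultimately show "continuous_on ?U (\<lambda>w. q i w *\<^sub>C x i)"
        by (rule bounded_linear.continuous_on)
    qed
    ultimately have "continuous_on ?U g"
      by (intro uniform_limit_theorem) auto
    then have "(g \<longlongrightarrow> g z) (at z)"
      using z by (simp add: continuous_on_eq_continuous_at isCont_def)
    moreover have "\<forall>\<^sub>F w in at z. g w = inverse (w - z) *\<^sub>C (f w - f z)"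
    proof -
      have "\<forall>\<^sub>F w in at z. w \<in> ?U"
        using z eventually_at_topological by (metis open_ball)
      moreover have "\<forall>\<^sub>F w in at z. w \<noteq> z" by (simp add: eventually_at_filter)
      ultimately show ?thesis
      proof eventually_elim
        case (elim w)
        have sg: "summable (\<lambda>n. q n w *\<^sub>C x n)"
          by (rule summable_norm_cancel, rule summable_comparison_test'[where g = "\<lambda>n. (4 * C * a) * (1 / 2) ^ n" and N = 0])
            (use q_norm[OF elim(1)] in \<open>auto intro!: summable_mult summable_geometric\<close>)
        have "f w - f z = (\<Sum>n. (w - l) ^ n *\<^sub>C x n - (z - l) ^ n *\<^sub>C x n)"
          unfolding f_def by (rule suminf_diff[OF summ[OF elim(1)] summ[OF z]])
        also have "(\<lambda>n. (w - l) ^ n *\<^sub>C x n - (z - l) ^ n *\<^sub>C x n) = (\<lambda>n. (w - z) *\<^sub>C (q n w *\<^sub>C x n))"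
          unfolding scaleC_scaleC q_mult complex_vector.scale_left_diff_distrib ..
        also have "(\<Sum>n. (w - z) *\<^sub>C (q n w *\<^sub>C x n)) = (w - z) *\<^sub>C g w"
          unfolding g_def by (rule bounded_linear.suminf[OF bounded_linear_scaleC sg, symmetric])
        finally show ?case using elim(2) by (simp add: scaleC_scaleC)
      qed
    qed
    ultimately have "((\<lambda>w. inverse (w - z) *\<^sub>C (f w - f z)) \<longlongrightarrow> g z) (at z)"
      by (rule Lim_transform_eventually)
    then show "\<exists>D. ((\<lambda>w. inverse (w - z) *\<^sub>C (f w - f z)) \<longlongrightarrow> D) (at z)" by blast
  qed
qed

text \<open>Solving \<open>(T - l) x\<^sub>n\<^sub>+\<^sub>1 = x\<^sub>n\<close> in \<open>W\<close> with geometric growth, \<open>\<Sum> (z - l)\<^sup>n x\<^sub>n\<close> is an analytic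
  family of eigenvectors, which SVEP forbids.\<close>

lemma SVEP_kernel_trivial:
  fixes T :: "'a :: complex_banach \<Rightarrow>\<^sub>C\<^sub>L 'a"
  assumes T: "SVEP T" and W: "csubspace W" "closed W"
    and onto: "cblinfun_apply (T - l *\<^sub>C id_cblinfun) ` W = W"
    and x0: "x0 \<in> W" "(T - l *\<^sub>C id_cblinfun) x0 = 0"
  shows "x0 = 0"
proof -
  let ?T = "T - l *\<^sub>C id_cblinfun"
  obtain C where C: "0 < C" "\<And>y. y \<in> W \<Longrightarrow> \<exists>x\<in>W. ?T x = y \<and> norm x \<le> C * norm y"
    using open_mapping[OF W, of ?T] W(2) unfolding onto by blast
  obtain g where g: "\<And>y. y \<in> W \<Longrightarrow> g y \<in> W" "\<And>y. y \<in> W \<Longrightarrow> ?T (g y) = y" "\<And>y. y \<in> W \<Longrightarrow> norm (g y) \<le> C * norm y"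
    using C(2) by metis
  define x where "x n = (g ^^ n) x0" for n
  have x_Suc: "x (Suc n) = g (x n)" and x_0: "x 0 = x0" for n by (simp_all add: x_def)
  have xW: "x n \<in> W" for n
    by (induction n) (simp_all add: x_Suc x_0 x0 g)
  have x_norm: "norm (x n) \<le> norm x0 * C ^ n" for n
  proof (induction n)
    case (Suc n)
    have "norm (x (Suc n)) \<le> C * (norm x0 * C ^ n)"
      unfolding x_Suc using g(3)[OF xW] mult_left_mono[OF Suc, of C] C(1) by (meson less_imp_le order_trans)
    then show ?case by (simp add: mult_ac)
  qed (simp add: x_0)
  define f where "f z = (\<Sum>n. (z - l) ^ n *\<^sub>C x n)" for z
  let ?U = "ball l (1 / (4 * C))"
  have an: "vector_analytic_on f ?U"
    unfolding f_def[abs_def] by (rule vector_power_series_analytic(1)[OF C(1) x_norm])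
  have summ: "summable (\<lambda>n. (z - l) ^ n *\<^sub>C x n)" if "z \<in> ?U" for z
    by (rule vector_power_series_analytic(2)[OF C(1) x_norm that])
  have "(T - z *\<^sub>C id_cblinfun) (f z) = 0" if z: "z \<in> ?U" for z
  proof -
    \<comment> \<open>\<open>T - l\<close> lowers the index by one, so it reproduces the series
      multiplied by \<open>z - l\<close>.\<close>
    have Tx: "?T ((z - l) ^ n *\<^sub>C x n) = (case n of 0 \<Rightarrow> 0 | Suc m \<Rightarrow> (z - l) ^ Suc m *\<^sub>C x m)" for n
      using x0(2) g(2)[OF xW] by (cases n) (simp_all only: apply_scaleC x_Suc x_0 nat.case power_0 complex_vector.scale_zero_right)
    have "?T (f z) = (\<Sum>n. ?T ((z - l) ^ n *\<^sub>C x n))"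
      unfolding f_def by (rule bounded_linear.suminf[OF bounded_linear_apply summ[OF z]])
    also have "\<dots> = (\<Sum>n. ?T ((z - l) ^ Suc n *\<^sub>C x (Suc n))) + ?T ((z - l) ^ 0 *\<^sub>C x 0)"
      by (subst suminf_split_head[OF bounded_linear.summable[OF bounded_linear_apply summ[OF z]]]) (simp only: diff_add_cancel)
    also have "\<dots> = (\<Sum>n. (z - l) *\<^sub>C ((z - l) ^ n *\<^sub>C x n))"
      unfolding Tx by (simp add: scaleC_scaleC)
    also have "\<dots> = (z - l) *\<^sub>C f z"
      unfolding f_def by (rule bounded_linear.suminf[OF bounded_linear_scaleC summ[OF z], symmetric])
    finally have "?T (f z) = (z - l) *\<^sub>C f z" .
    then show ?thesis by (simp add: complex_vector.scale_left_diff_distrib)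
  qed
  then have "\<forall>z\<in>?U. f z = 0"
    using T an unfolding SVEP_def by (meson open_ball)
  then have "f l = 0" using C(1) by simp
  moreover have "f l = x0"
  proof -
    have "(\<lambda>n. (l - l) ^ n *\<^sub>C x n) = (\<lambda>n. if n = 0 then x0 else 0)"
      by (rule ext) (simp add: x_0 power_0_left)
    then show ?thesis
      unfolding f_def using suminf_finite[of "{0}" "\<lambda>n. if n = 0 then x0 else 0"] by simp
  qed
  ultimately show ?thesis by simp
qed

section \<open>Eigenvectors in finite dimensional invariant subspaces\<close>

definition poly_apply :: "complex poly \<Rightarrow> ('a :: complex_normed_vector \<Rightarrow> 'a) \<Rightarrow> 'a \<Rightarrow> 'a" where
  "poly_apply p T v = (\<Sum>i\<le>degree p. coeff p i *\<^sub>C (T ^^ i) v)"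

lemma poly_apply_sum:
  assumes "degree p \<le> n"
  shows "poly_apply p T v = (\<Sum>i\<le>n. coeff p i *\<^sub>C (T ^^ i) v)"
  unfolding poly_apply_def
  by (rule sum.mono_neutral_left) (use assms in \<open>auto simp: coeff_eq_0\<close>)

lemma poly_apply_linear_factor:
  "poly_apply ([:- a, 1:] * q) (cblinfun_apply T) v =
    T (poly_apply q (cblinfun_apply T) v) - a *\<^sub>C poly_apply q (cblinfun_apply T) v"
proof -
  define n where "n = degree q"
  have c0: "coeff ([:- a, 1:] * q) 0 = - a * coeff q 0"
    and cS: "coeff ([:- a, 1:] * q) (Suc i) = coeff q i - a * coeff q (Suc i)" for i
    by (simp_all add: algebra_simps)
  have "degree ([:- a, 1:] * q) \<le> Suc n"
    using degree_mult_le[of "[:- a, 1:]" q] by (simp add: n_def)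
  then have "poly_apply ([:- a, 1:] * q) (cblinfun_apply T) v =
      (\<Sum>i\<le>Suc n. coeff ([:- a, 1:] * q) i *\<^sub>C (cblinfun_apply T ^^ i) v)"
    by (rule poly_apply_sum)
  also have "\<dots> = (- a * coeff q 0) *\<^sub>C v + (\<Sum>i\<le>n. (coeff q i - a * coeff q (Suc i)) *\<^sub>C (cblinfun_apply T ^^ Suc i) v)"
    unfolding sum.atMost_Suc_shift c0 cS by simp
  also have "(\<Sum>i\<le>n. (coeff q i - a * coeff q (Suc i)) *\<^sub>C (cblinfun_apply T ^^ Suc i) v) =
      T (\<Sum>i\<le>n. coeff q i *\<^sub>C (cblinfun_apply T ^^ i) v) - (\<Sum>i\<le>n. (a * coeff q (Suc i)) *\<^sub>C (cblinfun_apply T ^^ Suc i) v)"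
    unfolding complex_vector.scale_left_diff_distrib sum_subtractf apply_sum by simp
  also have "(- a * coeff q 0) *\<^sub>C v + (T (\<Sum>i\<le>n. coeff q i *\<^sub>C (cblinfun_apply T ^^ i) v) -
        (\<Sum>i\<le>n. (a * coeff q (Suc i)) *\<^sub>C (cblinfun_apply T ^^ Suc i) v)) =
      T (\<Sum>i\<le>n. coeff q i *\<^sub>C (cblinfun_apply T ^^ i) v) - (\<Sum>i\<le>Suc n. (a * coeff q i) *\<^sub>C (cblinfun_apply T ^^ i) v)"
    unfolding sum.atMost_Suc_shift by (simp add: complex_vector.scale_minus_left)
  also have "(\<Sum>i\<le>Suc n. (a * coeff q i) *\<^sub>C (cblinfun_apply T ^^ i) v) = a *\<^sub>C (\<Sum>i\<le>Suc n. coeff q i *\<^sub>C (cblinfun_apply T ^^ i) v)"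
    unfolding complex_vector.scale_sum_right scaleC_scaleC ..
  also have "(\<Sum>i\<le>Suc n. coeff q i *\<^sub>C (cblinfun_apply T ^^ i) v) = poly_apply q (cblinfun_apply T) v"
    by (rule poly_apply_sum[symmetric]) (simp add: n_def)
  also have "(\<Sum>i\<le>n. coeff q i *\<^sub>C (cblinfun_apply T ^^ i) v) = poly_apply q (cblinfun_apply T) v"
    by (rule poly_apply_sum[symmetric]) (simp add: n_def)
  finally show ?thesis .
qed

lemma funpow_invariant: "(\<And>x. x \<in> V \<Longrightarrow> f x \<in> V) \<Longrightarrow> v \<in> V \<Longrightarrow> (f ^^ n) v \<in> V"
  by (induction n) auto

text \<open>Split a linear factor off the annihilating polynomial: the quotient applied to
  \<open>v\<close> is either an eigenvector or 0, and in the second case the degree has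
  dropped.\<close>

lemma poly_apply_eigenvector:
  fixes T :: "'a :: complex_normed_vector \<Rightarrow>\<^sub>C\<^sub>L 'a" and p :: "complex poly"
  assumes V: "csubspace V" "\<And>x. x \<in> V \<Longrightarrow> T x \<in> V" and v: "v \<in> V" "v \<noteq> 0"
  shows "p \<noteq> 0 \<Longrightarrow> poly_apply p (cblinfun_apply T) v = 0 \<Longrightarrow> \<exists>l x. x \<in> V \<and> x \<noteq> 0 \<and> T x = l *\<^sub>C x"
proof (induction "degree p" arbitrary: p rule: less_induct)
  case less
  show ?case
  proof (cases "degree p = 0")
    case True
    then obtain c where c: "p = [:c:]" by (rule degree_eq_zeroE)
    then have "c *\<^sub>C v = 0" using less.prems(2) by (simp add: poly_apply_def)
    then have "inverse c *\<^sub>C (c *\<^sub>C v) = 0" by simp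
    then show ?thesis using c less.prems(1) v(2) by (simp add: scaleC_scaleC)
  next
    case False
    then have "\<exists>i\<in>{1..degree p}. coeff p i \<noteq> 0"
      by (intro bexI[of _ "degree p"]) (simp_all add: less.prems(1))
    then obtain a where "poly p a = 0"
      unfolding poly_altdef using fundamental_theorem_of_algebra[of "coeff p" "degree p"] by blast
    then obtain q where q: "p = [:- a, 1:] * q"
      using poly_eq_0_iff_dvd by (metis dvdE)
    have "q \<noteq> 0" using q less.prems(1) by auto
    then have deg: "degree q < degree p"
      unfolding q by (subst degree_mult_eq) auto
    let ?u = "poly_apply q (cblinfun_apply T) v"
    have uV: "?u \<in> V"
      unfolding poly_apply_def
      by (intro complex_vector.subspace_sum[OF V(1)] complex_vector.subspace_scale[OF V(1)] funpow_invariant V(2) v(1))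
    have "T ?u = a *\<^sub>C ?u"
      using less.prems(2) unfolding q poly_apply_linear_factor by simp
    then show ?thesis
      using uV less.hyps[OF deg \<open>q \<noteq> 0\<close>] by (cases "?u = 0") blast+
  qed
qed

lemma eigenvector_exists:
  fixes T :: "'a :: complex_normed_vector \<Rightarrow>\<^sub>C\<^sub>L 'a"
  assumes V: "csubspace V" "\<And>x. x \<in> V \<Longrightarrow> T x \<in> V" and v: "v \<in> V" "v \<noteq> 0" and B: "finite B" "V \<subseteq> cspan B"
  obtains l x where "x \<in> V" "x \<noteq> 0" "T x = l *\<^sub>C x"
proof -
  define n where "n = card B"
  define y where "y i = (cblinfun_apply T ^^ i) v" for i
  have y: "y i \<in> V" for i
    unfolding y_def by (rule funpow_invariant[OF V(2) v(1)])
  \<comment> \<open>These are \<open>n + 1\<close> vectors in the span of \<open>n\<close> vectors.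
    Repeated iterates form a case of their own because dependence is a property of sets, not of
    families.\<close>
  have "\<exists>c. (\<exists>i\<le>n. c i \<noteq> 0) \<and> (\<Sum>i\<le>n. c i *\<^sub>C y i) = 0"
  proof (cases "inj_on y {..n}")
    case False
    then obtain i j where ij: "i \<le> n" "j \<le> n" "i \<noteq> j" "y i = y j" by (auto simp: inj_on_def)
    define c where "c k = (if k = i then 1 else if k = j then - 1 else 0 :: complex)" for k
    have "(\<Sum>k\<le>n. c k *\<^sub>C y k) = (\<Sum>k\<in>{i, j}. c k *\<^sub>C y k)"
      using ij by (intro sum.mono_neutral_right) (auto simp: c_def)
    also have "\<dots> = 0" using ij(3,4) by (simp add: c_def complex_vector.scale_minus_left)
    finally show ?thesis using ij(1) by (intro exI[of _ c]) (auto simp: c_def)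
  next
    case True
    have "cdependent (y ` {..n})"
    proof (rule ccontr)
      assume "\<not> ?thesis"
      then have "card (y ` {..n}) \<le> card B"
        using complex_vector.independent_span_bound[OF B(1)] y B(2) by blast
      then show False using card_image[OF True] by (simp add: n_def)
    qed
    then obtain u where u: "\<exists>w\<in>y ` {..n}. u w \<noteq> 0" "(\<Sum>w\<in>y ` {..n}. u w *\<^sub>C w) = 0"
      using complex_vector.dependent_finite[of "y ` {..n}"] by blast
    then show ?thesis
      by (intro exI[of _ "\<lambda>i. u (y i)"]) (auto simp: sum.reindex[OF True])
  qed
  then obtain c where c: "\<exists>i\<le>n. c i \<noteq> 0" "(\<Sum>i\<le>n. c i *\<^sub>C y i) = 0" by blast
  define p where "p = (\<Sum>i\<le>n. monom (c i) i)"
  have coeff: "coeff p k = (if k \<le> n then c k else 0)" for k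
    by (simp add: p_def coeff_sum)
  have "p \<noteq> 0" using c(1) coeff by (metis coeff_0)
  moreover have "poly_apply p (cblinfun_apply T) v = 0"
  proof -
    have "degree p \<le> n" by (rule degree_le) (simp add: coeff)
    then show ?thesis using c(2) by (simp add: poly_apply_sum coeff y_def)
  qed
  ultimately show thesis
    using poly_apply_eigenvector[OF V v] that by metis
qed

lemma csubspace_dim_equal:
  assumes A: "csubspace A" "A \<subseteq> V" and B: "finite B" "V \<subseteq> cspan B" and dim: "cdim V \<le> cdim A"
  shows "A = V"
proof -
  obtain N where N: "finite N" "N \<subseteq> A" "\<not> cdependent N" "A \<subseteq> cspan N" "card N = cdim A"
    using finite_cbasis[OF B(1) subset_trans[OF A(2) B(2)]] by blast
  obtain D where D: "N \<subseteq> D" "D \<subseteq> V" "\<not> cdependent D" "V \<subseteq> cspan D"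
    using complex_vector.maximal_independent_subset_extend[OF subset_trans[OF N(2) A(2)] N(3)] by blast
  have "finite D"
    using complex_vector.independent_span_bound[OF B(1) D(3) subset_trans[OF D(2) B(2)]] by blast
  have "card D = cdim V" by (rule complex_vector.basis_card_eq_dim[OF D(2,4,3)])
  then have "N = D"
    using card_subset_eq[OF \<open>finite D\<close> D(1)] card_mono[OF \<open>finite D\<close> D(1)] N(5) dim by linarith
  then show ?thesis
    using D(4) A complex_vector.span_minimal[OF N(2) A(1)] by blast
qed

section \<open>Powers, ascent and the splitting of the generalized kernel\<close>

primrec opow :: "('a :: complex_normed_vector \<Rightarrow>\<^sub>C\<^sub>L 'a) \<Rightarrow> nat \<Rightarrow> ('a \<Rightarrow>\<^sub>C\<^sub>L 'a)" where
  "opow S 0 = id_cblinfun"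
| "opow S (Suc n) = S o\<^sub>C opow S n"

lemma opow_commute:
  fixes S B :: "'a :: complex_normed_vector \<Rightarrow>\<^sub>C\<^sub>L 'a"
  assumes "\<And>x. B (S x) = S (B x)"
  shows "B (opow S n x) = opow S n (B x)"
  by (induction n) (simp_all add: assms)

lemma opow_Suc_right: "opow S (Suc n) x = opow S n (S x)"
  using opow_commute[of S S n x] by simp

lemma range_opow_Suc: "range (cblinfun_apply (opow S (Suc n))) \<subseteq> range (cblinfun_apply (opow S n))"
  by (auto simp: opow_Suc_right simp del: opow.simps)

lemma range_opow_mono:
  "m \<le> n \<Longrightarrow> range (cblinfun_apply (opow S n)) \<subseteq> range (cblinfun_apply (opow S m))"
  by (rule lift_Suc_antimono_le) (rule range_opow_Suc)

lemma fin_perturbed_opow: "fin_perturbed S \<Longrightarrow> fin_perturbed (opow S n)"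
proof (induction n)
  case 0
  have "invertible_cblinfun (id_cblinfun :: 'a \<Rightarrow>\<^sub>C\<^sub>L 'a)"
    by (rule inverse_unique(2)) (rule compose_id)+
  then show ?case by (simp add: invertible_fin_perturbed)
next
  case (Suc n)
  then show ?case by (simp add: fin_perturbed_compose)
qed

lemma fin_perturbed_null_space:
  assumes "fin_perturbed S"
  obtains B where "finite B" "null_space S \<subseteq> cspan B"
proof -
  obtain n where "nullity S = enat n"
    using fin_perturbed_structure[OF assms] by metis
  then show thesis
    using that unfolding nullity_def edim_def by (auto split: if_splits)
qed

text \<open>The decreasing spaces \<open>A n\<close> lie in the finite dimensional kernel of
  \<open>S\<close> and become constant from some \<open>m\<close> on. This puts \<open>A m\<close>
  into every \<open>R n\<close>, and it is also why \<open>S\<close> maps the intersection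
  \<open>W\<close> onto itself. The cofactor \<open>G\<close> in \<open>factor\<close> has to
  commute with \<open>S\<close> so that it preserves \<open>W\<close>.\<close>

theorem SVEP_finite_ascent:
  fixes T S :: "'a :: complex_banach \<Rightarrow>\<^sub>C\<^sub>L 'a"
  assumes T: "SVEP T" and S: "fin_perturbed S" and comm: "\<And>x. T (S x) = S (T x)"
    and factor: "\<And>l x. T x = l *\<^sub>C x \<Longrightarrow> x \<noteq> 0 \<Longrightarrow> S x = 0 \<Longrightarrow>
      \<exists>G :: 'a \<Rightarrow>\<^sub>C\<^sub>L 'a. (\<forall>y. S y = (T - l *\<^sub>C id_cblinfun) (G y)) \<and> (\<forall>y. G (S y) = S (G y))"
  obtains m where "\<And>x. S x = 0 \<Longrightarrow> x \<in> range (cblinfun_apply (opow S m)) \<Longrightarrow> x = 0"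
proof -
  define R where "R n = range (cblinfun_apply (opow S n))" for n
  define A where "A n = null_space S \<inter> R n" for n
  obtain B where B: "finite B" "null_space S \<subseteq> cspan B"
    using fin_perturbed_null_space[OF S] by blast
  have R: "csubspace (R n)" "closed (R n)" for n
    using csubspace_range fin_perturbed_structure[OF fin_perturbed_opow[OF S]] by (metis R_def)+
  have R_mono: "R n \<subseteq> R m" if "m \<le> n" for m n
    unfolding R_def by (rule range_opow_mono[OF that])
  have R_S: "S x \<in> R (Suc n)" if "x \<in> R n" for x n
    using that by (auto simp: R_def)
  have R_inv: "G x \<in> R n" if "\<And>y. G (S y) = S (G y)" "x \<in> R n" for G :: "'a \<Rightarrow>\<^sub>C\<^sub>L 'a" and x n
    using that(2) opow_commute[OF that(1)] by (auto simp: R_def)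
  have A: "csubspace (A n)" for n
    unfolding A_def by (rule complex_vector.subspace_inter[OF csubspace_null_space R(1)])
  define m where "m = (ARG_MIN (\<lambda>n. cdim (A n)) n. True)"
  have m: "cdim (A m) \<le> cdim (A n)" for n
    unfolding m_def by (rule arg_min_nat_le) simp
  have A_eq: "A n = A m" if "m \<le> n" for n
    by (rule csubspace_dim_equal[OF A _ B(1) _ m]) (use R_mono[OF that] B(2) in \<open>auto simp: A_def\<close>)
  define W where "W = (\<Inter>n. R n)"
  have W: "csubspace W" "closed W"
    unfolding W_def using R by (auto intro: complex_vector.subspace_Inter)
  have W_inv: "G x \<in> W" if "\<And>y. G (S y) = S (G y)" "x \<in> W" for G :: "'a \<Rightarrow>\<^sub>C\<^sub>L 'a" and x
    using R_inv[OF that(1)] that(2) by (auto simp: W_def)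
  have A_W: "A m \<subseteq> W"
  proof
    fix x assume x: "x \<in> A m"
    have "x \<in> R n" for n
    proof (cases "m \<le> n")
      case True
      then show ?thesis using x A_eq[OF True] by (auto simp: A_def)
    next
      case False
      then show ?thesis using x R_mono[of n m] by (auto simp: A_def)
    qed
    then show "x \<in> W" by (simp add: W_def)
  qed
  have S_onto: "\<exists>x\<in>W. y = S x" if y: "y \<in> W" for y
  proof -
    have "\<exists>x\<in>R n. y = S x" for n
    proof -
      have "y \<in> R (Suc n)" using y by (simp add: W_def)
      then show ?thesis by (auto simp: R_def)
    qed
    \<comment> \<open>Each \<open>R n\<close> contains its own preimage of \<open>y\<close>. For
      \<open>n\<close> beyond \<open>m\<close> two of them differ by an element of
      \<open>A m\<close>, which equals \<open>A n\<close>; so the single preimage \<open>x m\<close>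
      lies in every \<open>R n\<close>.\<close>
    then obtain x where x: "\<And>n. x n \<in> R n" "\<And>n. y = S (x n)" by metis
    have "x m \<in> R n" for n
    proof (cases "m \<le> n")
      case True
      have "x m - x n \<in> R m"
        by (rule complex_vector.subspace_diff[OF R(1) x(1)]) (use x(1) R_mono[OF True] in blast)
      moreover have "S (x m - x n) = 0"
        using x(2)[of m] x(2)[of n] by simp
      ultimately have "x m - x n \<in> A n"
        unfolding A_eq[OF True] by (simp add: A_def null_space_def)
      then have "(x m - x n) + x n \<in> R n"
        by (intro complex_vector.subspace_add[OF R(1)] x(1)) (simp add: A_def)
      then show ?thesis by simp
    next
      case False
      then show ?thesis using x(1)[of m] R_mono[of n m] by auto
    qed
    then have "x m \<in> W" by (simp add: W_def)
    then show ?thesis using x(2) by blast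
  qed
  have "A m \<subseteq> {0}"
  proof (rule ccontr)
    assume "\<not> ?thesis"
    then obtain v where v: "v \<in> A m" "v \<noteq> 0" by blast
    have T_A: "T x \<in> A m" if "x \<in> A m" for x
      using that comm[of x] R_inv[OF comm] by (auto simp: A_def null_space_def)
    have A_B: "A m \<subseteq> cspan B" using B(2) by (auto simp: A_def)
    obtain l x where x: "x \<in> A m" "x \<noteq> 0" "T x = l *\<^sub>C x"
      by (rule eigenvector_exists[OF A T_A v B(1) A_B])
    have Sx: "S x = 0" using x(1) by (simp add: A_def null_space_def)
    obtain G :: "'a \<Rightarrow>\<^sub>C\<^sub>L 'a" where G: "\<And>y. S y = (T - l *\<^sub>C id_cblinfun) (G y)" "\<And>y. G (S y) = S (G y)"
      using factor[OF x(3,2) Sx] by blast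
    have T_W: "T y \<in> W" if "y \<in> W" for y by (rule W_inv[OF comm that])
    have "cblinfun_apply (T - l *\<^sub>C id_cblinfun) ` W = W"
    proof
      show "cblinfun_apply (T - l *\<^sub>C id_cblinfun) ` W \<subseteq> W"
        using T_W complex_vector.subspace_diff[OF W(1)] complex_vector.subspace_scale[OF W(1)] by auto
      show "W \<subseteq> cblinfun_apply (T - l *\<^sub>C id_cblinfun) ` W"
      proof
        fix y assume "y \<in> W"
        then obtain z where z: "z \<in> W" "y = S z" using S_onto by blast
        show "y \<in> cblinfun_apply (T - l *\<^sub>C id_cblinfun) ` W"
          unfolding z(2) G(1) by (rule imageI) (rule W_inv[OF G(2) z(1)])
      qed
    qed
    moreover have "x \<in> W" using x(1) A_W by blast
    moreover have "(T - l *\<^sub>C id_cblinfun) x = 0" using x(3) by simp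
    ultimately have "x = 0" by (rule SVEP_kernel_trivial[OF T W])
    then show False using x(2) by blast
  qed
  then show thesis
    using that[of m] by (auto simp: A_def R_def null_space_def)
qed

text \<open>Finite ascent together with index zero splits off the finite dimensional generalized kernel \<open>N(S\<^sup>p)\<close>: \<open>P\<close> is
  the projection onto it along \<open>R(S\<^sup>p)\<close>.\<close>

theorem fin_perturbed_splitting:
  fixes S :: "'a :: complex_banach \<Rightarrow>\<^sub>C\<^sub>L 'a"
  assumes S: "fin_perturbed S" and m: "\<And>x. S x = 0 \<Longrightarrow> x \<in> range (cblinfun_apply (opow S m)) \<Longrightarrow> x = 0"
  obtains P where "finite_rank P" "\<And>x. P (P x) = P x" "\<And>x. opow S (Suc m) (P x) = 0"
    "\<forall>B :: 'a \<Rightarrow>\<^sub>C\<^sub>L 'a. (\<forall>y. B (S y) = S (B y)) \<longrightarrow> (\<forall>x. B (P x) = P (B x))"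
    "invertible_cblinfun (S o\<^sub>C (id_cblinfun - P) + P)"
proof -
  \<comment> \<open>With exponent \<open>Suc m\<close> the kernel of \<open>S\<close> is contained
    in that of \<open>Q\<close> even for \<open>m = 0\<close>.\<close>
  define Q where "Q = opow S (Suc m)"
  have Q: "fin_perturbed Q" unfolding Q_def by (rule fin_perturbed_opow[OF S])
  have inj_pow: "x = 0" if "opow S k x = 0" "x \<in> range (cblinfun_apply (opow S m))" for k x
    using that
  proof (induction k arbitrary: x)
    case (Suc k)
    have "S x = 0"
    proof (rule Suc.IH)
      show "opow S k (S x) = 0" using Suc.prems(1) unfolding opow_Suc_right .
      obtain y where "x = opow S m y" using Suc.prems(2) by blast
      then have "S x = opow S m (S y)" using opow_commute[of S S m y] by simp
      then show "S x \<in> range (cblinfun_apply (opow S m))" by blast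
    qed
    then show ?case using m Suc.prems(2) by blast
  qed simp
  have disj: "x = 0" if "Q x = 0" "x \<in> range (cblinfun_apply Q)" for x
    using inj_pow[of "Suc m" x] that range_opow_Suc[of S m] unfolding Q_def by blast
  obtain B where B: "finite B" "null_space Q \<subseteq> cspan B"
    using fin_perturbed_null_space[OF Q] by blast
  obtain N where N: "finite N" "N \<subseteq> null_space Q" "\<not> cdependent N" "null_space Q \<subseteq> cspan N"
    using finite_cbasis[OF B] by metis
  obtain \<phi> :: "'a \<Rightarrow> 'a \<Rightarrow> complex" where \<phi>: "\<And>b. b \<in> N \<Longrightarrow> bounded_clinear (\<phi> b)"
      "\<And>b c. b \<in> N \<Longrightarrow> c \<in> N \<Longrightarrow> \<phi> b c = (if b = c then 1 else 0)"
    using dual_basis[OF N(1,3)] by blast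
  obtain F where F: "finite_rank F" "\<And>x. cblinfun_apply F x = (\<Sum>b\<in>N. \<phi> b x *\<^sub>C b)"
    using finite_rank_operator[OF N(1), of \<phi> "\<lambda>b. b"] \<phi>(1) by blast
  have F_null: "Q (F x) = 0" for x
    using N(2) by (auto simp: F(2) apply_sum null_space_def intro!: sum.neutral)
  have F_id: "F x = x" if x: "Q x = 0" for x
  proof -
    obtain u where u: "x = (\<Sum>b\<in>N. u b *\<^sub>C b)"
      using x N(4) cspan_finite_sum[OF N(1)] by (auto simp: null_space_def)
    have F_b: "F b = b" if b: "b \<in> N" for b
    proof -
      have "(\<Sum>c\<in>N. \<phi> c b *\<^sub>C c) = (\<Sum>c\<in>N. if c = b then b else 0)"
        using \<phi>(2)[OF _ b] by (intro sum.cong) auto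
      then show ?thesis using b N(1) by (simp add: F(2))
    qed
    show ?thesis
      unfolding u apply_sum by (intro sum.cong) (simp_all add: F_b)
  qed
  have "invertible_cblinfun (Q + F)"
  proof (rule fin_perturbed_inj_invertible[OF fin_perturbed_add[OF Q F(1)]])
    fix x assume x: "(Q + F) x = 0"
    then have "F x = Q (- x)" by (simp add: eq_neg_iff_add_eq_0 add.commute)
    then have "F x = 0" using disj[of "F x"] F_null by (metis rangeI)
    then show "x = 0" using x F_id by simp
  qed
  note inv = inverse_apply[OF this]
  \<comment> \<open>\<open>F\<close> takes values in the kernel of \<open>Q\<close> and is the
    identity there, so this formula gives the projection onto that kernel, and
    \<open>x - P x\<close> is the value of \<open>Q\<close> at the same preimage.\<close>
  define P where "P = F o\<^sub>C cblinfun_inverse (Q + F)"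
  have P_fin: "finite_rank P" unfolding P_def by (rule finite_rank_compose_right[OF F(1)])
  have P: "Q (P x) = 0" "x - P x \<in> range (cblinfun_apply Q)" for x
  proof -
    show "Q (P x) = 0" by (simp add: P_def F_null)
    have "x - P x = Q (cblinfun_inverse (Q + F) x)"
      using inv(2)[of x] by (simp add: P_def algebra_simps)
    then show "x - P x \<in> range (cblinfun_apply Q)" by blast
  qed
  have P_unique: "P (u + v) = u" if u: "Q u = 0" and v: "v \<in> range (cblinfun_apply Q)" for u v
  proof -
    have "(u + v - P (u + v)) - v \<in> range (cblinfun_apply Q)"
      by (rule complex_vector.subspace_diff[OF csubspace_range P(2) v])
    moreover have "Q (u - P (u + v)) = 0" using u P(1)[of "u + v"] by (simp only: apply_diff diff_self)
    ultimately have "u - P (u + v) = 0" using disj[of "u - P (u + v)"] by (simp add: algebra_simps)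
    then show ?thesis by simp
  qed
  \<comment> \<open>\<open>C\<close> preserves kernel and range of \<open>Q\<close>, so uniqueness
    of the decomposition forces it to commute with the projection.\<close>
  have comm: "C (P x) = P (C x)" if C: "\<And>y. C (S y) = S (C y)" for C :: "'a \<Rightarrow>\<^sub>C\<^sub>L 'a" and x
  proof -
    have CQ: "C (Q y) = Q (C y)" for y unfolding Q_def by (rule opow_commute[OF C])
    obtain y where y: "x - P x = Q y" using P(2) by blast
    have "P (C (P x) + C (x - P x)) = C (P x)"
    proof (rule P_unique)
      show "Q (C (P x)) = 0" using CQ[of "P x"] P(1) by simp
      show "C (x - P x) \<in> range (cblinfun_apply Q)" unfolding y CQ by blast
    qed
    moreover have "C (P x) + C (x - P x) = C x" by simp
    ultimately show ?thesis by simp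
  qed
  show thesis
  proof (rule that[of P])
    show "finite_rank P" by (rule P_fin)
    show "P (P x) = P x" for x
      using P_unique[OF P(1)[of x] range_eqI[of 0 _ 0]] by simp
    show "opow S (Suc m) (P x) = 0" for x using P(1) unfolding Q_def .
    show "\<forall>B :: 'a \<Rightarrow>\<^sub>C\<^sub>L 'a. (\<forall>y. B (S y) = S (B y)) \<longrightarrow> (\<forall>x. B (P x) = P (B x))"
      using comm by simp
    \<comment> \<open>A finite rank change of \<open>S\<close>, so injectivity alone yields
      invertibility.\<close>
    have eq: "S o\<^sub>C (id_cblinfun - P) + P = S + (P - S o\<^sub>C P)"
      by (rule cblinfun_eqI) simp
    have "fin_perturbed (S o\<^sub>C (id_cblinfun - P) + P)"
      unfolding eq by (intro fin_perturbed_add[OF S] finite_rank_diff finite_rank_compose_left P_fin)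
    then show "invertible_cblinfun (S o\<^sub>C (id_cblinfun - P) + P)"
    proof (rule fin_perturbed_inj_invertible)
      fix x assume "(S o\<^sub>C (id_cblinfun - P) + P) x = 0"
      then have x: "S (x - P x) + P x = 0" by simp
      obtain y where y: "x - P x = Q y" using P(2) by blast
      have "S (Q y) = Q (S y)" unfolding Q_def by (rule opow_commute) simp
      then have "P x = Q (- S y)" using x unfolding y by (simp add: eq_neg_iff_add_eq_0 add.commute)
      then have Px: "P x = 0" using disj[OF P(1)] by (metis rangeI)
      then have "S x = 0" using x by simp
      then have "Q x = 0" unfolding Q_def opow_Suc_right by simp
      moreover have "x \<in> range (cblinfun_apply Q)" using P(2)[of x] Px by simp
      ultimately show "x = 0" by (rule disj)
    qed
  qed
qed


section \<open>Cycles around a compact set\<close>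

text \<open>A continuous derivative on the whole parameter interval makes every continuous integrand
  integrable and permits the exchange of two contour integrals. Other closed paths are replaced by
  such loops through polynomial approximation.\<close>

definition smooth_loop :: "(real \<Rightarrow> complex) \<Rightarrow> bool" where
  "smooth_loop p \<longleftrightarrow> valid_path p \<and> pathfinish p = pathstart p \<and>
     continuous_on {0..1} (\<lambda>t. vector_derivative p (at t))"

lemma smooth_loop_approx:
  assumes W: "open W" and \<gamma>: "valid_path \<gamma>" "pathfinish \<gamma> = pathstart \<gamma>" "path_image \<gamma> \<subseteq> W"
  obtains p where "smooth_loop p" "path_image p \<subseteq> W"
    "\<And>f. f holomorphic_on W \<Longrightarrow> contour_integral p f = contour_integral \<gamma> f"
proof -
  obtain d where d: "0 < d" "\<And>g h. \<lbrakk>valid_path g; valid_path h; \<forall>t\<in>{0..1}. cmod (g t - \<gamma> t) < d \<and> cmod (h t - \<gamma> t) < d;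
      pathstart h = pathstart g; pathfinish h = pathfinish g\<rbrakk> \<Longrightarrow>
      path_image g \<subseteq> W \<and> path_image h \<subseteq> W \<and> (\<forall>f. f holomorphic_on W \<longrightarrow> contour_integral h f = contour_integral g f)"
    using contour_integral_nearby_ends[OF W valid_path_imp_path[OF \<gamma>(1)] \<gamma>(3)] by metis
  obtain p where p: "polynomial_function p" "pathstart p = pathstart \<gamma>" "pathfinish p = pathfinish \<gamma>"
      "\<And>t. t \<in> {0..1} \<Longrightarrow> norm (p t - \<gamma> t) < d"
    using path_approx_polynomial_function[OF valid_path_imp_path[OF \<gamma>(1)] d(1)] by metis
  have vp: "valid_path p"
    using p(1) by (rule valid_path_polynomial_function)
  have *: "path_image \<gamma> \<subseteq> W \<and> path_image p \<subseteq> W \<and> (\<forall>f. f holomorphic_on W \<longrightarrow> contour_integral p f = contour_integral \<gamma> f)"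
    by (rule d(2)[OF \<gamma>(1) vp]) (use p d(1) in auto)
  obtain p' where p': "polynomial_function p'" "\<And>x. (p has_vector_derivative p' x) (at x)"
    using has_vector_derivative_polynomial_function[OF p(1)] by blast
  have "(\<lambda>t. vector_derivative p (at t)) = p'"
    using p'(2) vector_derivative_at by blast
  then have "continuous_on {0..1} (\<lambda>t. vector_derivative p (at t))"
    using continuous_on_polymonial_function[OF p'(1)] by metis
  then have "smooth_loop p"
    using vp p(2,3) \<gamma>(2) by (simp add: smooth_loop_def)
  then show thesis using that * by blast
qed

lemma contour_integral_sum_list:
  assumes "\<And>x. x \<in> set xs \<Longrightarrow> f x contour_integrable_on \<gamma>"
  shows "contour_integral \<gamma> (\<lambda>z. \<Sum>x\<leftarrow>xs. f x z) = (\<Sum>x\<leftarrow>xs. contour_integral \<gamma> (f x))"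
    and "(\<lambda>z. \<Sum>x\<leftarrow>xs. f x z) contour_integrable_on \<gamma>"
proof -
  have "contour_integral \<gamma> (\<lambda>z. \<Sum>x\<leftarrow>xs. f x z) = (\<Sum>x\<leftarrow>xs. contour_integral \<gamma> (f x)) \<and>
    (\<lambda>z. \<Sum>x\<leftarrow>xs. f x z) contour_integrable_on \<gamma>"
    using assms
  proof (induction xs)
    case (Cons a xs)
    then show ?case
      by (simp add: contour_integral_add contour_integrable_add)
  qed (use has_contour_integral_0 has_contour_integral_integrable in auto)
  then show "contour_integral \<gamma> (\<lambda>z. \<Sum>x\<leftarrow>xs. f x z) = (\<Sum>x\<leftarrow>xs. contour_integral \<gamma> (f x))"
    and "(\<lambda>z. \<Sum>x\<leftarrow>xs. f x z) contour_integrable_on \<gamma>" by blast+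
qed

section \<open>Closed polygons from permuted segments\<close>

lemma closed_orbit:
  assumes E: "finite E" and \<pi>: "bij_betw \<pi> E E" and e: "e \<in> E"
  obtains n where "(\<pi> ^^ Suc n) e = e" "inj_on (\<lambda>k. (\<pi> ^^ k) e) {..n}"
proof -
  have in_E: "(\<pi> ^^ k) e \<in> E" for k
    by (induction k) (use e \<pi> in \<open>auto simp: bij_betw_def\<close>)
  have inj: "x = y" if "x \<in> E" "y \<in> E" "(\<pi> ^^ k) x = (\<pi> ^^ k) y" for k x y
    using that
  proof (induction k arbitrary: x y)
    case (Suc k)
    have "\<pi> x \<in> E" "\<pi> y \<in> E"
      using \<pi> Suc.prems(1,2) by (simp_all add: bij_betw_apply)
    moreover have "(\<pi> ^^ k) (\<pi> x) = (\<pi> ^^ k) (\<pi> y)"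
      using Suc.prems(3) by (simp only: funpow_Suc_right o_apply)
    ultimately have "\<pi> x = \<pi> y" by (rule Suc.IH)
    with \<pi> Suc.prems(1,2) show ?case
      unfolding bij_betw_def by (meson inj_onD)
  qed simp
  have shift: "(\<pi> ^^ (j - i)) e = e" if "i < j" "(\<pi> ^^ i) e = (\<pi> ^^ j) e" for i j
  proof -
    have "(\<pi> ^^ i) ((\<pi> ^^ (j - i)) e) = (\<pi> ^^ i) e"
      using that funpow_add[of i "j - i" \<pi>] by simp
    then show ?thesis using inj[OF in_E e] by simp
  qed
  have "\<not> inj (\<lambda>k. (\<pi> ^^ k) e)"
    using in_E E finite_imageD[of "\<lambda>k. (\<pi> ^^ k) e" UNIV] finite_subset[of "range (\<lambda>k. (\<pi> ^^ k) e)" E]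
    by auto
  then obtain i j where "i \<noteq> j" "(\<pi> ^^ i) e = (\<pi> ^^ j) e"
    by (auto simp: inj_def)
  then have ex: "\<exists>k>0. (\<pi> ^^ k) e = e"
    using shift[of i j] shift[of j i] by (metis nat_neq_iff zero_less_diff)
  define m where "m = (LEAST k. 0 < k \<and> (\<pi> ^^ k) e = e)"
  have m: "0 < m" "(\<pi> ^^ m) e = e"
    using LeastI_ex[OF ex] by (simp_all add: m_def)
  have least: "m \<le> k" if "0 < k" "(\<pi> ^^ k) e = e" for k
    unfolding m_def by (rule Least_le) (use that in blast)
  obtain n where n: "m = Suc n" using m(1) by (cases m) auto
  show thesis
  proof (rule that[of n])
    show "(\<pi> ^^ Suc n) e = e" using m(2) n by simp
    have "i = j" if "i \<le> n" "j \<le> n" "(\<pi> ^^ i) e = (\<pi> ^^ j) e" for i j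
    proof (rule ccontr)
      assume "i \<noteq> j"
      then consider "i < j" | "j < i" by linarith
      then show False
      proof cases
        case 1
        then show False using least[of "j - i"] shift[of i j] that n by simp
      next
        case 2
        then show False using least[of "i - j"] shift[of j i] that n by simp
      qed
    qed
    then show "inj_on (\<lambda>k. (\<pi> ^^ k) e) {..n}" by (auto simp: inj_on_def)
  qed
qed

text \<open>A finite family of segments, permuted so that each one ends where its successor starts, is a
  union of closed polygons: one for each cycle of the permutation.\<close>

lemma segments_to_loops:
  fixes a b :: "'e \<Rightarrow> complex"
  assumes "finite E" "bij_betw \<pi> E E" "\<And>e. e \<in> E \<Longrightarrow> b e = a (\<pi> e)"
    "\<And>e. e \<in> E \<Longrightarrow> closed_segment (a e) (b e) \<subseteq> W"
  shows "\<exists>\<Gamma>. (\<forall>\<gamma>\<in>set \<Gamma>. valid_path \<gamma> \<and> pathfinish \<gamma> = pathstart \<gamma> \<and> path_image \<gamma> \<subseteq> W) \<and>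
    (\<forall>g. continuous_on W g \<longrightarrow>
      (\<Sum>\<gamma>\<leftarrow>\<Gamma>. contour_integral \<gamma> g) = (\<Sum>e\<in>E. contour_integral (linepath (a e) (b e)) g))"
  using assms
proof (induction "card E" arbitrary: E rule: less_induct)
  case less
  show ?case
  proof (cases "E = {}")
    case True
    then show ?thesis by (intro exI[of _ "[]"]) auto
  next
    case False
    then obtain e where e: "e \<in> E" by blast
    obtain n where n: "(\<pi> ^^ Suc n) e = e" "inj_on (\<lambda>k. (\<pi> ^^ k) e) {..n}"
      using closed_orbit[OF less.prems(1,2) e] by blast
    define x where "x k = (\<pi> ^^ k) e" for k
    have x_Suc: "\<pi> (x k) = x (Suc k)" for k by (simp add: x_def)
    have x_E: "x k \<in> E" for k
      by (induction k) (use e less.prems(2) in \<open>auto simp: x_def bij_betw_def\<close>)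
    define p where "p = rec_nat (linepath (a (x 0)) (b (x 0))) (\<lambda>k q. q +++ linepath (a (x (Suc k))) (b (x (Suc k))))"
    have p0: "p 0 = linepath (a (x 0)) (b (x 0))" and p_Suc: "p (Suc k) = p k +++ linepath (a (x (Suc k))) (b (x (Suc k)))" for k
      by (simp_all add: p_def)
    have p: "valid_path (p k) \<and> pathstart (p k) = a (x 0) \<and> pathfinish (p k) = b (x k) \<and> path_image (p k) \<subseteq> W \<and>
      (\<forall>g. continuous_on W g \<longrightarrow> g contour_integrable_on p k \<and>
        contour_integral (p k) g = (\<Sum>j\<le>k. contour_integral (linepath (a (x j)) (b (x j))) g))" for k
    proof (induction k)
      case 0
      then show ?case
        using less.prems(4)[OF x_E[of 0]]
        by (auto simp: p0 intro!: contour_integrable_continuous_linepath intro: continuous_on_subset)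
    next
      case (Suc k)
      have join: "pathfinish (p k) = pathstart (linepath (a (x (Suc k))) (b (x (Suc k))))"
        using Suc less.prems(3)[OF x_E[of k]] by (simp add: x_Suc)
      have img: "path_image (p (Suc k)) \<subseteq> W"
        unfolding p_Suc path_image_join[OF join] using Suc less.prems(4)[OF x_E[of "Suc k"]] by simp
      have int: "g contour_integrable_on linepath (a (x (Suc k))) (b (x (Suc k)))" if "continuous_on W g" for g
        using that less.prems(4)[OF x_E[of "Suc k"]]
        by (intro contour_integrable_continuous_linepath) (blast intro: continuous_on_subset)
      have "g contour_integrable_on p (Suc k) \<and>
          contour_integral (p (Suc k)) g = (\<Sum>j\<le>Suc k. contour_integral (linepath (a (x j)) (b (x j))) g)"
        if g: "continuous_on W g" for g
        unfolding p_Suc using Suc int[OF g] g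
        by (simp add: contour_integrable_joinI contour_integral_join)
      then show ?case
        using Suc join img by (simp add: p_Suc valid_path_join)
    qed
    define Orb where "Orb = x ` {..n}"
    have Orb: "Orb \<subseteq> E" using x_E by (auto simp: Orb_def)
    have "\<pi> ` Orb = Orb"
    proof -
      have "\<pi> ` Orb = x ` Suc ` {..n}"
        by (auto simp: Orb_def x_Suc image_iff)
      also have "Suc ` {..n} = {1..Suc n}"
        by (simp add: image_Suc_atMost)
      also have "x ` {1..Suc n} = x ` {..n}"
      proof -
        have "x (Suc n) = x 0" using n(1) by (simp add: x_def)
        moreover have "{1..Suc n} = insert (Suc n) {1..n}" "{..n} = insert 0 {1..n}" by auto
        ultimately show ?thesis by (metis image_insert)
      qed
      finally show ?thesis by (simp add: Orb_def)
    qed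
    have bij': "bij_betw \<pi> (E - Orb) (E - Orb)"
    proof -
      have "bij_betw \<pi> Orb Orb"
        using bij_betw_subset[OF less.prems(2) Orb] \<open>\<pi> ` Orb = Orb\<close> by simp
      then show ?thesis
        by (rule bij_betw_DiffI[OF less.prems(2) _ Orb Orb])
    qed
    have "card (E - Orb) < card E"
    proof -
      have "x 0 = e" by (simp add: x_def)
      then have "e \<in> Orb" by (auto simp: Orb_def)
      then show ?thesis
        using e less.prems(1) by (intro psubset_card_mono) auto
    qed
    then obtain \<Gamma> where \<Gamma>: "\<forall>\<gamma>\<in>set \<Gamma>. valid_path \<gamma> \<and> pathfinish \<gamma> = pathstart \<gamma> \<and> path_image \<gamma> \<subseteq> W"
      "\<forall>g. continuous_on W g \<longrightarrow>
        (\<Sum>\<gamma>\<leftarrow>\<Gamma>. contour_integral \<gamma> g) = (\<Sum>e\<in>E - Orb. contour_integral (linepath (a e) (b e)) g)"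
      using less.hyps[of "E - Orb", OF _ _ bij'] less.prems by auto
    have inj: "inj_on x {..n}" using n(2) by (simp add: x_def[abs_def])
    have closed: "pathfinish (p n) = pathstart (p n)"
      using p[of n] less.prems(3)[OF x_E[of n]] n(1) by (simp add: x_Suc) (simp add: x_def)
    have "(\<Sum>\<gamma>\<leftarrow>p n # \<Gamma>. contour_integral \<gamma> g) = (\<Sum>e\<in>E. contour_integral (linepath (a e) (b e)) g)"
      if g: "continuous_on W g" for g
    proof -
      have "(\<Sum>e\<in>Orb. contour_integral (linepath (a e) (b e)) g) = contour_integral (p n) g"
        unfolding Orb_def sum.reindex[OF inj] using p[of n] g by simp
      then show ?thesis
        using \<Gamma>(2) g sum.subset_diff[OF Orb less.prems(1), of "\<lambda>e. contour_integral (linepath (a e) (b e)) g"]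
        by simp
    qed
    then show ?thesis
      using \<Gamma>(1) p[of n] closed by (intro exI[of _ "p n # \<Gamma>"]) simp
  qed
qed


text \<open>A grid of squares of side \<open>h\<close>: \<open>c\<close> is a centre and \<open>d\<close> is \<open>h\<close> times a fourth root of unity. The
  pair \<open>(c, d)\<close> stands for the edge in direction \<open>d\<close> that has the square around \<open>c\<close> on its left and
  the square around \<open>c - \<i> * d\<close> on its right. Among the edges of the squares in \<open>Q\<close>, those with another square of
  \<open>Q\<close> on the right cancel in pairs; the walk along the remaining ones turns right whenever possible, so it has
  an inverse.\<close>

definition edge_start :: "complex \<times> complex \<Rightarrow> complex" where
  "edge_start e = fst e - (1 + \<i>) / 2 * snd e"

definition edge_end :: "complex \<times> complex \<Rightarrow> complex" where
  "edge_end e = fst e + (1 - \<i>) / 2 * snd e"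

definition edges :: "complex set \<Rightarrow> real \<Rightarrow> (complex \<times> complex) set" where
  "edges Q h = {(c, d). c \<in> Q \<and> d \<in> {of_real h, \<i> * of_real h, - of_real h, - \<i> * of_real h}}"

definition boundary_edges :: "complex set \<Rightarrow> real \<Rightarrow> (complex \<times> complex) set" where
  "boundary_edges Q h = {(c, d) \<in> edges Q h. c - \<i> * d \<notin> Q}"

definition next_edge :: "complex set \<Rightarrow> complex \<times> complex \<Rightarrow> complex \<times> complex" where
  "next_edge Q = (\<lambda>(c, d). if c + d - \<i> * d \<in> Q then (c + d - \<i> * d, - \<i> * d)
     else if c + d \<in> Q then (c + d, d) else (c, \<i> * d))"

definition previous_edge :: "complex set \<Rightarrow> complex \<times> complex \<Rightarrow> complex \<times> complex" where
  "previous_edge Q = (\<lambda>(c, d). if c - d - \<i> * d \<in> Q then (c - d - \<i> * d, \<i> * d)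
     else if c - d \<in> Q then (c - d, d) else (c, - \<i> * d))"

lemma i_times_i: "\<i> * (\<i> * d) = - d"
  by (simp flip: mult.assoc)

lemma edges_eq: "edges Q h = Q \<times> {of_real h, \<i> * of_real h, - of_real h, - \<i> * of_real h}"
  by (auto simp: edges_def)

lemma finite_edges: "finite Q \<Longrightarrow> finite (edges Q h)"
  by (simp add: edges_eq)

lemma finite_boundary_edges: "finite Q \<Longrightarrow> finite (boundary_edges Q h)"
  by (rule finite_subset[OF _ finite_edges[of Q h]]) (auto simp: boundary_edges_def)

text \<open>The branches turn right, go straight on and turn left. Preferring the right turn settles
  the corners at which two squares of \<open>Q\<close> meet only diagonally; the tests of
  \<open>previous_edge\<close> on the new edge then reveal which branch was taken.\<close>

lemma next_edge_boundary:
  assumes "e \<in> boundary_edges Q h"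
  shows "next_edge Q e \<in> boundary_edges Q h"
    and "previous_edge Q (next_edge Q e) = e"
    and "edge_end e = edge_start (next_edge Q e)"
proof -
  obtain c d where e: "e = (c, d)" by (cases e)
  have c: "c \<in> Q" "c - \<i> * d \<notin> Q" and d: "d \<in> {of_real h, \<i> * of_real h, - of_real h, - \<i> * of_real h}"
    using assms by (auto simp: e boundary_edges_def edges_def)
  let ?M = "{of_real h, \<i> * of_real h, - of_real h, - \<i> * of_real h}"
  have mem: "(x, y) \<in> boundary_edges Q h \<longleftrightarrow> x \<in> Q \<and> x - \<i> * y \<notin> Q \<and> y \<in> ?M" for x y
    by (auto simp: boundary_edges_def edges_def)
  have d': "\<i> * d \<in> ?M" "- \<i> * d \<in> ?M"
    using d by (auto simp: i_times_i)
  have ii: "\<i> * (- \<i> * d) = d" "- \<i> * (\<i> * d) = d"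
    by (simp_all add: i_times_i)
  consider "c + d - \<i> * d \<in> Q" | "c + d - \<i> * d \<notin> Q" "c + d \<in> Q" | "c + d - \<i> * d \<notin> Q" "c + d \<notin> Q"
    by blast
  then have "next_edge Q e \<in> boundary_edges Q h \<and> previous_edge Q (next_edge Q e) = e \<and>
    edge_end e = edge_start (next_edge Q e)"
  proof cases
    case 1
    then have n: "next_edge Q e = (c + d - \<i> * d, - \<i> * d)"
      by (simp add: next_edge_def e)
    have eq: "(c + d - \<i> * d) - \<i> * (- \<i> * d) = c - \<i> * d"
      "(c + d - \<i> * d) - (- \<i> * d) - \<i> * (- \<i> * d) = c"
      unfolding ii by simp_all
    have "previous_edge Q (next_edge Q e) = e"
      unfolding n previous_edge_def prod.case eq using c(1) by (simp only: if_True ii e)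
    moreover have "edge_end e = edge_start (next_edge Q e)"
      unfolding n unfolding e by (simp add: edge_end_def edge_start_def complex_eq_iff field_simps)
    moreover have "next_edge Q e \<in> boundary_edges Q h"
      unfolding n mem eq using 1 c(2) d'(2) by blast
    ultimately show ?thesis by blast
  next
    case 2
    then have n: "next_edge Q e = (c + d, d)"
      by (simp add: next_edge_def e)
    have eq: "c + d - d - \<i> * d = c - \<i> * d" "c + d - d = c"
      by simp_all
    have "previous_edge Q (next_edge Q e) = e"
      unfolding n previous_edge_def prod.case eq using c by (simp add: e)
    moreover have "edge_end e = edge_start (next_edge Q e)"
      unfolding n unfolding e by (simp add: edge_end_def edge_start_def complex_eq_iff field_simps)
    moreover have "next_edge Q e \<in> boundary_edges Q h"
      unfolding n mem using 2 d by blast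
    ultimately show ?thesis by blast
  next
    case 3
    then have n: "next_edge Q e = (c, \<i> * d)"
      by (simp add: next_edge_def e)
    have eq: "c - \<i> * (\<i> * d) = c + d" "c - \<i> * d - \<i> * (\<i> * d) = c + d - \<i> * d"
      unfolding i_times_i by simp_all
    have "previous_edge Q (next_edge Q e) = e"
      unfolding n previous_edge_def prod.case eq using c 3 by (simp only: if_False ii e)
    moreover have "edge_end e = edge_start (next_edge Q e)"
      unfolding n unfolding e by (simp add: edge_end_def edge_start_def complex_eq_iff field_simps)
    moreover have "next_edge Q e \<in> boundary_edges Q h"
      unfolding n mem eq using 3 c d'(1) by blast
    ultimately show ?thesis by blast
  qed
  then show "next_edge Q e \<in> boundary_edges Q h"
    and "previous_edge Q (next_edge Q e) = e"
    and "edge_end e = edge_start (next_edge Q e)" by blast+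
qed

lemma bij_next_edge:
  assumes "finite Q"
  shows "bij_betw (next_edge Q) (boundary_edges Q h) (boundary_edges Q h)"
proof -
  have "inj_on (next_edge Q) (boundary_edges Q h)"
    by (rule inj_on_inverseI[where g = "previous_edge Q"]) (rule next_edge_boundary(2))
  moreover have "next_edge Q ` boundary_edges Q h \<subseteq> boundary_edges Q h"
    using next_edge_boundary(1) by blast
  ultimately show ?thesis
    using endo_inj_surj[OF finite_boundary_edges[OF assms]] by (simp add: bij_betw_def)
qed

text \<open>\<open>\<tau>\<close> exchanges the two orientations of an edge between two squares of
  \<open>Q\<close>, so the sum over these inner edges equals its own negative.\<close>

lemma sum_edges_eq_boundary:
  assumes Q: "finite Q"
  shows "(\<Sum>e\<in>edges Q h. contour_integral (linepath (edge_start e) (edge_end e)) g) =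
    (\<Sum>e\<in>boundary_edges Q h. contour_integral (linepath (edge_start e) (edge_end e)) g)"
proof -
  let ?I = "\<lambda>e. contour_integral (linepath (edge_start e) (edge_end e)) g"
  define X where "X = edges Q h - boundary_edges Q h"
  define \<tau> where "\<tau> = (\<lambda>(c, d). (c - \<i> * d, - d) :: complex \<times> complex)"
  have X: "X = {(c, d). c \<in> Q \<and> c - \<i> * d \<in> Q \<and> d \<in> {of_real h, \<i> * of_real h, - of_real h, - \<i> * of_real h}}"
    by (auto simp: X_def edges_def boundary_edges_def)
  have \<tau>_X: "\<tau> e \<in> X" if "e \<in> X" for e
    using that by (auto simp: X \<tau>_def)
  have \<tau>\<tau>: "\<tau> (\<tau> e) = e" for e
    by (simp add: \<tau>_def split: prod.splits)
  have "?I (\<tau> e) = - ?I e" for e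
  proof -
    have "edge_start (\<tau> e) = edge_end e" "edge_end (\<tau> e) = edge_start e"
      by (simp_all add: \<tau>_def edge_start_def edge_end_def field_simps split: prod.splits)
    then show ?thesis
      using contour_integral_reversepath[OF valid_path_linepath, of "edge_start e" "edge_end e" g]
      by (simp add: reversepath_linepath)
  qed
  then have "(\<Sum>e\<in>X. ?I e) = (\<Sum>e\<in>X. - ?I e)"
    by (intro sum.reindex_bij_witness[of X \<tau> \<tau>]) (simp_all add: \<tau>\<tau> \<tau>_X)
  then have "(\<Sum>e\<in>X. ?I e) = 0"
    by (simp add: sum_negf)
  moreover have "boundary_edges Q h \<subseteq> edges Q h"
    by (auto simp: boundary_edges_def)
  ultimately show ?thesis
    using sum.subset_diff[OF _ finite_edges[OF Q], of "boundary_edges Q h" h ?I] by (simp add: X_def)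
qed

section \<open>Cauchy's formula on a grid and cycles around compact sets\<close>

definition grid_square :: "complex \<Rightarrow> real \<Rightarrow> complex set" where
  "grid_square c h = cbox (c - (1 + \<i>) / 2 * of_real h) (c + (1 + \<i>) / 2 * of_real h)"

lemma mem_grid_square: "z \<in> grid_square c h \<longleftrightarrow> \<bar>Re z - Re c\<bar> \<le> h / 2 \<and> \<bar>Im z - Im c\<bar> \<le> h / 2"
  unfolding abs_diff_le_iff grid_square_def in_cbox_complex_iff by auto

lemma edge_in_grid_square:
  assumes e: "e \<in> edges {c} h" and h: "0 < h"
  shows "closed_segment (edge_start e) (edge_end e) \<subseteq> grid_square c h"
proof -
  have "edge_start e \<in> grid_square c h" "edge_end e \<in> grid_square c h"
    using e h by (auto simp: edges_def edge_start_def edge_end_def mem_grid_square field_simps)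
  then show ?thesis
    unfolding grid_square_def by (rule closed_segment_subset) (rule convex_box)
qed

text \<open>Keeps the cycle away from the compact set: the square to the right of a boundary edge
  does not meet it, and the edge lies in that square too.\<close>

lemma edge_in_right_square:
  assumes e: "(c, d) \<in> edges Q h" and h: "0 < h"
  shows "closed_segment (edge_start (c, d)) (edge_end (c, d)) \<subseteq> grid_square (c - \<i> * d) h"
proof -
  have "edge_start (c, d) \<in> grid_square (c - \<i> * d) h" "edge_end (c, d) \<in> grid_square (c - \<i> * d) h"
    using e h by (auto simp: edges_def edge_start_def edge_end_def mem_grid_square field_simps)
  then show ?thesis
    unfolding grid_square_def by (rule closed_segment_subset) (rule convex_box)
qed

text \<open>Points on the sides of the square are left out here; they are reached by continuity once
  inner edges have cancelled.\<close>

lemma contour_integral_grid_square: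
  assumes h: "0 < h" and f: "f holomorphic_on S" and S: "grid_square c h \<subseteq> S"
    and z: "z \<in> box (c - (1 + \<i>) / 2 * of_real h) (c + (1 + \<i>) / 2 * of_real h) \<or> z \<notin> grid_square c h"
  shows "(\<Sum>e\<in>edges {c} h. contour_integral (linepath (edge_start e) (edge_end e)) (\<lambda>w. f w / (w - z))) =
    (if z \<in> grid_square c h then 2 * of_real pi * \<i> * f z else 0)"
proof -
  define a where "a = c - (1 + \<i>) / 2 * of_real h"
  define b where "b = c + (1 + \<i>) / 2 * of_real h"
  define p q where "p = Complex (Re b) (Im a)" and "q = Complex (Re a) (Im b)"
  let ?g = "\<lambda>w. f w / (w - z)"
  have ab: "Re a < Re b" "Im a < Im b"
    using h by (simp_all add: a_def b_def)
  have sq: "grid_square c h = cbox a b" by (simp add: grid_square_def a_def b_def)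
  have pts: "edge_start (c, of_real h) = a" "edge_end (c, of_real h) = p"
    "edge_start (c, \<i> * of_real h) = p" "edge_end (c, \<i> * of_real h) = b"
    "edge_start (c, - of_real h) = b" "edge_end (c, - of_real h) = q"
    "edge_start (c, - \<i> * of_real h) = q" "edge_end (c, - \<i> * of_real h) = a"
    by (simp_all add: edge_start_def edge_end_def a_def b_def p_def q_def complex_eq_iff field_simps)
  have rect: "rectpath a b = linepath a p +++ linepath p b +++ linepath b q +++ linepath q a"
    by (simp add: rectpath_def p_def q_def Let_def)
  have image: "path_image (rectpath a b) \<subseteq> cbox a b - {z}"
    using z path_image_rectpath_subset_cbox[of a b] path_image_rectpath_inter_box[of a b] ab
    unfolding sq a_def[symmetric] b_def[symmetric] by (auto simp: less_imp_le)
  have hol: "f holomorphic_on cbox a b"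
    using f S sq holomorphic_on_subset by blast
  have "continuous_on (path_image (rectpath a b)) ?g"
    using image by (intro continuous_intros continuous_on_subset[OF holomorphic_on_imp_continuous_on[OF hol]]) auto
  moreover have "path_image (rectpath a b) = closed_segment a p \<union> closed_segment p b \<union> closed_segment b q \<union> closed_segment q a"
    unfolding rect by (simp add: path_image_join Un_assoc)
  ultimately have int: "?g contour_integrable_on linepath a p" "?g contour_integrable_on linepath p b"
    "?g contour_integrable_on linepath b q" "?g contour_integrable_on linepath q a"
    by (auto intro!: contour_integrable_continuous_linepath intro: continuous_on_subset)
  let ?I = "\<lambda>d. contour_integral (linepath (edge_start (c, d)) (edge_end (c, d))) ?g"
  have four: "sum I {x, y, u, v} = I x + I y + I u + I v" if "distinct [x, y, u, v]"
    for I :: "complex \<Rightarrow> complex" and x y u v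
    using that by (simp add: add.assoc)
  have dist: "distinct [of_real h, \<i> * of_real h, - of_real h, - \<i> * of_real h]"
    using h by (auto simp: complex_eq_iff)
  have Pair_inj: "inj_on (Pair c) X" for X :: "complex set"
    by (rule inj_onI) simp
  have "edges {c} h = Pair c ` {of_real h, \<i> * of_real h, - of_real h, - \<i> * of_real h}"
    unfolding edges_eq by auto
  then have "(\<Sum>e\<in>edges {c} h. contour_integral (linepath (edge_start e) (edge_end e)) ?g) =
      (\<Sum>d\<in>{of_real h, \<i> * of_real h, - of_real h, - \<i> * of_real h}. ?I d)"
    by (simp only: sum.reindex[OF Pair_inj] o_def)
  also have "\<dots> = contour_integral (linepath a p) ?g + contour_integral (linepath p b) ?g +
      contour_integral (linepath b q) ?g + contour_integral (linepath q a) ?g"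
    unfolding four[OF dist] pts ..
  also have "\<dots> = contour_integral (rectpath a b) ?g"
    unfolding rect using int by (simp add: contour_integral_join contour_integrable_joinI valid_path_join)
  also have "\<dots> = (if z \<in> grid_square c h then 2 * of_real pi * \<i> * f z else 0)"
  proof (cases "z \<in> grid_square c h")
    case True
    then have zb: "z \<in> box a b" using z by (simp add: a_def b_def)
    have "((\<lambda>w. f w / (w - z)) has_contour_integral (of_real (2 * pi) * \<i> * winding_number (rectpath a b) z * f z)) (rectpath a b)"
      by (rule Cauchy_integral_formula_convex_simple[OF convex_box(1) hol]) (use zb image in \<open>auto simp: interior_cbox\<close>)
    then show ?thesis
      using True winding_number_rectpath[OF zb] by (simp add: contour_integral_unique)
  next
    case False
    then have "?g holomorphic_on cbox a b"
      using hol sq by (intro holomorphic_intros) auto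
    then have "(?g has_contour_integral 0) (rectpath a b)"
      by (intro Cauchy_theorem_convex_simple[OF _ convex_box(1)[of a b]]) (use image in auto)
    then show ?thesis
      using False by (simp add: contour_integral_unique)
  qed
  finally show ?thesis .
qed

text \<open>The cycle is the boundary of the union of all grid squares that meet \<open>D\<close>.
  Cauchy's formula is proved along with the winding numbers because the homology form of Cauchy's
  theorem is derived from it, not the other way round. For a point inside a square the formula is
  added up square by square; a point of \<open>D\<close> on a grid line is a limit of such points
  and is itself off the boundary edges.\<close>

theorem surrounding_loops:
  assumes S: "open S" and D: "compact D" "D \<subseteq> S"
  obtains \<Gamma> where "\<And>\<gamma>. \<gamma> \<in> set \<Gamma> \<Longrightarrow> smooth_loop \<gamma> \<and> path_image \<gamma> \<subseteq> S - D"
    "\<And>f z. f holomorphic_on S \<Longrightarrow> z \<in> D \<Longrightarrow>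
      (\<Sum>\<gamma>\<leftarrow>\<Gamma>. contour_integral \<gamma> (\<lambda>w. f w / (w - z))) = 2 * of_real pi * \<i> * f z"
    "\<And>z. z \<notin> S \<Longrightarrow> (\<Sum>\<gamma>\<leftarrow>\<Gamma>. contour_integral \<gamma> (\<lambda>w. 1 / (w - z))) = 0"
proof -
  obtain r where r: "0 < r" "(\<Union>x\<in>D. ball x r) \<subseteq> S"
    using compact_subset_open_imp_ball_epsilon_subset[OF D(1) S D(2)] by blast
  \<comment> \<open>The diagonal of a square of side \<open>r / 2\<close> is shorter than
    \<open>r\<close>, so a square that meets \<open>D\<close> stays inside \<open>S\<close>.\<close>
  define h where "h = r / 2"
  have h: "0 < h" using r by (simp add: h_def)
  define L where "L = range (\<lambda>(m, n). Complex (h * real_of_int m) (h * real_of_int n))"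
  have LI: "x \<in> L" if "x = Complex (h * real_of_int m) (h * real_of_int n)" for x m n
    unfolding L_def by (rule range_eqI[of _ _ "(m, n)"]) (simp add: that)
  have L_add: "x + y \<in> L" and L_diff: "x - y \<in> L" if xy: "x \<in> L" "y \<in> L" for x y
  proof -
    obtain m n m' n' where "x = Complex (h * real_of_int m) (h * real_of_int n)" "y = Complex (h * real_of_int m') (h * real_of_int n')"
      using xy by (auto simp: L_def)
    then have "x + y = Complex (h * real_of_int (m + m')) (h * real_of_int (n + n'))"
      "x - y = Complex (h * real_of_int (m - m')) (h * real_of_int (n - n'))"
      by (simp_all add: complex_eq_iff algebra_simps)
    then show "x + y \<in> L" "x - y \<in> L" using LI by blast+
  qed
  have L_i: "\<i> * x \<in> L" if x: "x \<in> L" for x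
  proof -
    obtain m n where "x = Complex (h * real_of_int m) (h * real_of_int n)"
      using x by (auto simp: L_def)
    then have "\<i> * x = Complex (h * real_of_int (- n)) (h * real_of_int m)"
      by (simp add: complex_eq_iff)
    then show ?thesis by (rule LI)
  qed
  have "of_real h = Complex (h * real_of_int 1) (h * real_of_int 0)" "0 = Complex (h * real_of_int 0) (h * real_of_int 0)"
    by (simp_all add: complex_eq_iff)
  then have hL: "of_real h \<in> L" "0 \<in> L" using LI by blast+
  have L_minus: "- x \<in> L" if "x \<in> L" for x
    using L_diff[OF hL(2) that] by simp
  have L_dirs: "\<i> * d \<in> L" if "d \<in> {of_real h, \<i> * of_real h, - of_real h, - \<i> * of_real h}" for d
  proof (rule L_i)
    show "d \<in> L"
      using that hL(1) L_minus[OF hL(1)] L_i[OF hL(1)] L_minus[OF L_i[OF hL(1)]] by auto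
  qed
  define Q where "Q = {c \<in> L. grid_square c h \<inter> D \<noteq> {}}"
  have "finite Q"
  proof -
    obtain R where R: "\<And>x. x \<in> D \<Longrightarrow> norm x \<le> R"
      using compact_imp_bounded[OF D(1)] unfolding bounded_iff by blast
    define N where "N = \<lceil>(R + h) / h\<rceil>"
    have "Q \<subseteq> (\<lambda>(m, n). Complex (h * real_of_int m) (h * real_of_int n)) ` ({- N..N} \<times> {- N..N})"
    proof
      fix c assume c: "c \<in> Q"
      then obtain m n z where mn: "c = Complex (h * real_of_int m) (h * real_of_int n)" and z: "z \<in> grid_square c h" "z \<in> D"
        by (auto simp: Q_def L_def)
      have zc: "\<bar>Re z - h * real_of_int m\<bar> \<le> h / 2" "\<bar>Im z - h * real_of_int n\<bar> \<le> h / 2"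
        using z(1) by (simp_all only: mem_grid_square mn complex.sel)
      have "\<bar>h * real_of_int m\<bar> \<le> R + h"
        using zc(1) R[OF z(2)] abs_Re_le_cmod[of z] h by linarith
      moreover have "\<bar>h * real_of_int n\<bar> \<le> R + h"
        using zc(2) R[OF z(2)] abs_Im_le_cmod[of z] h by linarith
      ultimately      have "\<bar>real_of_int m\<bar> \<le> (R + h) / h" "\<bar>real_of_int n\<bar> \<le> (R + h) / h"
        using h by (simp_all add: abs_mult pos_le_divide_eq mult.commute)
      then have "\<bar>m\<bar> \<le> N" "\<bar>n\<bar> \<le> N"
        unfolding N_def by linarith+
      then have "(m, n) \<in> {- N..N} \<times> {- N..N}" by auto
      then show "c \<in> (\<lambda>(m, n). Complex (h * real_of_int m) (h * real_of_int n)) ` ({- N..N} \<times> {- N..N})"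
        using mn by (intro image_eqI[of _ _ "(m, n)"]) auto
    qed
    then show ?thesis by (rule finite_subset) auto
  qed
  have Q_S: "grid_square c h \<subseteq> S" if c: "c \<in> Q" for c
  proof
    fix w assume w: "w \<in> grid_square c h"
    obtain z where z: "z \<in> grid_square c h" "z \<in> D" using c by (auto simp: Q_def)
    have zw: "\<bar>Re z - Re c\<bar> \<le> h / 2" "\<bar>Im z - Im c\<bar> \<le> h / 2" "\<bar>Re w - Re c\<bar> \<le> h / 2" "\<bar>Im w - Im c\<bar> \<le> h / 2"
      using w z(1) by (simp_all only: mem_grid_square)
    have "\<bar>Re (z - w)\<bar> \<le> h" using zw(1,3) unfolding minus_complex.sel by linarith
    have "\<bar>Im (z - w)\<bar> \<le> h" using zw(2,4) unfolding minus_complex.sel by linarith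
    have "cmod (z - w) < h + h"
    proof -
      have "(cmod (z - w))\<^sup>2 \<le> h\<^sup>2 + h\<^sup>2"
        unfolding cmod_power2 using \<open>\<bar>Re (z - w)\<bar> \<le> h\<close> \<open>\<bar>Im (z - w)\<bar> \<le> h\<close>
        by (intro add_mono) (metis abs_ge_zero power2_abs power_mono)+
      also have "\<dots> < (h + h)\<^sup>2" using h by (simp add: power2_eq_square algebra_simps)
      finally show ?thesis by (rule power2_less_imp_less) (use h in simp)
    qed
    then have "w \<in> ball z r" by (simp add: h_def dist_norm)
    then show "w \<in> S" using r(2) z(2) by blast
  qed
  have cover: "\<exists>c\<in>L. z \<in> grid_square c h" for z
  proof -
    have "\<bar>x - h * real_of_int (round (x / h))\<bar> \<le> h / 2" for x
    proof -
      have "\<bar>real_of_int (round (x / h)) - x / h\<bar> \<le> 1 / 2" by (rule of_int_round_abs_le)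
      then have "h * \<bar>real_of_int (round (x / h)) - x / h\<bar> \<le> h * (1 / 2)"
        using h by (intro mult_left_mono) auto
      moreover have "h * \<bar>real_of_int (round (x / h)) - x / h\<bar> = \<bar>h * (real_of_int (round (x / h)) - x / h)\<bar>"
        using h by (simp add: abs_mult)
      moreover have "h * (real_of_int (round (x / h)) - x / h) = h * real_of_int (round (x / h)) - x"
        using h by (simp add: algebra_simps)
      ultimately show ?thesis by (simp add: abs_minus_commute)
    qed
    then have "z \<in> grid_square (Complex (h * real_of_int (round (Re z / h))) (h * real_of_int (round (Im z / h)))) h"
      by (simp add: mem_grid_square)
    then show ?thesis using LI[OF refl] by blast
  qed
  have separate: "c = c'" if c: "c \<in> L" "c' \<in> L" "z \<in> box (c - (1 + \<i>) / 2 * of_real h) (c + (1 + \<i>) / 2 * of_real h)"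
    "z \<in> grid_square c' h" for c c' z
  proof -
    obtain m n m' n' where mn: "c = Complex (h * real_of_int m) (h * real_of_int n)" "c' = Complex (h * real_of_int m') (h * real_of_int n')"
      using c(1,2) by (auto simp: L_def)
    have "Re c - h / 2 < Re z" "Re z < Re c + h / 2" "Im c - h / 2 < Im z" "Im z < Im c + h / 2"
      using c(3) by (simp_all add: in_box_complex_iff)
    moreover have "\<bar>Re z - Re c'\<bar> \<le> h / 2" "\<bar>Im z - Im c'\<bar> \<le> h / 2"
      using c(4) by (simp_all only: mem_grid_square)
    ultimately have "\<bar>Re c - Re c'\<bar> < h" "\<bar>Im c - Im c'\<bar> < h"
      by linarith+
    then have "\<bar>h * real_of_int (m - m')\<bar> < h * 1" "\<bar>h * real_of_int (n - n')\<bar> < h * 1"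
      by (simp_all add: mn algebra_simps)
    then have "\<bar>real_of_int (m - m')\<bar> < 1" "\<bar>real_of_int (n - n')\<bar> < 1"
      using h by (simp_all only: abs_mult abs_of_pos mult_less_cancel_left_pos)
    then have "m = m'" "n = n'" by linarith+
    then show ?thesis by (simp add: mn)
  qed
  define E where "E = boundary_edges Q h"
  have "finite E" unfolding E_def by (rule finite_boundary_edges[OF \<open>finite Q\<close>])
  have E_SD: "closed_segment (edge_start e) (edge_end e) \<subseteq> S - D" if e: "e \<in> E" for e
  proof -
    obtain c d where cd: "e = (c, d)" by (cases e)
    have c: "c \<in> Q" "c - \<i> * d \<notin> Q" "(c, d) \<in> edges {c} h" and d: "d \<in> {of_real h, \<i> * of_real h, - of_real h, - \<i> * of_real h}"
      using e by (auto simp: E_def cd boundary_edges_def edges_def)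
    have "c - \<i> * d \<in> L" using c(1) L_diff[OF _ L_dirs[OF d]] by (auto simp: Q_def)
    then have "grid_square (c - \<i> * d) h \<inter> D = {}" using c(2) by (auto simp: Q_def)
    then show ?thesis
      using edge_in_right_square[OF c(3) h] edge_in_grid_square[OF c(3) h] Q_S[OF c(1)] by (auto simp: cd)
  qed
  have total: "(\<Sum>e\<in>E. contour_integral (linepath (edge_start e) (edge_end e)) g) =
    (\<Sum>c\<in>Q. \<Sum>e\<in>edges {c} h. contour_integral (linepath (edge_start e) (edge_end e)) g)" for g
  proof -
    have "edges Q h = (\<Union>c\<in>Q. edges {c} h)" by (auto simp: edges_def)
    then have "(\<Sum>e\<in>edges Q h. contour_integral (linepath (edge_start e) (edge_end e)) g) =
      (\<Sum>c\<in>Q. \<Sum>e\<in>edges {c} h. contour_integral (linepath (edge_start e) (edge_end e)) g)"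
      using \<open>finite Q\<close> by (simp only:) (intro sum.UNION_disjoint, auto simp: finite_edges edges_def)
    then show ?thesis
      unfolding E_def sum_edges_eq_boundary[OF \<open>finite Q\<close>] by simp
  qed
  have outside: "(\<Sum>e\<in>E. contour_integral (linepath (edge_start e) (edge_end e)) (\<lambda>w. 1 / (w - z))) = 0" if z: "z \<notin> S" for z
  proof -
    have zc: "z \<notin> grid_square c h" if "c \<in> Q" for c using Q_S[OF that] z by blast
    have "(\<Sum>e\<in>edges {c} h. contour_integral (linepath (edge_start e) (edge_end e)) (\<lambda>w. 1 / (w - z))) = 0" if c: "c \<in> Q" for c
      using contour_integral_grid_square[OF h holomorphic_on_const[of 1 S] Q_S[OF c] disjI2[OF zc[OF c]]] zc[OF c] by simp
    then show ?thesis unfolding total by (rule sum.neutral[OF ballI])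
  qed
  have inside: "(\<Sum>e\<in>E. contour_integral (linepath (edge_start e) (edge_end e)) (\<lambda>w. f w / (w - z))) = 2 * of_real pi * \<i> * f z"
    if f: "f holomorphic_on S" and c: "c \<in> Q" and z: "z \<in> box (c - (1 + \<i>) / 2 * of_real h) (c + (1 + \<i>) / 2 * of_real h)" for f z c
  proof -
    have zc: "z \<in> grid_square c h"
      using z box_subset_cbox unfolding grid_square_def by blast
    have zc': "z \<notin> grid_square c' h" if "c' \<in> Q" "c' \<noteq> c" for c'
      using separate[of c c' z] that c z by (auto simp: Q_def)
    have "(\<Sum>e\<in>E. contour_integral (linepath (edge_start e) (edge_end e)) (\<lambda>w. f w / (w - z))) =
      (\<Sum>c'\<in>Q. if c' = c then 2 * of_real pi * \<i> * f z else 0)"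
      unfolding total
    proof (rule sum.cong[OF refl])
      fix c' assume c': "c' \<in> Q"
      show "(\<Sum>e\<in>edges {c'} h. contour_integral (linepath (edge_start e) (edge_end e)) (\<lambda>w. f w / (w - z))) =
        (if c' = c then 2 * of_real pi * \<i> * f z else 0)"
        using contour_integral_grid_square[OF h f Q_S[OF c'], of z] zc zc'[OF c'] z by (cases "c' = c") auto
    qed
    then show ?thesis using c \<open>finite Q\<close> by simp
  qed
  have on_D: "(\<Sum>e\<in>E. contour_integral (linepath (edge_start e) (edge_end e)) (\<lambda>w. f w / (w - z))) = 2 * of_real pi * \<i> * f z"
    if f: "f holomorphic_on S" and z: "z \<in> D" for f z
  proof -
    obtain c where c: "c \<in> L" "z \<in> grid_square c h" using cover by blast
    then have cQ: "c \<in> Q" using z by (auto simp: Q_def)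
    \<comment> \<open>Points on the segment from \<open>z\<close> to the centre, interior to the
      square and tending to \<open>z\<close>.\<close>
    define y where "y n = z + of_real (1 / real (n + 2)) * (c - z)" for n
    have y_box: "y n \<in> box (c - (1 + \<i>) / 2 * of_real h) (c + (1 + \<i>) / 2 * of_real h)" for n
    proof -
      have c_box: "c \<in> interior (grid_square c h)"
        using h by (simp add: grid_square_def interior_cbox in_box_complex_iff)
      have "z - of_real (1 / real (n + 2)) *\<^sub>R (z - c) \<in> interior (grid_square c h)" if True
        using mem_interior_convex_shrink[OF _ c_box c(2), of "1 / real (n + 2)"] by (simp add: grid_square_def)
      moreover have "y n = z - (1 / real (n + 2)) *\<^sub>R (z - c)"
        by (simp add: y_def scaleR_conv_of_real diff_divide_distrib)
      ultimately show ?thesis by (simp add: grid_square_def interior_cbox)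
    qed
    have y_lim: "y \<longlonglongrightarrow> z"
    proof -
      have "(\<lambda>n. 1 / real (n + 2)) \<longlonglongrightarrow> 0"
        using LIMSEQ_ignore_initial_segment[OF lim_1_over_n, of 2] by simp
      then have "(\<lambda>n. z + of_real (1 / real (n + 2)) * (c - z)) \<longlonglongrightarrow> z + of_real 0 * (c - z)"
        by (intro tendsto_intros)
      then show ?thesis by (simp add: y_def[abs_def])
    qed
    have lim: "(\<lambda>n. \<Sum>e\<in>E. contour_integral (linepath (edge_start e) (edge_end e)) (\<lambda>w. f w / (w - y n)))
      \<longlonglongrightarrow> (\<Sum>e\<in>E. contour_integral (linepath (edge_start e) (edge_end e)) (\<lambda>w. f w / (w - z)))"
    proof (rule tendsto_sum)
      fix e assume e: "e \<in> E"
      let ?\<gamma> = "linepath (edge_start e) (edge_end e)"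
      have cont: "continuous_on (path_image ?\<gamma>) f"
        using E_SD[OF e] f by (auto intro: continuous_on_subset holomorphic_on_imp_continuous_on)
      have z\<gamma>: "z \<in> UNIV - path_image ?\<gamma>" using E_SD[OF e] z by auto
      have "((\<lambda>z. contour_integral ?\<gamma> (\<lambda>w. f w / (w - z))) has_field_derivative
          of_nat 1 * contour_integral ?\<gamma> (\<lambda>u. f u / (u - z) ^ Suc 1)) (at z)"
      proof (rule Cauchy_next_derivative(2)[OF cont])
        show "norm (vector_derivative ?\<gamma> (at t)) \<le> norm (edge_end e - edge_start e)" if "t \<in> {0..1}" for t by simp
        show "((\<lambda>u. f u / (u - w) ^ 1) has_contour_integral contour_integral ?\<gamma> (\<lambda>u. f u / (u - w))) ?\<gamma>" if "w \<in> UNIV - path_image ?\<gamma>" for w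
          using that cont by (auto intro!: has_contour_integral_integral contour_integrable_continuous_linepath continuous_intros)
      qed (use z\<gamma> in auto)
      then have "isCont (\<lambda>z. contour_integral ?\<gamma> (\<lambda>w. f w / (w - z))) z"
        by (rule DERIV_isCont)
      then show "(\<lambda>n. contour_integral ?\<gamma> (\<lambda>w. f w / (w - y n))) \<longlonglongrightarrow> contour_integral ?\<gamma> (\<lambda>w. f w / (w - z))"
        using isCont_tendsto_compose y_lim by blast
    qed
    have y_n: "(\<Sum>e\<in>E. contour_integral (linepath (edge_start e) (edge_end e)) (\<lambda>w. f w / (w - y n))) = 2 * of_real pi * \<i> * f (y n)" for n
      by (rule inside[OF f cQ y_box])
    have "(\<lambda>n. 2 * of_real pi * \<i> * f (y n)) \<longlonglongrightarrow> 2 * of_real pi * \<i> * f z"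
    proof -
      have "isCont f z"
        using f z D(2) S by (metis continuous_on_eq_continuous_at holomorphic_on_imp_continuous_on subsetD)
      then have "(\<lambda>n. f (y n)) \<longlonglongrightarrow> f z"
        by (rule isCont_tendsto_compose) (rule y_lim)
      then show ?thesis by (intro tendsto_intros)
    qed
    then show ?thesis by (rule LIMSEQ_unique[OF lim[unfolded y_n]])
  qed
  obtain \<Gamma>0 where \<Gamma>0: "\<forall>\<gamma>\<in>set \<Gamma>0. valid_path \<gamma> \<and> pathfinish \<gamma> = pathstart \<gamma> \<and> path_image \<gamma> \<subseteq> S - D"
    "\<forall>g. continuous_on (S - D) g \<longrightarrow> (\<Sum>\<gamma>\<leftarrow>\<Gamma>0. contour_integral \<gamma> g) =
      (\<Sum>e\<in>E. contour_integral (linepath (edge_start e) (edge_end e)) g)"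
    using segments_to_loops[OF \<open>finite E\<close>, of "next_edge Q" edge_end edge_start "S - D"]
      bij_next_edge[OF \<open>finite Q\<close>, of h] next_edge_boundary(3)[of _ Q h] E_SD unfolding E_def by blast
  have op: "open (S - D)" using S compact_imp_closed[OF D(1)] by (rule open_Diff)
  \<comment> \<open>The polygons have corners; smoothing them inside \<open>S - D\<close> leaves the
    integrals of functions holomorphic there unchanged.\<close>
  have "\<exists>p. smooth_loop p \<and> path_image p \<subseteq> S - D \<and> (\<forall>f. f holomorphic_on S - D \<longrightarrow> contour_integral p f = contour_integral \<gamma> f)"
    if "\<gamma> \<in> set \<Gamma>0" for \<gamma>
    using smooth_loop_approx[OF op, of \<gamma>] \<Gamma>0(1) that by metis
  then obtain p where p: "\<And>\<gamma>. \<gamma> \<in> set \<Gamma>0 \<Longrightarrow> smooth_loop (p \<gamma>) \<and> path_image (p \<gamma>) \<subseteq> S - D"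
    "\<And>\<gamma> f. \<gamma> \<in> set \<Gamma>0 \<Longrightarrow> f holomorphic_on S - D \<Longrightarrow> contour_integral (p \<gamma>) f = contour_integral \<gamma> f"
    by metis
  have p_sum: "(\<Sum>\<gamma>\<leftarrow>map p \<Gamma>0. contour_integral \<gamma> g) = (\<Sum>e\<in>E. contour_integral (linepath (edge_start e) (edge_end e)) g)"
    if g: "g holomorphic_on S - D" for g
  proof -
    have "(\<Sum>\<gamma>\<leftarrow>map p \<Gamma>0. contour_integral \<gamma> g) = (\<Sum>\<gamma>\<leftarrow>\<Gamma>0. contour_integral \<gamma> g)"
      using p(2)[OF _ g] by (auto simp: o_def intro!: arg_cong[where f = sum_list] map_cong)
    then show ?thesis using \<Gamma>0(2) holomorphic_on_imp_continuous_on[OF g] by simp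
  qed
  show thesis
  proof (rule that[of "map p \<Gamma>0"])
    show "smooth_loop \<gamma> \<and> path_image \<gamma> \<subseteq> S - D" if "\<gamma> \<in> set (map p \<Gamma>0)" for \<gamma>
      using that p(1) by auto
    show "(\<Sum>\<gamma>\<leftarrow>map p \<Gamma>0. contour_integral \<gamma> (\<lambda>w. f w / (w - z))) = 2 * of_real pi * \<i> * f z"
      if f: "f holomorphic_on S" and z: "z \<in> D" for f z
    proof -
      have "(\<lambda>w. f w / (w - z)) holomorphic_on S - D"
        using z by (intro holomorphic_intros holomorphic_on_subset[OF f]) auto
      then show ?thesis by (simp only: p_sum on_D[OF f z])
    qed
    show "(\<Sum>\<gamma>\<leftarrow>map p \<Gamma>0. contour_integral \<gamma> (\<lambda>w. 1 / (w - z))) = 0" if z: "z \<notin> S" for z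
    proof -
      have "(\<lambda>w. 1 / (w - z)) holomorphic_on S - D"
        using z by (intro holomorphic_intros) auto
      then show ?thesis by (simp only: p_sum outside[OF z])
    qed
  qed
qed


section \<open>Cauchy's theorem for cycles\<close>

lemma smooth_loop_contour_integrable:
  assumes \<gamma>: "smooth_loop \<gamma>" and g: "continuous_on (path_image \<gamma>) g"
  shows "g contour_integrable_on \<gamma>"
  unfolding contour_integrable_on
proof (rule integrable_continuous_real)
  have "continuous_on {0..1} \<gamma>"
    using \<gamma> valid_path_imp_path by (auto simp: smooth_loop_def path_def)
  then have "continuous_on {0..1} (\<lambda>t. g (\<gamma> t))"
    using continuous_on_compose2[OF g] by (auto simp: path_image_def)
  then show "continuous_on {0..1} (\<lambda>t. g (\<gamma> t) * vector_derivative \<gamma> (at t))"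
    using \<gamma> by (intro continuous_on_mult) (auto simp: smooth_loop_def)
qed

lemma Cauchy_type_integral_holomorphic:
  assumes \<gamma>: "smooth_loop \<gamma>" and f: "continuous_on (path_image \<gamma>) f"
  shows "(\<lambda>z. contour_integral \<gamma> (\<lambda>w. f w / (w - z))) holomorphic_on - path_image \<gamma>"
proof -
  have "compact ((\<lambda>t. vector_derivative \<gamma> (at t)) ` {0..1})"
    using \<gamma> by (intro compact_continuous_image) (auto simp: smooth_loop_def)
  then have "bounded ((\<lambda>t. vector_derivative \<gamma> (at t)) ` {0..1})"
    by (rule compact_imp_bounded)
  then obtain c where "\<forall>x\<in>(\<lambda>t. vector_derivative \<gamma> (at t)) ` {0..1}. norm x \<le> c"
    unfolding bounded_iff by blast
  then have B: "norm (vector_derivative \<gamma> (at t)) \<le> c" if "t \<in> {0..1}" for t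
    using that by auto
  have vp: "valid_path \<gamma>" using \<gamma> by (simp add: smooth_loop_def)
  have deriv: "((\<lambda>z. contour_integral \<gamma> (\<lambda>w. f w / (w - z))) has_field_derivative
      of_nat 1 * contour_integral \<gamma> (\<lambda>u. f u / (u - z) ^ Suc 1)) (at z)" if z: "z \<notin> path_image \<gamma>" for z
  proof (rule Cauchy_next_derivative(2)[OF f B])
    fix w assume w: "w \<in> UNIV - path_image \<gamma>"
    then have "(\<lambda>u. f u / (u - w)) contour_integrable_on \<gamma>"
      using f by (intro smooth_loop_contour_integrable[OF \<gamma>] continuous_intros) auto
    then show "((\<lambda>u. f u / (u - w) ^ 1) has_contour_integral contour_integral \<gamma> (\<lambda>u. f u / (u - w))) \<gamma>"
      by (simp add: has_contour_integral_integral)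
  qed (use z vp in auto)
  show ?thesis
  proof (rule holomorphic_onI)
    fix z assume "z \<in> - path_image \<gamma>"
    then have "z \<notin> path_image \<gamma>" by simp
    then show "(\<lambda>z. contour_integral \<gamma> (\<lambda>w. f w / (w - z))) field_differentiable at z within - path_image \<gamma>"
      unfolding field_differentiable_def using has_field_derivative_at_within[OF deriv] by blast
  qed
qed

lemma smooth_loop_swap:
  assumes \<gamma>: "smooth_loop \<gamma>" and \<delta>: "smooth_loop \<delta>"
    and "continuous_on (path_image \<gamma> \<times> path_image \<delta>) (\<lambda>(z, w). f z w)"
  shows "contour_integral \<gamma> (\<lambda>z. contour_integral \<delta> (f z)) = contour_integral \<delta> (\<lambda>w. contour_integral \<gamma> (\<lambda>z. f z w))"
  using assms by (intro contour_integral_swap) (auto simp: smooth_loop_def)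

lemma sum_list_interchange:
  fixes f :: "'a \<Rightarrow> 'b \<Rightarrow> 'c :: comm_monoid_add"
  shows "(\<Sum>x\<leftarrow>xs. \<Sum>y\<leftarrow>ys. f x y) = (\<Sum>y\<leftarrow>ys. \<Sum>x\<leftarrow>xs. f x y)"
  by (induction xs) (simp_all add: sum_list_addf)

lemma winding_number_smooth_loop:
  assumes "smooth_loop \<gamma>" "z \<notin> path_image \<gamma>"
  shows "contour_integral \<gamma> (\<lambda>w. 1 / (w - z)) = 2 * of_real pi * \<i> * winding_number \<gamma> z"
  using assms by (simp add: winding_number_valid_path smooth_loop_def)

text \<open>Writing \<open>g\<close> as a Cauchy integral over loops around the points that \<open>\<Gamma>\<close> meets or encloses and
  exchanging the integrations leaves the winding numbers of \<open>\<Gamma>\<close> about the points of those loops, which vanish.\<close>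

lemma Cauchy_smooth_cycle:
  assumes S: "open S" and g: "g holomorphic_on S"
    and \<Gamma>: "\<And>\<gamma>. \<gamma> \<in> set \<Gamma> \<Longrightarrow> smooth_loop \<gamma> \<and> path_image \<gamma> \<subseteq> S"
    and zero: "\<And>z. z \<notin> S \<Longrightarrow> (\<Sum>\<gamma>\<leftarrow>\<Gamma>. winding_number \<gamma> z) = 0"
  shows "(\<Sum>\<gamma>\<leftarrow>\<Gamma>. contour_integral \<gamma> g) = 0"
proof -
  define n where "n z = (\<Sum>\<gamma>\<leftarrow>\<Gamma>. winding_number \<gamma> z)" for z
  define I where "I = (\<Union>\<gamma>\<in>set \<Gamma>. path_image \<gamma>)"
  define D where "D = I \<union> {z. n z \<noteq> 0}"
  have vp: "valid_path \<gamma>" "path \<gamma>" "pathfinish \<gamma> = pathstart \<gamma>" if "\<gamma> \<in> set \<Gamma>" for \<gamma>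
    using \<Gamma>[OF that] by (auto simp: smooth_loop_def valid_path_imp_path)
  have "compact I"
    unfolding I_def using vp(2) by (intro compact_UN) (auto intro: compact_path_image)
  have n_cong: "n z = n w" if "\<And>\<gamma>. \<gamma> \<in> set \<Gamma> \<Longrightarrow> winding_number \<gamma> z = winding_number \<gamma> w" for z w
    unfolding n_def using that by (intro arg_cong[where f = sum_list] map_cong) auto
  \<comment> \<open>Winding numbers are locally constant off \<open>I\<close>, which makes
    \<open>D\<close> closed; far away they vanish, which makes it bounded.\<close>
  have "open (- D)"
    unfolding open_contains_ball
  proof
    fix z assume z: "z \<in> - D"
    have "open (- I)" using \<open>compact I\<close> compact_imp_closed by blast
    then obtain e where e: "0 < e" "ball z e \<subseteq> - I"
      using z by (auto simp: D_def open_contains_ball)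
    have "w \<in> - D" if w: "w \<in> ball z e" for w
    proof -
      have "n w = n z"
      proof (rule n_cong)
        fix \<gamma> assume \<gamma>: "\<gamma> \<in> set \<Gamma>"
        have "ball z e \<inter> path_image \<gamma> = {}" using e(2) \<gamma> by (auto simp: I_def)
        then show "winding_number \<gamma> w = winding_number \<gamma> z"
          using winding_number_eq[OF vp(2,3)[OF \<gamma>] w _ connected_ball] e(1) by simp
      qed
      then show ?thesis using z w e(2) by (auto simp: D_def)
    qed
    then show "\<exists>e>0. ball z e \<subseteq> - D" using e(1) by blast
  qed
  then have "closed D" by (simp add: closed_def)
  obtain R where R: "I \<subseteq> ball 0 R"
    using compact_imp_bounded[OF \<open>compact I\<close>] bounded_subset_ballD by blast
  have "D \<subseteq> ball 0 R"
  proof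
    fix z assume z: "z \<in> D"
    show "z \<in> ball 0 R"
    proof (rule ccontr)
      assume out: "z \<notin> ball 0 R"
      have "winding_number \<gamma> z = 0" if \<gamma>: "\<gamma> \<in> set \<Gamma>" for \<gamma>
        by (rule winding_number_zero_outside[OF vp(2)[OF \<gamma>] convex_ball vp(3)[OF \<gamma>] out])
          (use R \<gamma> in \<open>auto simp: I_def\<close>)
      then have "n z = (\<Sum>\<gamma>\<leftarrow>\<Gamma>. 0)"
        unfolding n_def by (intro arg_cong[where f = sum_list] map_cong refl)
      then have "n z = 0" by simp
      then show False using z R out by (auto simp: D_def)
    qed
  qed
  then have "compact D"
    using \<open>closed D\<close> bounded_subset[OF bounded_ball] by (simp add: compact_eq_bounded_closed)
  have "D \<subseteq> S" using \<Gamma> zero by (auto simp: D_def I_def n_def)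
  obtain \<Delta> where \<Delta>: "\<And>\<delta>. \<delta> \<in> set \<Delta> \<Longrightarrow> smooth_loop \<delta> \<and> path_image \<delta> \<subseteq> S - D"
    "\<And>f z. f holomorphic_on S \<Longrightarrow> z \<in> D \<Longrightarrow>
      (\<Sum>\<delta>\<leftarrow>\<Delta>. contour_integral \<delta> (\<lambda>w. f w / (w - z))) = 2 * of_real pi * \<i> * f z"
    using surrounding_loops[OF S \<open>compact D\<close> \<open>D \<subseteq> S\<close>] by metis
  have disj: "path_image \<gamma> \<inter> path_image \<delta> = {}" if "\<gamma> \<in> set \<Gamma>" "\<delta> \<in> set \<Delta>" for \<gamma> \<delta>
    using \<Delta>(1)[OF that(2)] that(1) by (auto simp: D_def I_def)
  have g_\<delta>: "continuous_on (path_image \<delta>) g" if "\<delta> \<in> set \<Delta>" for \<delta>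
    using \<Delta>(1)[OF that] holomorphic_on_imp_continuous_on[OF g] continuous_on_subset by blast
  \<comment> \<open>The kernel \<open>1 / (w - z)\<close> changes sign when its variables trade
    places, hence the minus sign before the winding number.\<close>
  have swap: "contour_integral \<gamma> (\<lambda>z. contour_integral \<delta> (\<lambda>w. g w / (w - z))) =
      contour_integral \<delta> (\<lambda>w. - (2 * of_real pi * \<i> * g w * winding_number \<gamma> w))"
    if \<gamma>: "\<gamma> \<in> set \<Gamma>" and \<delta>: "\<delta> \<in> set \<Delta>" for \<gamma> \<delta>
  proof -
    have "contour_integral \<gamma> (\<lambda>z. contour_integral \<delta> (\<lambda>w. g w / (w - z))) =
        contour_integral \<delta> (\<lambda>w. contour_integral \<gamma> (\<lambda>z. g w / (w - z)))"
      using \<Gamma>[OF \<gamma>] \<Delta>(1)[OF \<delta>] disj[OF \<gamma> \<delta>]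
      by (intro smooth_loop_swap)
        (auto simp: case_prod_unfold intro!: continuous_intros continuous_on_compose2[OF g_\<delta>[OF \<delta>]])
    also have "\<dots> = contour_integral \<delta> (\<lambda>w. - (2 * of_real pi * \<i> * g w * winding_number \<gamma> w))"
    proof (rule contour_integral_cong[OF refl])
      fix w assume w: "w \<in> path_image \<delta>"
      then have w\<gamma>: "w \<notin> path_image \<gamma>" using disj[OF \<gamma> \<delta>] by blast
      have "(\<lambda>z. g w / (w - z)) = (\<lambda>z. (- g w) * (1 / (z - w)))"
        by (auto simp: fun_eq_iff divide_simps) (simp add: algebra_simps)
      moreover have "(\<lambda>z. 1 / (z - w)) contour_integrable_on \<gamma>"
        using \<Gamma>[OF \<gamma>] w\<gamma> by (intro smooth_loop_contour_integrable continuous_intros) auto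
      ultimately show "contour_integral \<gamma> (\<lambda>z. g w / (w - z)) = - (2 * of_real pi * \<i> * g w * winding_number \<gamma> w)"
        using winding_number_smooth_loop[of \<gamma> w] \<Gamma>[OF \<gamma>] w\<gamma> by (simp only: contour_integral_lmul) simp
    qed
    finally show ?thesis .
  qed
  have int1: "(\<lambda>z. contour_integral \<delta> (\<lambda>w. g w / (w - z))) contour_integrable_on \<gamma>"
    if \<gamma>: "\<gamma> \<in> set \<Gamma>" and \<delta>: "\<delta> \<in> set \<Delta>" for \<gamma> \<delta>
  proof (rule smooth_loop_contour_integrable)
    show "continuous_on (path_image \<gamma>) (\<lambda>z. contour_integral \<delta> (\<lambda>w. g w / (w - z)))"
      using Cauchy_type_integral_holomorphic[OF _ g_\<delta>[OF \<delta>]] \<Delta>(1)[OF \<delta>] disj[OF \<gamma> \<delta>]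
      by (blast intro: holomorphic_on_imp_continuous_on continuous_on_subset)
  qed (use \<Gamma>[OF \<gamma>] in blast)
  have int2: "(\<lambda>w. - (2 * of_real pi * \<i> * g w * winding_number \<gamma> w)) contour_integrable_on \<delta>"
    if \<gamma>: "\<gamma> \<in> set \<Gamma>" and \<delta>: "\<delta> \<in> set \<Delta>" for \<gamma> \<delta>
  proof (rule smooth_loop_contour_integrable)
    have "continuous_on (path_image \<delta>) (winding_number \<gamma>)"
      using continuous_on_winding_number[OF vp(2)[OF \<gamma>]] disj[OF \<gamma> \<delta>] by (blast intro: continuous_on_subset)
    then show "continuous_on (path_image \<delta>) (\<lambda>w. - (2 * of_real pi * \<i> * g w * winding_number \<gamma> w))"
      using g_\<delta>[OF \<delta>] by (intro continuous_intros)
  qed (use \<Delta>(1)[OF \<delta>] in blast)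
  have "2 * of_real pi * \<i> * (\<Sum>\<gamma>\<leftarrow>\<Gamma>. contour_integral \<gamma> g) =
      (\<Sum>\<gamma>\<leftarrow>\<Gamma>. contour_integral \<gamma> (\<lambda>z. \<Sum>\<delta>\<leftarrow>\<Delta>. contour_integral \<delta> (\<lambda>w. g w / (w - z))))"
    unfolding sum_list_const_mult[symmetric]
  proof (intro arg_cong[where f = sum_list] map_cong refl)
    fix \<gamma> assume \<gamma>: "\<gamma> \<in> set \<Gamma>"
    have "g contour_integrable_on \<gamma>"
      using \<Gamma>[OF \<gamma>] holomorphic_on_imp_continuous_on[OF g]
      by (intro smooth_loop_contour_integrable) (auto intro: continuous_on_subset)
    then have "2 * of_real pi * \<i> * contour_integral \<gamma> g = contour_integral \<gamma> (\<lambda>z. 2 * of_real pi * \<i> * g z)"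
      by (simp add: contour_integral_lmul)
    also have "\<dots> = contour_integral \<gamma> (\<lambda>z. \<Sum>\<delta>\<leftarrow>\<Delta>. contour_integral \<delta> (\<lambda>w. g w / (w - z)))"
    proof (rule contour_integral_cong[OF refl])
      fix z assume "z \<in> path_image \<gamma>"
      then have "z \<in> D" using \<gamma> by (auto simp: D_def I_def)
      then show "2 * of_real pi * \<i> * g z = (\<Sum>\<delta>\<leftarrow>\<Delta>. contour_integral \<delta> (\<lambda>w. g w / (w - z)))"
        using \<Delta>(2)[OF g] by simp
    qed
    finally show "2 * of_real pi * \<i> * contour_integral \<gamma> g =
        contour_integral \<gamma> (\<lambda>z. \<Sum>\<delta>\<leftarrow>\<Delta>. contour_integral \<delta> (\<lambda>w. g w / (w - z)))" .
  qed
  also have "\<dots> = (\<Sum>\<gamma>\<leftarrow>\<Gamma>. \<Sum>\<delta>\<leftarrow>\<Delta>. contour_integral \<delta> (\<lambda>w. - (2 * of_real pi * \<i> * g w * winding_number \<gamma> w)))"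
  proof (intro arg_cong[where f = sum_list] map_cong refl)
    fix \<gamma> assume \<gamma>: "\<gamma> \<in> set \<Gamma>"
    show "contour_integral \<gamma> (\<lambda>z. \<Sum>\<delta>\<leftarrow>\<Delta>. contour_integral \<delta> (\<lambda>w. g w / (w - z))) =
        (\<Sum>\<delta>\<leftarrow>\<Delta>. contour_integral \<delta> (\<lambda>w. - (2 * of_real pi * \<i> * g w * winding_number \<gamma> w)))"
      by (subst contour_integral_sum_list(1)[of \<Delta> "\<lambda>\<delta> z. contour_integral \<delta> (\<lambda>w. g w / (w - z))", OF int1[OF \<gamma>]],
          assumption, intro arg_cong[where f = sum_list] map_cong refl, rule swap[OF \<gamma>])
  qed
  also have "\<dots> = (\<Sum>\<delta>\<leftarrow>\<Delta>. \<Sum>\<gamma>\<leftarrow>\<Gamma>. contour_integral \<delta> (\<lambda>w. - (2 * of_real pi * \<i> * g w * winding_number \<gamma> w)))"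
    by (rule sum_list_interchange)
  also have "\<dots> = (\<Sum>\<delta>\<leftarrow>\<Delta>. 0)"
  proof (intro arg_cong[where f = sum_list] map_cong refl)
    fix \<delta> assume \<delta>: "\<delta> \<in> set \<Delta>"
    have "(\<Sum>\<gamma>\<leftarrow>\<Gamma>. contour_integral \<delta> (\<lambda>w. - (2 * of_real pi * \<i> * g w * winding_number \<gamma> w))) =
        contour_integral \<delta> (\<lambda>w. \<Sum>\<gamma>\<leftarrow>\<Gamma>. - (2 * of_real pi * \<i> * g w) * winding_number \<gamma> w)"
      using contour_integral_sum_list(1)[of \<Gamma> "\<lambda>\<gamma> w. - (2 * of_real pi * \<i> * g w * winding_number \<gamma> w)" \<delta>] int2[OF _ \<delta>]
      by (simp only: mult_minus_left)
    also have "\<dots> = contour_integral \<delta> (\<lambda>w. 0)"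
    proof (rule contour_integral_cong[OF refl])
      fix w assume "w \<in> path_image \<delta>"
      then have "n w = 0" using \<Delta>(1)[OF \<delta>] by (auto simp: D_def)
      then show "(\<Sum>\<gamma>\<leftarrow>\<Gamma>. - (2 * of_real pi * \<i> * g w) * winding_number \<gamma> w) = 0"
        unfolding sum_list_const_mult by (simp add: n_def)
    qed
    finally show "(\<Sum>\<gamma>\<leftarrow>\<Gamma>. contour_integral \<delta> (\<lambda>w. - (2 * of_real pi * \<i> * g w * winding_number \<gamma> w))) = 0"
      by simp
  qed
  finally show ?thesis by simp
qed

lemma winding_number_eq_contour_integral:
  assumes "valid_path \<gamma>" "z \<notin> path_image \<gamma>"
  shows "winding_number \<gamma> z = 1 / (2 * of_real pi * \<i>) * contour_integral \<gamma> (\<lambda>w. 1 / (w - z))"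
  using assms by (simp add: winding_number_valid_path)

lemma smooth_loops_approx:
  assumes W: "open W" and \<Gamma>: "\<And>\<gamma>. \<gamma> \<in> set \<Gamma> \<Longrightarrow> valid_path \<gamma> \<and> pathfinish \<gamma> = pathstart \<gamma> \<and> path_image \<gamma> \<subseteq> W"
  obtains \<Delta> where "\<And>\<gamma>. \<gamma> \<in> set \<Delta> \<Longrightarrow> smooth_loop \<gamma> \<and> path_image \<gamma> \<subseteq> W"
    "\<And>f. f holomorphic_on W \<Longrightarrow> (\<Sum>\<gamma>\<leftarrow>\<Delta>. contour_integral \<gamma> f) = (\<Sum>\<gamma>\<leftarrow>\<Gamma>. contour_integral \<gamma> f)"
    "\<And>z. z \<notin> W \<Longrightarrow> (\<Sum>\<gamma>\<leftarrow>\<Delta>. winding_number \<gamma> z) = (\<Sum>\<gamma>\<leftarrow>\<Gamma>. winding_number \<gamma> z)"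
proof -
  have "\<exists>p. smooth_loop p \<and> path_image p \<subseteq> W \<and> (\<forall>f. f holomorphic_on W \<longrightarrow> contour_integral p f = contour_integral \<gamma> f)"
    if \<gamma>: "\<gamma> \<in> set \<Gamma>" for \<gamma>
    using smooth_loop_approx[OF W, of \<gamma>] \<Gamma>[OF \<gamma>] by metis
  then obtain p where p: "\<And>\<gamma>. \<gamma> \<in> set \<Gamma> \<Longrightarrow> smooth_loop (p \<gamma>) \<and> path_image (p \<gamma>) \<subseteq> W"
    "\<And>\<gamma> f. \<gamma> \<in> set \<Gamma> \<Longrightarrow> f holomorphic_on W \<Longrightarrow> contour_integral (p \<gamma>) f = contour_integral \<gamma> f"
    by metis
  have w: "winding_number (p \<gamma>) z = winding_number \<gamma> z" if \<gamma>: "\<gamma> \<in> set \<Gamma>" and z: "z \<notin> W" for \<gamma> z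
  proof -
    have "(\<lambda>w. 1 / (w - z)) holomorphic_on W"
      using z by (intro holomorphic_intros) auto
    then show ?thesis
      using p[OF \<gamma>] \<Gamma>[OF \<gamma>] z
      by (subst (1 2) winding_number_eq_contour_integral) (auto simp: smooth_loop_def)
  qed
  show thesis
  proof (rule that[of "map p \<Gamma>"])
    show "(\<Sum>\<gamma>\<leftarrow>map p \<Gamma>. contour_integral \<gamma> f) = (\<Sum>\<gamma>\<leftarrow>\<Gamma>. contour_integral \<gamma> f)" if "f holomorphic_on W" for f
      unfolding map_map o_def using p(2) that by (intro arg_cong[where f = sum_list] map_cong refl) auto
    show "(\<Sum>\<gamma>\<leftarrow>map p \<Gamma>. winding_number \<gamma> z) = (\<Sum>\<gamma>\<leftarrow>\<Gamma>. winding_number \<gamma> z)" if "z \<notin> W" for z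
      unfolding map_map o_def using w that by (intro arg_cong[where f = sum_list] map_cong refl) auto
  qed (use p(1) in auto)
qed

text \<open>The passage from smooth loops to arbitrary valid paths is needed because
  \<open>hol_calculus\<close> may have chosen any surrounding cycle.\<close>

theorem Cauchy_cycle:
  assumes S: "open S" and g: "g holomorphic_on S"
    and \<Gamma>: "\<And>\<gamma>. \<gamma> \<in> set \<Gamma> \<Longrightarrow> valid_path \<gamma> \<and> pathfinish \<gamma> = pathstart \<gamma> \<and> path_image \<gamma> \<subseteq> S"
    and zero: "\<And>z. z \<notin> S \<Longrightarrow> (\<Sum>\<gamma>\<leftarrow>\<Gamma>. winding_number \<gamma> z) = 0"
  shows "(\<Sum>\<gamma>\<leftarrow>\<Gamma>. contour_integral \<gamma> g) = 0"
proof -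
  obtain \<Delta> where \<Delta>: "\<And>\<gamma>. \<gamma> \<in> set \<Delta> \<Longrightarrow> smooth_loop \<gamma> \<and> path_image \<gamma> \<subseteq> S"
    "\<And>f. f holomorphic_on S \<Longrightarrow> (\<Sum>\<gamma>\<leftarrow>\<Delta>. contour_integral \<gamma> f) = (\<Sum>\<gamma>\<leftarrow>\<Gamma>. contour_integral \<gamma> f)"
    "\<And>z. z \<notin> S \<Longrightarrow> (\<Sum>\<gamma>\<leftarrow>\<Delta>. winding_number \<gamma> z) = (\<Sum>\<gamma>\<leftarrow>\<Gamma>. winding_number \<gamma> z)"
    using smooth_loops_approx[OF S \<Gamma>] by metis
  show ?thesis
    using Cauchy_smooth_cycle[OF S g \<Delta>(1)] \<Delta>(2)[OF g] \<Delta>(3) zero by simp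
qed

corollary exists_surrounding_cycle:
  assumes S: "open S" and K: "compact K" "K \<subseteq> S"
  obtains \<Gamma> where "surrounds_in \<Gamma> K S" "\<And>\<gamma>. \<gamma> \<in> set \<Gamma> \<Longrightarrow> smooth_loop \<gamma>"
proof (rule surrounding_loops[OF S K])
  fix \<Gamma> assume \<Gamma>: "\<And>\<gamma>. \<gamma> \<in> set \<Gamma> \<Longrightarrow> smooth_loop \<gamma> \<and> path_image \<gamma> \<subseteq> S - K"
    "\<And>f z. f holomorphic_on S \<Longrightarrow> z \<in> K \<Longrightarrow>
      (\<Sum>\<gamma>\<leftarrow>\<Gamma>. contour_integral \<gamma> (\<lambda>w. f w / (w - z))) = 2 * of_real pi * \<i> * f z"
    "\<And>z. z \<notin> S \<Longrightarrow> (\<Sum>\<gamma>\<leftarrow>\<Gamma>. contour_integral \<gamma> (\<lambda>w. 1 / (w - z))) = 0"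
  have wind: "(\<Sum>\<gamma>\<leftarrow>\<Gamma>. winding_number \<gamma> z) = 1 / (2 * of_real pi * \<i>) * (\<Sum>\<gamma>\<leftarrow>\<Gamma>. contour_integral \<gamma> (\<lambda>w. 1 / (w - z)))"
    if z: "z \<notin> S - K" for z
    unfolding sum_list_const_mult[symmetric]
  proof (intro arg_cong[where f = sum_list] map_cong refl)
    fix \<gamma> assume "\<gamma> \<in> set \<Gamma>"
    then show "winding_number \<gamma> z = 1 / (2 * of_real pi * \<i>) * contour_integral \<gamma> (\<lambda>w. 1 / (w - z))"
      using \<Gamma>(1)[of \<gamma>] z by (intro winding_number_eq_contour_integral) (auto simp: smooth_loop_def)
  qed
  have "surrounds_in \<Gamma> K S"
    unfolding surrounds_in_def
  proof (intro conjI ballI allI impI)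
    show "(\<Sum>\<gamma>\<leftarrow>\<Gamma>. winding_number \<gamma> z) = 1" if "z \<in> K" for z
      using wind[of z] \<Gamma>(2)[of "\<lambda>_. 1" z] that by simp
    show "(\<Sum>\<gamma>\<leftarrow>\<Gamma>. winding_number \<gamma> z) = 0" if "z \<notin> S" for z
      using wind[of z] \<Gamma>(3)[of z] that by simp
  qed (use \<Gamma>(1) in \<open>auto simp: smooth_loop_def\<close>)
  then show thesis using that \<Gamma>(1) by blast
qed


section \<open>The resolvent\<close>

text \<open>In place of the Neumann series, \<open>x = y + K x\<close> is solved by the contraction
  principle; boundedness of the inverse is contained in \<open>bij_invertible\<close>.\<close>

lemma invertible_id_minus:
  fixes K :: "'a :: complex_banach \<Rightarrow>\<^sub>C\<^sub>L 'a"
  assumes "norm K < 1"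
  shows "invertible_cblinfun (id_cblinfun - K)"
proof (rule bij_invertible)
  have "\<exists>!x. (id_cblinfun - K) x = y" for y
  proof -
    have "\<exists>!x. y + K x = x"
    proof (rule banach_fix_type[OF norm_ge_zero assms], intro allI)
      show "dist (y + K x) (y + K x') \<le> norm K * dist x x'" for x x'
        using norm_apply[of K "x - x'"] by (simp add: dist_norm)
    qed
    moreover have "(id_cblinfun - K) x = y \<longleftrightarrow> y + K x = x" for x
      by (auto simp: algebra_simps)
    ultimately show ?thesis by simp
  qed
  then show "bij (cblinfun_apply (id_cblinfun - K))"
    by (intro bijI') metis+
qed

lemma invertible_perturbation:
  fixes A B :: "'a :: complex_banach \<Rightarrow>\<^sub>C\<^sub>L 'a"
  assumes A: "invertible_cblinfun A" and B: "norm (A - B) * norm (cblinfun_inverse A) < 1"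
  shows "invertible_cblinfun B"
proof -
  let ?K = "cblinfun_inverse A o\<^sub>C (A - B)"
  have "norm ?K < 1"
    using norm_compose[of "cblinfun_inverse A" "A - B"] B by (simp add: mult.commute)
  then have "invertible_cblinfun (A o\<^sub>C (id_cblinfun - ?K))"
    by (intro invertible_compose A invertible_id_minus)
  also have "A o\<^sub>C (id_cblinfun - ?K) = B"
    by (rule cblinfun_eqI) (simp add: A)
  finally show ?thesis .
qed

lemma invertible_scaleC_iff:
  fixes A :: "'a :: complex_normed_vector \<Rightarrow>\<^sub>C\<^sub>L 'a"
  assumes c: "c \<noteq> 0"
  shows "invertible_cblinfun (c *\<^sub>C A) \<longleftrightarrow> invertible_cblinfun A"
proof -
  have *: "invertible_cblinfun (c *\<^sub>C A)" if c: "c \<noteq> 0" and A: "invertible_cblinfun A"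
    for c and A :: "'a \<Rightarrow>\<^sub>C\<^sub>L 'a"
    by (rule inverse_unique(2)[where S = "inverse c *\<^sub>C cblinfun_inverse A"])
      (rule cblinfun_eqI, simp add: A c scaleC_scaleC)+
  have "inverse c *\<^sub>C (c *\<^sub>C A) = A" using c by (simp add: scaleC_scaleC)
  then show ?thesis using *[of c A] *[of "inverse c" "c *\<^sub>C A"] c by auto
qed

text \<open>The resolvent in the sign convention of the functional calculus; it is only meaningful off the spectrum.\<close>

definition resolvent :: "('a :: complex_normed_vector \<Rightarrow>\<^sub>C\<^sub>L 'a) \<Rightarrow> complex \<Rightarrow> ('a \<Rightarrow>\<^sub>C\<^sub>L 'a)" where
  "resolvent T z = cblinfun_inverse (z *\<^sub>C id_cblinfun - T)"

lemma not_in_spectrum_iff: "z \<notin> spectrum T \<longleftrightarrow> invertible_cblinfun (z *\<^sub>C id_cblinfun - T)"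
proof -
  have "T - z *\<^sub>C id_cblinfun = (-1) *\<^sub>C (z *\<^sub>C id_cblinfun - T)"
    by (rule cblinfun_eqI) (simp add: complex_vector.scale_right_diff_distrib complex_vector.scale_minus_left)
  then show ?thesis
    using invertible_scaleC_iff[of "-1" "z *\<^sub>C id_cblinfun - T"] by (simp add: spectrum_def)
qed

lemma resolvent_apply:
  assumes "z \<notin> spectrum T"
  shows "z *\<^sub>C resolvent T z x - T (resolvent T z x) = x" "resolvent T z (z *\<^sub>C x - T x) = x"
  using inverse_apply[OF assms[unfolded not_in_spectrum_iff]] unfolding resolvent_def by simp_all

lemma resolvent_commute:
  fixes T B :: "'a :: complex_normed_vector \<Rightarrow>\<^sub>C\<^sub>L 'a"
  assumes z: "z \<notin> spectrum T" and comm: "\<And>x. T (B x) = B (T x)"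
  shows "resolvent T z (B x) = B (resolvent T z x)"
  unfolding resolvent_def
  by (rule commute_inverse[OF z[unfolded not_in_spectrum_iff]]) (simp add: comm)

lemma resolvent_identity:
  assumes z: "z \<notin> spectrum T" and w: "w \<notin> spectrum T"
  shows "resolvent T z - resolvent T w = (w - z) *\<^sub>C (resolvent T z o\<^sub>C resolvent T w)"
proof (rule cblinfun_eqI)
  fix x
  let ?y = "resolvent T w x"
  have "resolvent T z (w *\<^sub>C ?y - T ?y) = resolvent T z x"
    using resolvent_apply(1)[OF w] by simp
  moreover have "w *\<^sub>C ?y - T ?y = (z *\<^sub>C ?y - T ?y) + (w - z) *\<^sub>C ?y"
    by (simp add: complex_vector.scale_left_diff_distrib)
  ultimately have "resolvent T z x = ?y + (w - z) *\<^sub>C resolvent T z ?y"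
    using resolvent_apply(2)[OF z, of ?y] by (simp only: apply_add apply_scaleC)
  then show "(resolvent T z - resolvent T w) x = ((w - z) *\<^sub>C (resolvent T z o\<^sub>C resolvent T w)) x"
    by simp
qed

lemma closed_spectrum:
  fixes T :: "'a :: complex_banach \<Rightarrow>\<^sub>C\<^sub>L 'a"
  shows "closed (spectrum T)"
  unfolding closed_def open_contains_ball
proof
  fix z assume "z \<in> - spectrum T"
  then have z: "invertible_cblinfun (z *\<^sub>C id_cblinfun - T)"
    using not_in_spectrum_iff by blast
  let ?R = "norm (resolvent T z)"
  have "w \<notin> spectrum T" if w: "w \<in> ball z (1 / (?R + 1))" for w
  proof -
    have "norm ((z *\<^sub>C id_cblinfun - T) - (w *\<^sub>C id_cblinfun - T)) \<le> cmod (z - w) * 1"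
    proof -
      have "(z *\<^sub>C id_cblinfun - T) - (w *\<^sub>C id_cblinfun - T) = (z - w) *\<^sub>C id_cblinfun"
        by (simp add: complex_vector.scale_left_diff_distrib)
      then show ?thesis
        using norm_id_le mult_left_mono[OF norm_id_le, of "cmod (z - w)"] by (simp add: norm_scaleC)
    qed
    then have "norm ((z *\<^sub>C id_cblinfun - T) - (w *\<^sub>C id_cblinfun - T)) * ?R \<le> cmod (z - w) * ?R"
      by (intro mult_right_mono) auto
    also have "\<dots> \<le> cmod (z - w) * (?R + 1)"
      by (intro mult_left_mono) auto
    also have "\<dots> < 1"
    proof -
      have "0 < ?R + 1" by (smt (verit) norm_ge_zero)
      then show ?thesis using w by (simp add: dist_norm pos_less_divide_eq)
    qed
    finally show ?thesis
      unfolding not_in_spectrum_iff resolvent_def by (rule invertible_perturbation[OF z])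
  qed
  moreover have "0 < 1 / (?R + 1)" by (smt (verit) norm_ge_zero zero_less_divide_1_iff)
  ultimately show "\<exists>e>0. ball z e \<subseteq> - spectrum T" by blast
qed

lemma norm_less_not_in_spectrum:
  fixes T :: "'a :: complex_banach \<Rightarrow>\<^sub>C\<^sub>L 'a"
  assumes "norm T < cmod z"
  shows "z \<notin> spectrum T"
proof -
  have z: "z \<noteq> 0" using assms by auto
  have "norm (inverse z *\<^sub>C T) < 1"
    using assms z by (simp add: norm_scaleC norm_divide norm_inverse field_simps)
  then have "invertible_cblinfun (z *\<^sub>C (id_cblinfun - inverse z *\<^sub>C T))"
    using invertible_scaleC_iff[OF z] invertible_id_minus by blast
  also have "z *\<^sub>C (id_cblinfun - inverse z *\<^sub>C T) = z *\<^sub>C id_cblinfun - T"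
    using z by (simp add: complex_vector.scale_right_diff_distrib scaleC_scaleC)
  finally show ?thesis by (simp add: not_in_spectrum_iff)
qed

lemma compact_spectrum:
  fixes T :: "'a :: complex_banach \<Rightarrow>\<^sub>C\<^sub>L 'a"
  shows "compact (spectrum T)"
proof -
  have "cmod z \<le> norm T" if "z \<in> spectrum T" for z
    using norm_less_not_in_spectrum[of T z] that by linarith
  then have "bounded (spectrum T)" unfolding bounded_iff by blast
  then show ?thesis using closed_spectrum compact_eq_bounded_closed by blast
qed

text \<open>In the resolvent identity the term that contains \<open>resolvent T w\<close> is at most
  half of its norm and is absorbed on the left. This bound is what gives continuity of the
  resolvent.\<close>

lemma resolvent_locally_bounded:
  fixes T :: "'a :: complex_banach \<Rightarrow>\<^sub>C\<^sub>L 'a"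
  assumes z: "z \<notin> spectrum T" and w: "w \<notin> spectrum T"
    and close: "cmod (w - z) * norm (resolvent T z) \<le> 1 / 2"
  shows "norm (resolvent T w) \<le> 2 * norm (resolvent T z)"
proof -
  have "resolvent T w = resolvent T z - (w - z) *\<^sub>C (resolvent T z o\<^sub>C resolvent T w)"
    using resolvent_identity[OF z w] by (simp add: algebra_simps)
  then have "norm (resolvent T w) \<le> norm (resolvent T z) + cmod (w - z) * norm (resolvent T z o\<^sub>C resolvent T w)"
    using norm_triangle_ineq4 by (metis norm_scaleC)
  also have "\<dots> \<le> norm (resolvent T z) + cmod (w - z) * (norm (resolvent T z) * norm (resolvent T w))"
    by (intro add_left_mono mult_left_mono norm_compose) auto
  also have "cmod (w - z) * (norm (resolvent T z) * norm (resolvent T w)) \<le> 1 / 2 * norm (resolvent T w)"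
    using mult_right_mono[OF close, of "norm (resolvent T w)"] by (simp add: mult.assoc)
  finally show ?thesis by simp
qed

lemma resolvent_tendsto:
  fixes T :: "'a :: complex_banach \<Rightarrow>\<^sub>C\<^sub>L 'a"
  assumes z: "z \<notin> spectrum T"
  shows "(resolvent T \<longlongrightarrow> resolvent T z) (at z)"
proof -
  let ?R = "norm (resolvent T z)"
  have "open (- spectrum T)" using closed_spectrum by blast
  then have ev: "\<forall>\<^sub>F w in at z. w \<notin> spectrum T"
    using z eventually_at_topological by blast
  have "((\<lambda>w. cmod (w - z) * ?R) \<longlongrightarrow> cmod (z - z) * ?R) (at z)"
    by (intro tendsto_intros)
  then have lim0: "((\<lambda>w. cmod (w - z) * ?R) \<longlongrightarrow> 0) (at z)" by simp
  then have ev2: "\<forall>\<^sub>F w in at z. cmod (w - z) * ?R < 1 / 2"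
    by (rule order_tendstoD) simp
  have "((\<lambda>w. resolvent T w - resolvent T z) \<longlongrightarrow> 0) (at z)"
  proof (rule Lim_null_comparison)
    show "\<forall>\<^sub>F w in at z. norm (resolvent T w - resolvent T z) \<le> cmod (w - z) * ?R * (2 * ?R)"
      using ev ev2
    proof eventually_elim
      case (elim w)
      have "norm (resolvent T w - resolvent T z) = cmod (z - w) * norm (resolvent T w o\<^sub>C resolvent T z)"
        using resolvent_identity[OF elim(1) z] by (simp add: norm_scaleC)
      also have "\<dots> \<le> cmod (z - w) * ((2 * ?R) * ?R)"
        using resolvent_locally_bounded[OF z elim(1)] elim(2)
        by (intro mult_left_mono order_trans[OF norm_compose] mult_right_mono) auto
      finally show ?case by (simp add: norm_minus_commute mult_ac)
    qed
    show "((\<lambda>w. cmod (w - z) * ?R * (2 * ?R)) \<longlongrightarrow> 0) (at z)"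
      using tendsto_mult_left_zero[OF lim0] .
  qed
  then show ?thesis by (simp add: LIM_zero_iff)
qed

lemma functional_resolvent_holomorphic:
  fixes T :: "'a :: complex_banach \<Rightarrow>\<^sub>C\<^sub>L 'a" and \<phi> :: "('a \<Rightarrow>\<^sub>C\<^sub>L 'a) \<Rightarrow> complex"
  assumes \<phi>: "bounded_clinear \<phi>"
  shows "(\<lambda>z. \<phi> (resolvent T z)) holomorphic_on - spectrum T"
proof -
  have op: "open (- spectrum T)" using closed_spectrum by blast
  have lin: "bounded_linear \<phi>" using \<phi> by (rule bounded_clinear_linear)
  have "((\<lambda>z. \<phi> (resolvent T z)) has_field_derivative - \<phi> (resolvent T z o\<^sub>C resolvent T z)) (at z)"
    if z: "z \<in> - spectrum T" for z
    unfolding has_field_derivative_iff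
  proof (rule Lim_transform_eventually)
    have "((\<lambda>w. \<phi> (resolvent T w o\<^sub>C resolvent T z)) \<longlongrightarrow> \<phi> (resolvent T z o\<^sub>C resolvent T z)) (at z)"
      using resolvent_tendsto z
      by (intro bounded_linear.tendsto[OF lin]
        bounded_linear.tendsto[OF bounded_clinear_linear[OF bounded_clinear_compose_left]]) auto
    then show "((\<lambda>w. - \<phi> (resolvent T w o\<^sub>C resolvent T z)) \<longlongrightarrow> - \<phi> (resolvent T z o\<^sub>C resolvent T z)) (at z)"
      by (rule tendsto_minus)
    have "\<forall>\<^sub>F w in at z. w \<in> - spectrum T"
      using z op eventually_at_topological by blast
    moreover have "\<forall>\<^sub>F w in at z. w \<noteq> z" by (simp add: eventually_at_filter)
    ultimately show "\<forall>\<^sub>F w in at z. - \<phi> (resolvent T w o\<^sub>C resolvent T z) = (\<phi> (resolvent T w) - \<phi> (resolvent T z)) / (w - z)"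
    proof eventually_elim
      case (elim w)
      have "\<phi> (resolvent T w) - \<phi> (resolvent T z) = \<phi> (resolvent T w - resolvent T z)"
        using linear_diff[OF bounded_linear.linear[OF lin]] by simp
      also have "\<dots> = (z - w) * \<phi> (resolvent T w o\<^sub>C resolvent T z)"
        using resolvent_identity[of w T z] elim(1) z bounded_clinear_scaleC[OF \<phi>]
        by (simp add: scaleC_complex_def)
      finally show ?case using elim(2) by (simp add: field_simps)
    qed
  qed
  then show ?thesis
    using op by (simp add: holomorphic_on_open) blast
qed


section \<open>Contour integrals of vector-valued functions\<close>

lemma functional_linear:
  fixes \<phi> :: "'b :: complex_normed_vector \<Rightarrow> complex"
  assumes "bounded_clinear \<phi>"
  shows "\<phi> (x + y) = \<phi> x + \<phi> y" "\<phi> (x - y) = \<phi> x - \<phi> y" "\<phi> 0 = 0" "\<phi> (c *\<^sub>C x) = c * \<phi> x"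
  using linear_add[OF bounded_linear.linear[OF bounded_clinear_linear[OF assms]]]
    linear_diff[OF bounded_linear.linear[OF bounded_clinear_linear[OF assms]]]
    linear_0[OF bounded_linear.linear[OF bounded_clinear_linear[OF assms]]]
    bounded_clinear_scaleC[OF assms, of c x]
  by (simp_all add: scaleC_complex_def)

lemma bounded_bilinear_scaleC: "bounded_bilinear (\<lambda>c (x :: 'a :: complex_normed_vector). c *\<^sub>C x)"
proof
  show "\<exists>K. \<forall>a (b :: 'a). norm (a *\<^sub>C b) \<le> norm a * norm b * K"
    by (rule exI[of _ 1]) (simp add: norm_scaleC)
  show "(r *\<^sub>R c) *\<^sub>C x = r *\<^sub>R (c *\<^sub>C x)" for r :: real and c and x :: 'a
    by (simp add: scaleR_scaleC scaleC_scaleC scaleC_complex_def)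
  show "c *\<^sub>C (r *\<^sub>R x) = r *\<^sub>R (c *\<^sub>C x)" for r :: real and c and x :: 'a
    by (simp add: scaleR_scaleC scaleC_scaleC mult.commute)
qed (simp_all add: scaleC_add_left scaleC_add_right)

lemmas continuous_on_scaleC [continuous_intros] = bounded_bilinear.continuous_on[OF bounded_bilinear_scaleC]

text \<open>Functionals give access to scalar Cauchy theory, while norm continuity lets integrals
  along segments exist as vectors.\<close>

definition weakly_holomorphic_on :: "(complex \<Rightarrow> 'a :: complex_normed_vector) \<Rightarrow> complex set \<Rightarrow> bool" where
  "weakly_holomorphic_on F S \<longleftrightarrow> continuous_on S F \<and>
     (\<forall>\<phi> :: 'a \<Rightarrow> complex. bounded_clinear \<phi> \<longrightarrow> (\<lambda>z. \<phi> (F z)) holomorphic_on S)"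

definition line_integral :: "(complex \<Rightarrow> 'a :: complex_normed_vector) \<Rightarrow> complex \<Rightarrow> complex \<Rightarrow> 'a" where
  "line_integral F a b = integral {0..1} (\<lambda>t. (b - a) *\<^sub>C F (linepath a b t))"

lemma continuous_on_line:
  assumes "continuous_on S F" "closed_segment a b \<subseteq> S"
  shows "continuous_on {0..1} (\<lambda>t. F (linepath a b t))"
proof (rule continuous_on_compose2[OF assms(1)])
  show "continuous_on {0..1} (linepath a b)" by (rule continuous_on_linepath)
  show "linepath a b ` {0..1} \<subseteq> S"
    using assms(2) path_image_linepath[of a b] by (simp add: path_image_def)
qed

lemma functional_line_integral:
  fixes F :: "complex \<Rightarrow> 'a :: complex_banach" and \<phi> :: "'a \<Rightarrow> complex"
  assumes F: "continuous_on S F" "closed_segment a b \<subseteq> S" and \<phi>: "bounded_clinear \<phi>"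
  shows "\<phi> (line_integral F a b) = contour_integral (linepath a b) (\<lambda>z. \<phi> (F z))"
proof -
  have "(\<lambda>t. (b - a) *\<^sub>C F (linepath a b t)) integrable_on {0..1}"
    using continuous_on_line[OF F] by (intro integrable_continuous_real continuous_intros)
  from integral_linear[OF this bounded_clinear_linear[OF \<phi>]]
  have "\<phi> (line_integral F a b) = integral {0..1} (\<lambda>t. (b - a) * \<phi> (F (linepath a b t)))"
    by (simp add: line_integral_def o_def functional_linear[OF \<phi>])
  then show ?thesis
    by (simp add: contour_integral_integral mult.commute)
qed

text \<open>Path independence within the disc is tested on functionals, where it is Cauchy's theorem
  for a triangle. Differentiability then uses only the norm continuity of \<open>F\<close>.\<close>

lemma line_integral_primitive:
  fixes F :: "complex \<Rightarrow> 'a :: complex_banach"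
  assumes F: "weakly_holomorphic_on F (ball a r)" and z: "z \<in> ball a r"
  shows "(line_integral F a has_derivative (\<lambda>h. h *\<^sub>C F z)) (at z)"
proof -
  have cont: "continuous_on (ball a r) F" using F by (simp add: weakly_holomorphic_on_def)
  have a: "a \<in> ball a r" using z by (metis centre_in_ball dist_self le_less_trans mem_ball zero_le_dist)
  have seg: "closed_segment x y \<subseteq> ball a r" if "x \<in> ball a r" "y \<in> ball a r" for x y
    using that by (intro closed_segment_subset convex_ball)
  have diff: "line_integral F a w - line_integral F a z = line_integral F z w" if w: "w \<in> ball a r" for w
  proof (rule functionals_separate)
    fix \<phi> :: "'a \<Rightarrow> complex" assume \<phi>: "bounded_clinear \<phi>"
    let ?f = "\<lambda>z. \<phi> (F z)"
    have hol: "?f holomorphic_on ball a r"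
      using F \<phi> by (simp add: weakly_holomorphic_on_def)
    have "convex hull {a, z, w} \<subseteq> ball a r"
      using a z w by (intro hull_minimal convex_ball) auto
    then have tri: "(?f has_contour_integral 0) (linepath a z +++ linepath z w +++ linepath w a)"
      using hol by (intro Cauchy_theorem_triangle holomorphic_on_subset[OF hol])
    have int: "?f contour_integrable_on linepath x y" if "x \<in> ball a r" "y \<in> ball a r" for x y
      using seg[OF that] holomorphic_on_imp_continuous_on[OF hol]
      by (intro contour_integrable_continuous_linepath) (blast intro: continuous_on_subset)
    have "contour_integral (linepath a z +++ linepath z w +++ linepath w a) ?f =
        contour_integral (linepath a z) ?f + (contour_integral (linepath z w) ?f + contour_integral (linepath w a) ?f)"
      using int[OF a z] int[OF z w] int[OF w a]
      by (simp add: contour_integral_join contour_integrable_joinI valid_path_join)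
    then have "contour_integral (linepath a z) ?f + (contour_integral (linepath z w) ?f + contour_integral (linepath w a) ?f) = 0"
      using contour_integral_unique[OF tri] by simp
    moreover have "contour_integral (linepath w a) ?f = - contour_integral (linepath a w) ?f"
      using contour_integral_reversepath[OF valid_path_linepath, of a w ?f] by (simp add: reversepath_linepath)
    ultimately have "contour_integral (linepath a w) ?f - contour_integral (linepath a z) ?f = contour_integral (linepath z w) ?f"
      by (simp add: algebra_simps)
    then show "\<phi> (line_integral F a w - line_integral F a z) = \<phi> (line_integral F z w)"
      unfolding functional_linear(2)[OF \<phi>]
      using functional_line_integral[OF cont seg \<phi>] a z w by simp
  qed
  have lin: "bounded_linear (\<lambda>h. h *\<^sub>C F z)"
    by (rule bounded_bilinear.bounded_linear_left[OF bounded_bilinear_scaleC])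
  show ?thesis
    unfolding has_derivative_at_alt
  proof (intro conjI lin allI impI)
    fix e :: real assume e: "0 < e"
    have "isCont F z"
      using cont z by (simp add: continuous_on_eq_continuous_at)
    then obtain d where d: "0 < d" "\<And>w. dist w z < d \<Longrightarrow> dist (F w) (F z) < e"
      using e unfolding continuous_at_eps_delta by blast
    obtain d' where d': "0 < d'" "ball z d' \<subseteq> ball a r"
      using openE[OF open_ball z] by blast
    have "norm (line_integral F a w - line_integral F a z - (w - z) *\<^sub>C F z) \<le> e * norm (w - z)"
      if w: "norm (w - z) < min d d'" for w
    proof -
      have "w \<in> ball z d'" using w by (simp add: dist_norm norm_minus_commute)
      then have wb: "w \<in> ball a r" using d'(2) by blast
      have c: "continuous_on {0..1} (\<lambda>t. (w - z) *\<^sub>C F (linepath z w t))"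
        using continuous_on_line[OF cont seg[OF z wb]] by (intro continuous_intros)
      have "line_integral F a w - line_integral F a z - (w - z) *\<^sub>C F z =
          integral {0..1} (\<lambda>t. (w - z) *\<^sub>C F (linepath z w t)) - integral {0..1} (\<lambda>t :: real. (w - z) *\<^sub>C F z)"
        by (subst diff[OF wb]) (simp add: line_integral_def)
      also have "\<dots> = integral {0..1} (\<lambda>t. (w - z) *\<^sub>C F (linepath z w t) - (w - z) *\<^sub>C F z)"
        by (rule integral_diff[symmetric]) (intro integrable_continuous_real c continuous_on_const)+
      finally have eq: "line_integral F a w - line_integral F a z - (w - z) *\<^sub>C F z =
          integral {0..1} (\<lambda>t. (w - z) *\<^sub>C F (linepath z w t) - (w - z) *\<^sub>C F z)" .
      have "norm (integral {0..1} (\<lambda>t. (w - z) *\<^sub>C F (linepath z w t) - (w - z) *\<^sub>C F z)) \<le> (e * norm (w - z)) * (1 - 0)"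
      proof (rule integral_bound)
        show "continuous_on {0..1} (\<lambda>t. (w - z) *\<^sub>C F (linepath z w t) - (w - z) *\<^sub>C F z)"
          by (intro continuous_on_diff c continuous_on_const)
        fix t :: real assume t: "t \<in> {0..1}"
        have "linepath z w t - z = t *\<^sub>R (w - z)"
          by (simp add: linepath_def algebra_simps)
        then have "dist (linepath z w t) z \<le> norm (w - z)"
          using t by (simp add: dist_norm mult_left_le_one_le)
        then have "norm (F (linepath z w t) - F z) \<le> e"
          using d(2)[of "linepath z w t"] w by (simp add: dist_norm)
        then show "norm ((w - z) *\<^sub>C F (linepath z w t) - (w - z) *\<^sub>C F z) \<le> e * norm (w - z)"
          unfolding complex_vector.scale_right_diff_distrib[symmetric] norm_scaleC
          by (metis mult.commute mult_left_mono norm_ge_zero)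
      qed simp
      then show ?thesis unfolding eq by simp
    qed
    then show "\<exists>d>0. \<forall>w. norm (w - z) < d \<longrightarrow>
        norm (line_integral F a w - line_integral F a z - (w - z) *\<^sub>C F z) \<le> e * norm (w - z)"
      using d(1) d'(1) by (intro exI[of _ "min d d'"]) auto
  qed
qed

text \<open>A path that is only piecewise differentiable may have an unbounded derivative, so integrability
  is obtained from local primitives rather than from continuity.\<close>

lemma vector_contour_integrable:
  fixes F :: "complex \<Rightarrow> 'a :: complex_banach"
  assumes S: "open S" and F: "weakly_holomorphic_on F S" and \<gamma>: "valid_path \<gamma>" "path_image \<gamma> \<subseteq> S"
  shows "(\<lambda>t. vector_derivative \<gamma> (at t within {0..1}) *\<^sub>C F (\<gamma> t)) integrable_on {0..1}"
proof -
  let ?g = "\<lambda>t. vector_derivative \<gamma> (at t within {0..1}) *\<^sub>C F (\<gamma> t)"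
  have cont_\<gamma>: "continuous_on {0..1} \<gamma>"
    using valid_path_imp_path[OF \<gamma>(1)] by (simp add: path_def)
  obtain K where K: "finite K" "\<And>t. t \<in> {0..1} - K \<Longrightarrow> \<gamma> differentiable at t"
    using \<gamma>(1) unfolding valid_path_def piecewise_C1_differentiable_on_def C1_differentiable_on_eq by blast
  have "?g integrable_on cbox 0 1"
  proof (rule integrable_on_little_subintervals, rule ballI)
    fix t :: real assume "t \<in> cbox 0 1"
    then have t: "t \<in> {0..1}" by simp
    then have "\<gamma> t \<in> S" using \<gamma>(2) by (auto simp: path_image_def)
    then obtain r where r: "0 < r" "ball (\<gamma> t) r \<subseteq> S"
      using S by (auto simp: open_contains_ball)
    have Fr: "weakly_holomorphic_on F (ball (\<gamma> t) r)"
      using F r(2) unfolding weakly_holomorphic_on_def by (meson continuous_on_subset holomorphic_on_subset)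
    obtain d where d: "0 < d" "\<And>s. s \<in> {0..1} \<Longrightarrow> dist s t < d \<Longrightarrow> dist (\<gamma> s) (\<gamma> t) < r"
      using cont_\<gamma> t r(1) unfolding continuous_on_iff by blast
    let ?G = "line_integral F (\<gamma> t)"
    have "?g integrable_on cbox u v" if uv: "t \<in> cbox u v" "cbox u v \<subseteq> ball t d" "cbox u v \<subseteq> cbox 0 1" for u v
    proof -
      have in_ball: "\<gamma> s \<in> ball (\<gamma> t) r" if s: "s \<in> {u..v}" for s
      proof -
        have "s \<in> ball t d" "s \<in> {0..1}" using uv s by auto
        then show ?thesis using d(2)[of s] by (simp add: dist_commute)
      qed
      have sub: "{u..v} \<subseteq> {0..1}" using uv(3) by simp
      have "(?g has_integral ?G (\<gamma> v) - ?G (\<gamma> u)) {u..v}"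
      proof (rule fundamental_theorem_of_calculus_interior_strong[OF K(1), where f = "\<lambda>s. ?G (\<gamma> s)"])
        show "u \<le> v" using uv(1) by auto
        have "continuous_on (ball (\<gamma> t) r) ?G"
          using line_integral_primitive[OF Fr] by (meson continuous_at_imp_continuous_on has_derivative_continuous)
        then show "continuous_on {u..v} (\<lambda>s. ?G (\<gamma> s))"
          using continuous_on_compose2[OF _ continuous_on_subset[OF cont_\<gamma> sub]] in_ball by blast
        fix s assume s: "s \<in> {u<..<v} - K"
        then have s01: "s \<in> {0<..<1}" using sub uv(1) by (auto simp: subset_iff) (smt (verit) atLeastAtMost_iff sub subsetD)+
        then have "\<gamma> differentiable at s" using K(2)[of s] s by auto
        then have vd: "(\<gamma> has_vector_derivative vector_derivative \<gamma> (at s)) (at s)"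
          by (simp add: vector_derivative_works)
        have eq: "vector_derivative \<gamma> (at s within {0..1}) = vector_derivative \<gamma> (at s)"
          using s01 vector_derivative_within_cbox[of 0 1 s \<gamma>] has_vector_derivative_at_within[OF vd] by simp
        have "(?G has_derivative (\<lambda>h. h *\<^sub>C F (\<gamma> s))) (at (\<gamma> s))"
          using s in_ball[of s] by (intro line_integral_primitive[OF Fr]) auto
        from has_derivative_compose[OF vd[unfolded has_vector_derivative_def] this]
        have "((\<lambda>s. ?G (\<gamma> s)) has_derivative (\<lambda>h. (h *\<^sub>R vector_derivative \<gamma> (at s)) *\<^sub>C F (\<gamma> s))) (at s)" .
        moreover have "(h *\<^sub>R vector_derivative \<gamma> (at s)) *\<^sub>C F (\<gamma> s) = h *\<^sub>R (vector_derivative \<gamma> (at s) *\<^sub>C F (\<gamma> s))" for h :: real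
          by (simp add: scaleR_scaleC scaleC_scaleC scaleC_complex_def)
        ultimately show "((\<lambda>s. ?G (\<gamma> s)) has_vector_derivative ?g s) (at s)"
          unfolding has_vector_derivative_def eq by simp
      qed
      then show ?thesis by (auto simp: has_integral_integrable)
    qed
    then show "\<exists>d>0. \<forall>u v. t \<in> cbox u v \<and> cbox u v \<subseteq> ball t d \<and> cbox u v \<subseteq> cbox 0 1 \<longrightarrow> ?g integrable_on cbox u v"
      using d(1) by blast
  qed
  then show ?thesis by simp
qed

lemma functional_vector_contour_integral:
  fixes F :: "complex \<Rightarrow> 'a :: complex_banach" and \<phi> :: "'a \<Rightarrow> complex"
  assumes S: "open S" and F: "weakly_holomorphic_on F S" and \<gamma>: "valid_path \<gamma>" "path_image \<gamma> \<subseteq> S"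
    and \<phi>: "bounded_clinear \<phi>"
  shows "\<phi> (vector_contour_integral \<gamma> F) = contour_integral \<gamma> (\<lambda>z. \<phi> (F z))"
proof -
  have "\<phi> (vector_contour_integral \<gamma> F) =
      integral {0..1} (\<lambda>t. vector_derivative \<gamma> (at t within {0..1}) * \<phi> (F (\<gamma> t)))"
    using integral_linear[OF vector_contour_integrable[OF S F \<gamma>] bounded_clinear_linear[OF \<phi>]]
    by (simp add: vector_contour_integral_def o_def functional_linear[OF \<phi>])
  also have "\<dots> = contour_integral \<gamma> (\<lambda>z. \<phi> (F z))"
  proof -
    have "(\<lambda>t. vector_derivative \<gamma> (at t within {0..1}) * \<phi> (F (\<gamma> t))) = (\<lambda>t. \<phi> (F (\<gamma> t)) * vector_derivative \<gamma> (at t within {0..1}))"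
      by (simp add: mult.commute)
    then show ?thesis
      unfolding contour_integral_def has_contour_integral_def integral_def contour_integrable_on_def integrable_on_def by simp
  qed
  finally show ?thesis .
qed


section \<open>The holomorphic functional calculus\<close>

lemma continuous_on_resolvent:
  fixes T :: "'a :: complex_banach \<Rightarrow>\<^sub>C\<^sub>L 'a"
  shows "continuous_on (- spectrum T) (resolvent T)"
  by (rule continuous_at_imp_continuous_on) (use resolvent_tendsto in \<open>auto simp: isCont_def\<close>)

lemma weakly_holomorphic_scaleC_resolvent:
  fixes T :: "'a :: complex_banach \<Rightarrow>\<^sub>C\<^sub>L 'a"
  assumes f: "f holomorphic_on U"
  shows "weakly_holomorphic_on (\<lambda>z. f z *\<^sub>C resolvent T z) (U - spectrum T)"
proof -
  have f': "f holomorphic_on U - spectrum T" using f by (rule holomorphic_on_subset) blast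
  have "continuous_on (U - spectrum T) (\<lambda>z. f z *\<^sub>C resolvent T z)"
    by (intro continuous_on_scaleC holomorphic_on_imp_continuous_on[OF f'] continuous_on_subset[OF continuous_on_resolvent]) blast
  moreover have "(\<lambda>z. \<phi> (f z *\<^sub>C resolvent T z)) holomorphic_on U - spectrum T" if \<phi>: "bounded_clinear \<phi>"
    for \<phi> :: "('a \<Rightarrow>\<^sub>C\<^sub>L 'a) \<Rightarrow> complex"
    unfolding functional_linear(4)[OF \<phi>]
    by (intro holomorphic_on_mult f' holomorphic_on_subset[OF functional_resolvent_holomorphic[OF \<phi>]]) blast
  ultimately show ?thesis by (simp add: weakly_holomorphic_on_def)
qed

lemma surrounds_inD:
  assumes "surrounds_in \<Gamma> K U" "\<gamma> \<in> set \<Gamma>"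
  shows "valid_path \<gamma>" "pathfinish \<gamma> = pathstart \<gamma>" "path_image \<gamma> \<subseteq> U - K" "path \<gamma>"
  using assms by (auto simp: surrounds_in_def valid_path_imp_path)

text \<open>\<open>\<Gamma>\<close> together with the reversed paths of \<open>\<Delta>\<close>
  winds 0 times about every point of \<open>K\<close> and about every point outside
  \<open>U \<union> V\<close>, so Cauchy's theorem applies on the complement of
  \<open>K\<close>.\<close>

lemma surrounding_cycle_independent:
  assumes U: "open U" "K \<subseteq> U" "surrounds_in \<Gamma> K U" and V: "open V" "K \<subseteq> V" "surrounds_in \<Delta> K V"
    and K: "closed K" and g: "g holomorphic_on (U \<union> V) - K"
  shows "(\<Sum>\<gamma>\<leftarrow>\<Gamma>. contour_integral \<gamma> g) = (\<Sum>\<gamma>\<leftarrow>\<Delta>. contour_integral \<gamma> g)"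
proof -
  let ?\<Lambda> = "\<Gamma> @ map reversepath \<Delta>"
  have "(\<Sum>\<gamma>\<leftarrow>?\<Lambda>. contour_integral \<gamma> g) = 0"
  proof (rule Cauchy_cycle[OF _ g])
    show "open (U \<union> V - K)" using U V K by blast
    show "valid_path \<gamma> \<and> pathfinish \<gamma> = pathstart \<gamma> \<and> path_image \<gamma> \<subseteq> U \<union> V - K" if \<gamma>: "\<gamma> \<in> set ?\<Lambda>" for \<gamma>
    proof -
      consider "\<gamma> \<in> set \<Gamma>" | \<delta> where "\<delta> \<in> set \<Delta>" "\<gamma> = reversepath \<delta>" using \<gamma> by auto
      then show ?thesis
      proof cases
        case 1
        then show ?thesis using surrounds_inD[OF U(3)] by blast
      next
        case 2
        then show ?thesis using surrounds_inD[OF V(3) 2(1)] by auto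
      qed
    qed
    fix z assume z: "z \<notin> U \<union> V - K"
    have "(\<Sum>\<gamma>\<leftarrow>\<Delta>. winding_number (reversepath \<gamma>) z) = (\<Sum>\<gamma>\<leftarrow>\<Delta>. (- 1) * winding_number \<gamma> z)"
    proof (intro arg_cong[where f = sum_list] map_cong refl)
      fix \<gamma> assume \<gamma>: "\<gamma> \<in> set \<Delta>"
      have "z \<notin> path_image \<gamma>" using surrounds_inD(3)[OF V(3) \<gamma>] z by blast
      then show "winding_number (reversepath \<gamma>) z = (- 1) * winding_number \<gamma> z"
        using winding_number_reversepath[OF surrounds_inD(4)[OF V(3) \<gamma>]] by simp
    qed
    also have "\<dots> = - (\<Sum>\<gamma>\<leftarrow>\<Delta>. winding_number \<gamma> z)"
      unfolding sum_list_const_mult by simp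
    finally have rev: "(\<Sum>\<gamma>\<leftarrow>\<Delta>. winding_number (reversepath \<gamma>) z) = - (\<Sum>\<gamma>\<leftarrow>\<Delta>. winding_number \<gamma> z)" .
    have "(\<Sum>\<gamma>\<leftarrow>\<Gamma>. winding_number \<gamma> z) = (\<Sum>\<gamma>\<leftarrow>\<Delta>. winding_number \<gamma> z)"
      using z U(2,3) V(2,3) unfolding surrounds_in_def by (cases "z \<in> K") auto
    then show "(\<Sum>\<gamma>\<leftarrow>?\<Lambda>. winding_number \<gamma> z) = 0"
      by (simp add: o_def rev)
  qed
  moreover have "(\<Sum>\<gamma>\<leftarrow>\<Delta>. contour_integral (reversepath \<gamma>) g) = (\<Sum>\<gamma>\<leftarrow>\<Delta>. (- 1) * contour_integral \<gamma> g)"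
    using surrounds_inD(1)[OF V(3)]
    by (intro arg_cong[where f = sum_list] map_cong refl) (simp add: contour_integral_reversepath)
  moreover have "(\<Sum>\<gamma>\<leftarrow>\<Delta>. (- 1) * contour_integral \<gamma> g) = - (\<Sum>\<gamma>\<leftarrow>\<Delta>. contour_integral \<gamma> g)"
    unfolding sum_list_const_mult by simp
  ultimately show ?thesis by (simp add: o_def)
qed

definition resolvent_integral :: "('a :: complex_normed_vector \<Rightarrow>\<^sub>C\<^sub>L 'a) \<Rightarrow> (real \<Rightarrow> complex) list \<Rightarrow> (complex \<Rightarrow> complex) \<Rightarrow>
    (('a \<Rightarrow>\<^sub>C\<^sub>L 'a) \<Rightarrow> complex) \<Rightarrow> complex" where
  "resolvent_integral T \<Gamma> f \<phi> =
     1 / (2 * of_real pi * \<i>) * (\<Sum>\<gamma>\<leftarrow>\<Gamma>. contour_integral \<gamma> (\<lambda>z. f z * \<phi> (resolvent T z)))"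

lemma functional_sum_list:
  fixes \<phi> :: "'b :: complex_normed_vector \<Rightarrow> complex"
  assumes "bounded_clinear \<phi>"
  shows "\<phi> (\<Sum>x\<leftarrow>xs. f x) = (\<Sum>x\<leftarrow>xs. \<phi> (f x))"
  by (induction xs) (simp_all add: functional_linear[OF assms])

text \<open>Frees the calculus from its choice operator: all later arguments pick the neighbourhood
  and the cycle that suit them.\<close>

theorem functional_hol_calculus:
  fixes T :: "'a :: complex_banach \<Rightarrow>\<^sub>C\<^sub>L 'a" and \<phi> :: "('a \<Rightarrow>\<^sub>C\<^sub>L 'a) \<Rightarrow> complex"
  assumes U: "open U" "spectrum T \<subseteq> U" "f holomorphic_on U" "surrounds_in \<Gamma> (spectrum T) U"
    and \<phi>: "bounded_clinear \<phi>"
  shows "\<phi> (hol_calculus f T) = resolvent_integral T \<Gamma> f \<phi>"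
proof -
  define P where "P \<Gamma> \<longleftrightarrow> (\<exists>U. open U \<and> spectrum T \<subseteq> U \<and> f holomorphic_on U \<and> surrounds_in \<Gamma> (spectrum T) U)" for \<Gamma>
  define \<Gamma>0 where "\<Gamma>0 = (SOME \<Gamma>. P \<Gamma>)"
  have "P \<Gamma>0" unfolding \<Gamma>0_def by (rule someI[of P \<Gamma>]) (use U in \<open>auto simp: P_def\<close>)
  then obtain V where V: "open V" "spectrum T \<subseteq> V" "f holomorphic_on V" "surrounds_in \<Gamma>0 (spectrum T) V"
    unfolding P_def by blast
  have op: "open (V - spectrum T)" using V(1) closed_spectrum by (rule open_Diff)
  have "\<phi> (hol_calculus f T) = 1 / (2 * of_real pi * \<i>) *
      (\<Sum>\<gamma>\<leftarrow>\<Gamma>0. \<phi> (vector_contour_integral \<gamma> (\<lambda>z. f z *\<^sub>C resolvent T z)))"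
    unfolding hol_calculus_def P_def[symmetric] \<Gamma>0_def[symmetric] Let_def functional_linear(4)[OF \<phi>]
      functional_sum_list[OF \<phi>] resolvent_def ..
  also have "(\<Sum>\<gamma>\<leftarrow>\<Gamma>0. \<phi> (vector_contour_integral \<gamma> (\<lambda>z. f z *\<^sub>C resolvent T z))) =
      (\<Sum>\<gamma>\<leftarrow>\<Gamma>0. contour_integral \<gamma> (\<lambda>z. f z * \<phi> (resolvent T z)))"
  proof (intro arg_cong[where f = sum_list] map_cong refl)
    fix \<gamma> assume \<gamma>: "\<gamma> \<in> set \<Gamma>0"
    show "\<phi> (vector_contour_integral \<gamma> (\<lambda>z. f z *\<^sub>C resolvent T z)) = contour_integral \<gamma> (\<lambda>z. f z * \<phi> (resolvent T z))"
      using functional_vector_contour_integral[OF op weakly_holomorphic_scaleC_resolvent[OF V(3)]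
          surrounds_inD(1,3)[OF V(4) \<gamma>] \<phi>]
      by (simp add: functional_linear(4)[OF \<phi>])
  qed
  also have "\<dots> = (\<Sum>\<gamma>\<leftarrow>\<Gamma>. contour_integral \<gamma> (\<lambda>z. f z * \<phi> (resolvent T z)))"
  proof (rule surrounding_cycle_independent[OF V(1,2,4) U(1,2,4) closed_spectrum])
    have "f holomorphic_on V \<union> U" using V U by (intro holomorphic_on_Un)
    then show "(\<lambda>z. f z * \<phi> (resolvent T z)) holomorphic_on V \<union> U - spectrum T"
      by (intro holomorphic_on_mult holomorphic_on_subset[OF functional_resolvent_holomorphic[OF \<phi>]])
        (blast intro: holomorphic_on_subset)+
  qed
  finally show ?thesis by (simp add: resolvent_integral_def)
qed

section \<open>Linearity and multiplicativity of the calculus\<close>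

lemma analytic_on_neighbourhood:
  assumes "f analytic_on K" "g analytic_on K"
  obtains U where "open U" "K \<subseteq> U" "f holomorphic_on U" "g holomorphic_on U"
proof -
  obtain U V where "open U" "K \<subseteq> U" "f holomorphic_on U" "open V" "K \<subseteq> V" "g holomorphic_on V"
    using assms unfolding analytic_on_holomorphic by blast
  then show thesis
    using that[of "U \<inter> V"] by (meson Int_lower1 Int_lower2 holomorphic_on_subset le_inf_iff open_Int)
qed

lemma calculus_cycle:
  fixes T :: "'a :: complex_banach \<Rightarrow>\<^sub>C\<^sub>L 'a"
  assumes "open U" "spectrum T \<subseteq> U"
  obtains \<Gamma> where "surrounds_in \<Gamma> (spectrum T) U" "\<And>\<gamma>. \<gamma> \<in> set \<Gamma> \<Longrightarrow> smooth_loop \<gamma>"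
  by (rule exists_surrounding_cycle[OF assms(1) compact_spectrum assms(2)]) (rule that)

lemma resolvent_integrand_integrable:
  fixes T :: "'a :: complex_banach \<Rightarrow>\<^sub>C\<^sub>L 'a" and \<phi> :: "('a \<Rightarrow>\<^sub>C\<^sub>L 'a) \<Rightarrow> complex"
  assumes f: "f holomorphic_on U" and \<Gamma>: "surrounds_in \<Gamma> (spectrum T) U" and \<gamma>: "\<gamma> \<in> set \<Gamma>" "smooth_loop \<gamma>"
    and \<phi>: "bounded_clinear \<phi>"
  shows "(\<lambda>z. f z * \<phi> (resolvent T z)) contour_integrable_on \<gamma>"
proof (rule smooth_loop_contour_integrable[OF \<gamma>(2)])
  have "(\<lambda>z. f z * \<phi> (resolvent T z)) holomorphic_on U - spectrum T"
    using f by (intro holomorphic_on_mult holomorphic_on_subset[OF functional_resolvent_holomorphic[OF \<phi>]])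
      (blast intro: holomorphic_on_subset)+
  then show "continuous_on (path_image \<gamma>) (\<lambda>z. f z * \<phi> (resolvent T z))"
    using surrounds_inD(3)[OF \<Gamma> \<gamma>(1)] holomorphic_on_imp_continuous_on continuous_on_subset by blast
qed

lemma hol_calculus_add:
  fixes T :: "'a :: complex_banach \<Rightarrow>\<^sub>C\<^sub>L 'a"
  assumes f: "f analytic_on spectrum T" and g: "g analytic_on spectrum T"
  shows "hol_calculus (\<lambda>z. f z + g z) T = hol_calculus f T + hol_calculus g T"
proof (rule functionals_separate)
  fix \<phi> :: "('a \<Rightarrow>\<^sub>C\<^sub>L 'a) \<Rightarrow> complex" assume \<phi>: "bounded_clinear \<phi>"
  obtain U where U: "open U" "spectrum T \<subseteq> U" "f holomorphic_on U" "g holomorphic_on U"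
    using analytic_on_neighbourhood[OF f g] by blast
  obtain \<Gamma> where \<Gamma>: "surrounds_in \<Gamma> (spectrum T) U" "\<And>\<gamma>. \<gamma> \<in> set \<Gamma> \<Longrightarrow> smooth_loop \<gamma>"
    using calculus_cycle[OF U(1,2)] by blast
  have "(\<Sum>\<gamma>\<leftarrow>\<Gamma>. contour_integral \<gamma> (\<lambda>z. (f z + g z) * \<phi> (resolvent T z))) =
      (\<Sum>\<gamma>\<leftarrow>\<Gamma>. contour_integral \<gamma> (\<lambda>z. f z * \<phi> (resolvent T z)) + contour_integral \<gamma> (\<lambda>z. g z * \<phi> (resolvent T z)))"
  proof (intro arg_cong[where f = sum_list] map_cong refl)
    fix \<gamma> assume \<gamma>: "\<gamma> \<in> set \<Gamma>"
    show "contour_integral \<gamma> (\<lambda>z. (f z + g z) * \<phi> (resolvent T z)) =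
        contour_integral \<gamma> (\<lambda>z. f z * \<phi> (resolvent T z)) + contour_integral \<gamma> (\<lambda>z. g z * \<phi> (resolvent T z))"
      unfolding distrib_right
      by (rule contour_integral_add) (rule resolvent_integrand_integrable[OF _ \<Gamma>(1) \<gamma> \<Gamma>(2)[OF \<gamma>] \<phi>], rule U)+
  qed
  then show "\<phi> (hol_calculus (\<lambda>z. f z + g z) T) = \<phi> (hol_calculus f T + hol_calculus g T)"
    unfolding functional_linear(1)[OF \<phi>] functional_hol_calculus[OF U(1,2,3) \<Gamma>(1) \<phi>] functional_hol_calculus[OF U(1,2,4) \<Gamma>(1) \<phi>]
      functional_hol_calculus[OF U(1,2) holomorphic_on_add[OF U(3,4)] \<Gamma>(1) \<phi>] resolvent_integral_def
    by (simp only: sum_list_addf distrib_left)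
qed

lemma hol_calculus_cmult:
  fixes T :: "'a :: complex_banach \<Rightarrow>\<^sub>C\<^sub>L 'a"
  assumes f: "f analytic_on spectrum T"
  shows "hol_calculus (\<lambda>z. c * f z) T = c *\<^sub>C hol_calculus f T"
proof (rule functionals_separate)
  fix \<phi> :: "('a \<Rightarrow>\<^sub>C\<^sub>L 'a) \<Rightarrow> complex" assume \<phi>: "bounded_clinear \<phi>"
  obtain U where U: "open U" "spectrum T \<subseteq> U" "f holomorphic_on U"
    using analytic_on_neighbourhood[OF f f] by blast
  obtain \<Gamma> where \<Gamma>: "surrounds_in \<Gamma> (spectrum T) U" "\<And>\<gamma>. \<gamma> \<in> set \<Gamma> \<Longrightarrow> smooth_loop \<gamma>"
    using calculus_cycle[OF U(1,2)] by blast
  have cf: "(\<lambda>z. c * f z) holomorphic_on U" by (intro holomorphic_intros U)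
  have "(\<Sum>\<gamma>\<leftarrow>\<Gamma>. contour_integral \<gamma> (\<lambda>z. c * f z * \<phi> (resolvent T z))) =
      (\<Sum>\<gamma>\<leftarrow>\<Gamma>. c * contour_integral \<gamma> (\<lambda>z. f z * \<phi> (resolvent T z)))"
  proof (intro arg_cong[where f = sum_list] map_cong refl)
    fix \<gamma> assume \<gamma>: "\<gamma> \<in> set \<Gamma>"
    show "contour_integral \<gamma> (\<lambda>z. c * f z * \<phi> (resolvent T z)) = c * contour_integral \<gamma> (\<lambda>z. f z * \<phi> (resolvent T z))"
      unfolding mult.assoc
      by (rule contour_integral_lmul) (rule resolvent_integrand_integrable[OF U(3) \<Gamma>(1) \<gamma> \<Gamma>(2)[OF \<gamma>] \<phi>])
  qed
  then show "\<phi> (hol_calculus (\<lambda>z. c * f z) T) = \<phi> (c *\<^sub>C hol_calculus f T)"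
    unfolding functional_linear(4)[OF \<phi>] functional_hol_calculus[OF U \<Gamma>(1) \<phi>] functional_hol_calculus[OF U(1,2) cf \<Gamma>(1) \<phi>]
      resolvent_integral_def by (simp add: sum_list_const_mult)
qed

lemma hol_calculus_cong:
  fixes T :: "'a :: complex_banach \<Rightarrow>\<^sub>C\<^sub>L 'a"
  assumes U: "open U" "spectrum T \<subseteq> U" "f holomorphic_on U" and eq: "\<And>z. z \<in> U \<Longrightarrow> f z = g z"
  shows "hol_calculus f T = hol_calculus g T"
proof (rule functionals_separate)
  fix \<phi> :: "('a \<Rightarrow>\<^sub>C\<^sub>L 'a) \<Rightarrow> complex" assume \<phi>: "bounded_clinear \<phi>"
  obtain \<Gamma> where \<Gamma>: "surrounds_in \<Gamma> (spectrum T) U"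
    using calculus_cycle[OF U(1,2)] by blast
  have g: "g holomorphic_on U" using U(3) eq by (rule holomorphic_transform)
  have "(\<Sum>\<gamma>\<leftarrow>\<Gamma>. contour_integral \<gamma> (\<lambda>z. f z * \<phi> (resolvent T z))) =
      (\<Sum>\<gamma>\<leftarrow>\<Gamma>. contour_integral \<gamma> (\<lambda>z. g z * \<phi> (resolvent T z)))"
    using surrounds_inD(3)[OF \<Gamma>] eq
    by (intro arg_cong[where f = sum_list] map_cong refl contour_integral_cong) auto
  then show "\<phi> (hol_calculus f T) = \<phi> (hol_calculus g T)"
    unfolding functional_hol_calculus[OF U \<Gamma> \<phi>] functional_hol_calculus[OF U(1,2) g \<Gamma> \<phi>] resolvent_integral_def by simp
qed

text \<open>After \<open>f w\<close> is subtracted from \<open>f z\<close> the singularity at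
  \<open>w\<close> is removable, so the quotient integrates to 0 and only the winding number term
  remains.\<close>

lemma Cauchy_formula_cycle:
  assumes S: "open S" and f: "f holomorphic_on S" and w: "w \<in> S"
    and \<Gamma>: "\<And>\<gamma>. \<gamma> \<in> set \<Gamma> \<Longrightarrow> smooth_loop \<gamma> \<and> path_image \<gamma> \<subseteq> S - {w}"
    and zero: "\<And>z. z \<notin> S \<Longrightarrow> (\<Sum>\<gamma>\<leftarrow>\<Gamma>. winding_number \<gamma> z) = 0"
  shows "(\<Sum>\<gamma>\<leftarrow>\<Gamma>. contour_integral \<gamma> (\<lambda>z. f z / (z - w))) = 2 * of_real pi * \<i> * f w * (\<Sum>\<gamma>\<leftarrow>\<Gamma>. winding_number \<gamma> w)"
proof -
  define g where "g z = (if z = w then deriv f w else (f z - f w) / (z - w))" for z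
  have g: "g holomorphic_on S"
    unfolding g_def[abs_def] by (rule pole_lemma_open[OF f S])
  have "(\<Sum>\<gamma>\<leftarrow>\<Gamma>. contour_integral \<gamma> g) = 0"
    by (rule Cauchy_cycle[OF S g _ zero]) (use \<Gamma> in \<open>auto simp: smooth_loop_def\<close>)
  moreover have "(\<Sum>\<gamma>\<leftarrow>\<Gamma>. contour_integral \<gamma> (\<lambda>z. f z / (z - w))) =
      (\<Sum>\<gamma>\<leftarrow>\<Gamma>. contour_integral \<gamma> g + (2 * of_real pi * \<i> * f w) * winding_number \<gamma> w)"
  proof (intro arg_cong[where f = sum_list] map_cong refl)
    fix \<gamma> assume \<gamma>: "\<gamma> \<in> set \<Gamma>"
    have int: "g contour_integrable_on \<gamma>" "(\<lambda>z. 1 / (z - w)) contour_integrable_on \<gamma>"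
      using \<Gamma>[OF \<gamma>] holomorphic_on_imp_continuous_on[OF g]
      by (intro smooth_loop_contour_integrable; force intro!: continuous_intros intro: continuous_on_subset)+
    have "contour_integral \<gamma> (\<lambda>z. f z / (z - w)) = contour_integral \<gamma> (\<lambda>z. g z + f w * (1 / (z - w)))"
      using \<Gamma>[OF \<gamma>] by (intro contour_integral_cong) (auto simp: g_def diff_divide_distrib)
    also have "\<dots> = contour_integral \<gamma> g + f w * contour_integral \<gamma> (\<lambda>z. 1 / (z - w))"
      using int by (simp add: contour_integral_add contour_integral_lmul contour_integrable_lmul del: times_divide_eq_right)
    also have "contour_integral \<gamma> (\<lambda>z. 1 / (z - w)) = 2 * of_real pi * \<i> * winding_number \<gamma> w"
      using \<Gamma>[OF \<gamma>] by (intro winding_number_smooth_loop) auto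
    finally show "contour_integral \<gamma> (\<lambda>z. f z / (z - w)) = contour_integral \<gamma> g + (2 * of_real pi * \<i> * f w) * winding_number \<gamma> w"
      by (simp add: mult_ac)
  qed
  ultimately show ?thesis by (simp only: sum_list_addf sum_list_const_mult) simp
qed

text \<open>The cycle for the second factor is chosen inside the first one, where the winding number is 1.
  After the resolvent identity one of the two resulting double integrals vanishes by Cauchy's theorem and the other one
  is evaluated by Cauchy's formula.\<close>

theorem hol_calculus_mult:
  fixes T :: "'a :: complex_banach \<Rightarrow>\<^sub>C\<^sub>L 'a"
  assumes f: "f analytic_on spectrum T" and g: "g analytic_on spectrum T"
  shows "hol_calculus (\<lambda>z. f z * g z) T = hol_calculus f T o\<^sub>C hol_calculus g T"
proof (rule functionals_separate)
  fix \<phi> :: "('a \<Rightarrow>\<^sub>C\<^sub>L 'a) \<Rightarrow> complex" assume \<phi>: "bounded_clinear \<phi>"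
  let ?K = "spectrum T" and ?R = "resolvent T" and ?c = "2 * of_real pi * \<i> :: complex"
  obtain U where U: "open U" "?K \<subseteq> U" "f holomorphic_on U" "g holomorphic_on U"
    using analytic_on_neighbourhood[OF f g] by blast
  obtain \<Gamma> where \<Gamma>: "surrounds_in \<Gamma> ?K U" "\<And>\<gamma>. \<gamma> \<in> set \<Gamma> \<Longrightarrow> smooth_loop \<gamma>"
    using calculus_cycle[OF U(1,2)] by blast
  define I where "I = (\<Union>\<gamma>\<in>set \<Gamma>. path_image \<gamma>)"
  define n where "n w = (\<Sum>\<gamma>\<leftarrow>\<Gamma>. winding_number \<gamma> w)" for w
  define V where "V = {w \<in> U - I. n w = 1}"
  have "compact I"
    unfolding I_def using surrounds_inD(4)[OF \<Gamma>(1)] by (intro compact_UN) (auto intro: compact_path_image)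
  then have op: "open (U - I)" using U(1) by (simp add: compact_imp_closed open_Diff)
  have "open V"
    unfolding open_contains_ball
  proof
    fix z assume z: "z \<in> V"
    then obtain e where e: "0 < e" "ball z e \<subseteq> U - I"
      using op by (auto simp: V_def open_contains_ball)
    have "n w = n z" if w: "w \<in> ball z e" for w
      unfolding n_def
    proof (intro arg_cong[where f = sum_list] map_cong refl)
      fix \<gamma> assume \<gamma>: "\<gamma> \<in> set \<Gamma>"
      have "ball z e \<inter> path_image \<gamma> = {}" using e(2) \<gamma> by (auto simp: I_def)
      then show "winding_number \<gamma> w = winding_number \<gamma> z"
        using winding_number_eq[OF surrounds_inD(4,2)[OF \<Gamma>(1) \<gamma>] w _ connected_ball] e(1) by simp
    qed
    then have "ball z e \<subseteq> V" using z e(2) by (auto simp: V_def)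
    then show "\<exists>e>0. ball z e \<subseteq> V" using e(1) by blast
  qed
  have "?K \<subseteq> V"
    using \<Gamma>(1) U(2) unfolding V_def I_def n_def surrounds_in_def by blast
  have "V \<subseteq> U" by (auto simp: V_def)
  have gV: "g holomorphic_on V" and fV: "f holomorphic_on V"
    using U(3,4) \<open>V \<subseteq> U\<close> holomorphic_on_subset by blast+
  obtain \<Delta> where \<Delta>: "surrounds_in \<Delta> ?K V" "\<And>\<gamma>. \<gamma> \<in> set \<Delta> \<Longrightarrow> smooth_loop \<gamma>"
    using calculus_cycle[OF \<open>open V\<close> \<open>?K \<subseteq> V\<close>] by blast
  have z_not_V: "z \<notin> V" "z \<notin> ?K" if "\<gamma> \<in> set \<Gamma>" "z \<in> path_image \<gamma>" for \<gamma> z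
    using that surrounds_inD(3)[OF \<Gamma>(1)] by (auto simp: V_def I_def)
  have w_in_V: "w \<in> V" "w \<notin> ?K" if "\<delta> \<in> set \<Delta>" "w \<in> path_image \<delta>" for \<delta> w
    using that surrounds_inD(3)[OF \<Delta>(1)] by auto
  define q where "q w = g w * \<phi> (?R w)" for w
  have q_cont: "continuous_on (path_image \<delta>) q" if \<delta>: "\<delta> \<in> set \<Delta>" for \<delta>
  proof -
    have "q holomorphic_on V - ?K"
      unfolding q_def[abs_def]
      by (intro holomorphic_on_mult holomorphic_on_subset[OF functional_resolvent_holomorphic[OF \<phi>]] holomorphic_on_subset[OF gV]) auto
    then show ?thesis
      using surrounds_inD(3)[OF \<Delta>(1) \<delta>] holomorphic_on_imp_continuous_on continuous_on_subset by blast
  qed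
  have g_cont: "continuous_on (path_image \<delta>) g" if \<delta>: "\<delta> \<in> set \<Delta>" for \<delta>
    using holomorphic_on_imp_continuous_on[OF gV] w_in_V(1)[OF \<delta>] by (blast intro: continuous_on_subset)
  have f_cont: "continuous_on (path_image \<gamma>) f" if \<gamma>: "\<gamma> \<in> set \<Gamma>" for \<gamma>
    using holomorphic_on_imp_continuous_on[OF U(3)] surrounds_inD(3)[OF \<Gamma>(1) \<gamma>] by (blast intro: continuous_on_subset)
  have q_int: "(\<lambda>w. q w / (w - z)) contour_integrable_on \<delta>" and g_int: "(\<lambda>w. g w / (w - z)) contour_integrable_on \<delta>"
    if \<delta>: "\<delta> \<in> set \<Delta>" and z: "z \<notin> V" for z \<delta>
  proof -
    have "w \<noteq> z" if "w \<in> path_image \<delta>" for w using w_in_V(1)[OF \<delta> that] z by blast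
    then show "(\<lambda>w. q w / (w - z)) contour_integrable_on \<delta>" "(\<lambda>w. g w / (w - z)) contour_integrable_on \<delta>"
      using q_cont[OF \<delta>] g_cont[OF \<delta>] by (intro smooth_loop_contour_integrable[OF \<Delta>(2)[OF \<delta>]] continuous_intros; auto)+
  qed
  have inner: "\<phi> (?R z o\<^sub>C hol_calculus g T) = - (1 / ?c) * (\<Sum>\<delta>\<leftarrow>\<Delta>. contour_integral \<delta> (\<lambda>w. q w / (w - z)))"
    if \<gamma>: "\<gamma> \<in> set \<Gamma>" and z: "z \<in> path_image \<gamma>" for \<gamma> z
  proof -
    note zV = z_not_V[OF \<gamma> z]
    have "bounded_clinear (\<lambda>B. \<phi> (?R z o\<^sub>C B))"
      by (rule bounded_clinear_compose[OF \<phi> bounded_clinear_compose_right])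
    from functional_hol_calculus[OF \<open>open V\<close> \<open>?K \<subseteq> V\<close> gV \<Delta>(1) this]
    have "\<phi> (?R z o\<^sub>C hol_calculus g T) = 1 / ?c * (\<Sum>\<delta>\<leftarrow>\<Delta>. contour_integral \<delta> (\<lambda>w. g w * \<phi> (?R z o\<^sub>C ?R w)))"
      by (simp add: resolvent_integral_def)
    also have "(\<Sum>\<delta>\<leftarrow>\<Delta>. contour_integral \<delta> (\<lambda>w. g w * \<phi> (?R z o\<^sub>C ?R w))) =
        (\<Sum>\<delta>\<leftarrow>\<Delta>. \<phi> (?R z) * contour_integral \<delta> (\<lambda>w. g w / (w - z)) + (- 1) * contour_integral \<delta> (\<lambda>w. q w / (w - z)))"
    proof (intro arg_cong[where f = sum_list] map_cong refl)
      fix \<delta> assume \<delta>: "\<delta> \<in> set \<Delta>"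
      have "contour_integral \<delta> (\<lambda>w. g w * \<phi> (?R z o\<^sub>C ?R w)) = contour_integral \<delta> (\<lambda>w. \<phi> (?R z) * (g w / (w - z)) - q w / (w - z))"
      proof (rule contour_integral_cong[OF refl])
        fix w assume w: "w \<in> path_image \<delta>"
        have "w \<noteq> z" using w_in_V(1)[OF \<delta> w] zV by blast
        moreover have "\<phi> (?R z) - \<phi> (?R w) = (w - z) * \<phi> (?R z o\<^sub>C ?R w)"
          using resolvent_identity[OF zV(2) w_in_V(2)[OF \<delta> w]] functional_linear(2,4)[OF \<phi>] by metis
        ultimately have eq: "\<phi> (?R z o\<^sub>C ?R w) = (\<phi> (?R z) - \<phi> (?R w)) / (w - z)"
          by (simp add: field_simps)
        show "g w * \<phi> (?R z o\<^sub>C ?R w) = \<phi> (?R z) * (g w / (w - z)) - q w / (w - z)"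
          unfolding eq q_def by (simp add: diff_divide_distrib right_diff_distrib mult.commute)
      qed
      also have "\<dots> = \<phi> (?R z) * contour_integral \<delta> (\<lambda>w. g w / (w - z)) - contour_integral \<delta> (\<lambda>w. q w / (w - z))"
        using q_int[OF \<delta> zV(1)] g_int[OF \<delta> zV(1)]
        by (simp add: contour_integral_diff contour_integral_lmul contour_integrable_lmul del: times_divide_eq_right)
      finally show "contour_integral \<delta> (\<lambda>w. g w * \<phi> (?R z o\<^sub>C ?R w)) =
        \<phi> (?R z) * contour_integral \<delta> (\<lambda>w. g w / (w - z)) + (- 1) * contour_integral \<delta> (\<lambda>w. q w / (w - z))"
        by simp
    qed
    also have "\<dots> = \<phi> (?R z) * (\<Sum>\<delta>\<leftarrow>\<Delta>. contour_integral \<delta> (\<lambda>w. g w / (w - z))) - (\<Sum>\<delta>\<leftarrow>\<Delta>. contour_integral \<delta> (\<lambda>w. q w / (w - z)))"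
      unfolding sum_list_addf sum_list_const_mult by simp
    \<comment> \<open>\<open>z\<close> lies on the outer cycle and hence outside \<open>V\<close>,
      so the integrand is holomorphic on all of \<open>V\<close>, the spectrum included.\<close>
    also have "(\<Sum>\<delta>\<leftarrow>\<Delta>. contour_integral \<delta> (\<lambda>w. g w / (w - z))) = 0"
    proof (rule Cauchy_cycle[OF \<open>open V\<close>])
      show "(\<lambda>w. g w / (w - z)) holomorphic_on V"
        using zV(1) by (intro holomorphic_intros gV) auto
      show "valid_path \<gamma> \<and> pathfinish \<gamma> = pathstart \<gamma> \<and> path_image \<gamma> \<subseteq> V" if "\<gamma> \<in> set \<Delta>" for \<gamma>
        using surrounds_inD[OF \<Delta>(1) that] by blast
      show "(\<Sum>\<gamma>\<leftarrow>\<Delta>. winding_number \<gamma> z) = 0" if "z \<notin> V" for z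
        using \<Delta>(1) that unfolding surrounds_in_def by blast
    qed
    finally show ?thesis by simp
  qed
  have double: "contour_integral \<gamma> (\<lambda>z. f z * contour_integral \<delta> (\<lambda>w. q w / (w - z))) =
      - contour_integral \<delta> (\<lambda>w. q w * contour_integral \<gamma> (\<lambda>z. f z / (z - w)))"
    if \<gamma>: "\<gamma> \<in> set \<Gamma>" and \<delta>: "\<delta> \<in> set \<Delta>" for \<gamma> \<delta>
  proof -
    have ne: "w \<noteq> z" if "z \<in> path_image \<gamma>" "w \<in> path_image \<delta>" for z w
      using z_not_V(1)[OF \<gamma> that(1)] w_in_V(1)[OF \<delta> that(2)] by blast
    have "contour_integral \<gamma> (\<lambda>z. f z * contour_integral \<delta> (\<lambda>w. q w / (w - z))) =
        contour_integral \<gamma> (\<lambda>z. contour_integral \<delta> (\<lambda>w. f z * (q w / (w - z))))"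
      using q_int[OF \<delta>] z_not_V(1)[OF \<gamma>]
      by (intro contour_integral_cong refl) (simp add: contour_integral_lmul del: times_divide_eq_right)
    also have "\<dots> = contour_integral \<delta> (\<lambda>w. contour_integral \<gamma> (\<lambda>z. f z * (q w / (w - z))))"
    proof (rule smooth_loop_swap[OF \<Gamma>(2)[OF \<gamma>] \<Delta>(2)[OF \<delta>]])
      have "continuous_on (path_image \<gamma> \<times> path_image \<delta>) (\<lambda>p. f (fst p) * (q (snd p) / (snd p - fst p)))"
        using ne by (intro continuous_intros continuous_on_compose2[OF f_cont[OF \<gamma>]] continuous_on_compose2[OF q_cont[OF \<delta>]]) auto
      then show "continuous_on (path_image \<gamma> \<times> path_image \<delta>) (\<lambda>(z, w). f z * (q w / (w - z)))"
        by (simp add: case_prod_unfold)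
    qed
    also have "\<dots> = contour_integral \<delta> (\<lambda>w. (- 1) * (q w * contour_integral \<gamma> (\<lambda>z. f z / (z - w))))"
    proof (rule contour_integral_cong[OF refl])
      fix w assume w: "w \<in> path_image \<delta>"
      have "(\<lambda>z. f z / (z - w)) contour_integrable_on \<gamma>"
        using ne[OF _ w] f_cont[OF \<gamma>] by (intro smooth_loop_contour_integrable[OF \<Gamma>(2)[OF \<gamma>]] continuous_intros) auto
      then have "contour_integral \<gamma> (\<lambda>z. (- q w) * (f z / (z - w))) = (- q w) * contour_integral \<gamma> (\<lambda>z. f z / (z - w))"
        by (rule contour_integral_lmul)
      moreover have "contour_integral \<gamma> (\<lambda>z. f z * (q w / (w - z))) = contour_integral \<gamma> (\<lambda>z. (- q w) * (f z / (z - w)))"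
      proof (rule contour_integral_cong[OF refl])
        fix z assume z: "z \<in> path_image \<gamma>"
        show "f z * (q w / (w - z)) = (- q w) * (f z / (z - w))"
          using ne[OF z w] by (simp add: divide_simps) (simp add: algebra_simps)
      qed
      ultimately show "contour_integral \<gamma> (\<lambda>z. f z * (q w / (w - z))) = (- 1) * (q w * contour_integral \<gamma> (\<lambda>z. f z / (z - w)))"
        by simp
    qed
    also have "\<dots> = (- 1) * contour_integral \<delta> (\<lambda>w. q w * contour_integral \<gamma> (\<lambda>z. f z / (z - w)))"
    proof (rule contour_integral_lmul, rule smooth_loop_contour_integrable[OF \<Delta>(2)[OF \<delta>]])
      have "continuous_on (path_image \<delta>) (\<lambda>w. contour_integral \<gamma> (\<lambda>z. f z / (z - w)))"
        using Cauchy_type_integral_holomorphic[OF \<Gamma>(2)[OF \<gamma>] f_cont[OF \<gamma>]] ne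
        by (blast intro: holomorphic_on_imp_continuous_on continuous_on_subset)
      then show "continuous_on (path_image \<delta>) (\<lambda>w. q w * contour_integral \<gamma> (\<lambda>z. f z / (z - w)))"
        by (intro continuous_on_mult q_cont[OF \<delta>])
    qed
    finally show ?thesis by simp
  qed
  have int\<gamma>: "(\<lambda>z. f z * contour_integral \<delta> (\<lambda>w. q w / (w - z))) contour_integrable_on \<gamma>"
    if \<gamma>: "\<gamma> \<in> set \<Gamma>" and \<delta>: "\<delta> \<in> set \<Delta>" for \<gamma> \<delta>
  proof (rule smooth_loop_contour_integrable[OF \<Gamma>(2)[OF \<gamma>]])
    have "path_image \<gamma> \<subseteq> - path_image \<delta>"
      using z_not_V(1)[OF \<gamma>] w_in_V(1)[OF \<delta>] by blast
    then have "continuous_on (path_image \<gamma>) (\<lambda>z. contour_integral \<delta> (\<lambda>w. q w / (w - z)))"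
      using Cauchy_type_integral_holomorphic[OF \<Delta>(2)[OF \<delta>] q_cont[OF \<delta>]]
      by (blast intro: holomorphic_on_imp_continuous_on continuous_on_subset)
    then show "continuous_on (path_image \<gamma>) (\<lambda>z. f z * contour_integral \<delta> (\<lambda>w. q w / (w - z)))"
      by (intro continuous_on_mult f_cont[OF \<gamma>])
  qed
  have int\<delta>: "(\<lambda>w. q w * contour_integral \<gamma> (\<lambda>z. f z / (z - w))) contour_integrable_on \<delta>"
    if \<gamma>: "\<gamma> \<in> set \<Gamma>" and \<delta>: "\<delta> \<in> set \<Delta>" for \<gamma> \<delta>
  proof (rule smooth_loop_contour_integrable[OF \<Delta>(2)[OF \<delta>]])
    have "path_image \<delta> \<subseteq> - path_image \<gamma>"
      using z_not_V(1)[OF \<gamma>] w_in_V(1)[OF \<delta>] by blast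
    then have "continuous_on (path_image \<delta>) (\<lambda>w. contour_integral \<gamma> (\<lambda>z. f z / (z - w)))"
      using Cauchy_type_integral_holomorphic[OF \<Gamma>(2)[OF \<gamma>] f_cont[OF \<gamma>]]
      by (blast intro: holomorphic_on_imp_continuous_on continuous_on_subset)
    then show "continuous_on (path_image \<delta>) (\<lambda>w. q w * contour_integral \<gamma> (\<lambda>z. f z / (z - w)))"
      by (intro continuous_on_mult q_cont[OF \<delta>])
  qed
  have formula: "(\<Sum>\<gamma>\<leftarrow>\<Gamma>. contour_integral \<gamma> (\<lambda>z. f z / (z - w))) = ?c * f w" if w: "w \<in> V" for w
  proof -
    have "(\<Sum>\<gamma>\<leftarrow>\<Gamma>. contour_integral \<gamma> (\<lambda>z. f z / (z - w))) = ?c * f w * (\<Sum>\<gamma>\<leftarrow>\<Gamma>. winding_number \<gamma> w)"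
    proof (rule Cauchy_formula_cycle[OF U(1,3)])
      show "w \<in> U" using w \<open>V \<subseteq> U\<close> by blast
      show "smooth_loop \<gamma> \<and> path_image \<gamma> \<subseteq> U - {w}" if \<gamma>: "\<gamma> \<in> set \<Gamma>" for \<gamma>
        using \<Gamma>(2)[OF \<gamma>] surrounds_inD(3)[OF \<Gamma>(1) \<gamma>] z_not_V(1)[OF \<gamma>] w by blast
      show "(\<Sum>\<gamma>\<leftarrow>\<Gamma>. winding_number \<gamma> z) = 0" if "z \<notin> U" for z
        using \<Gamma>(1) that unfolding surrounds_in_def by blast
    qed
    then show ?thesis using w by (simp add: V_def n_def)
  qed
  have "bounded_clinear (\<lambda>A. \<phi> (A o\<^sub>C hol_calculus g T))"
    by (rule bounded_clinear_compose[OF \<phi> bounded_clinear_compose_left])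
  from functional_hol_calculus[OF U(1,2,3) \<Gamma>(1) this]
  have "\<phi> (hol_calculus f T o\<^sub>C hol_calculus g T) =
      1 / ?c * (\<Sum>\<gamma>\<leftarrow>\<Gamma>. contour_integral \<gamma> (\<lambda>z. f z * \<phi> (?R z o\<^sub>C hol_calculus g T)))"
    by (simp add: resolvent_integral_def)
  also have "(\<Sum>\<gamma>\<leftarrow>\<Gamma>. contour_integral \<gamma> (\<lambda>z. f z * \<phi> (?R z o\<^sub>C hol_calculus g T))) =
      (\<Sum>\<gamma>\<leftarrow>\<Gamma>. (1 / ?c) * (\<Sum>\<delta>\<leftarrow>\<Delta>. contour_integral \<delta> (\<lambda>w. q w * contour_integral \<gamma> (\<lambda>z. f z / (z - w)))))"
  proof (intro arg_cong[where f = sum_list] map_cong refl)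
    fix \<gamma> assume \<gamma>: "\<gamma> \<in> set \<Gamma>"
    have "contour_integral \<gamma> (\<lambda>z. f z * \<phi> (?R z o\<^sub>C hol_calculus g T)) =
        contour_integral \<gamma> (\<lambda>z. (- (1 / ?c)) * (\<Sum>\<delta>\<leftarrow>\<Delta>. f z * contour_integral \<delta> (\<lambda>w. q w / (w - z))))"
      using inner[OF \<gamma>] by (intro contour_integral_cong refl) (simp only: sum_list_const_mult mult_ac)
    also have "\<dots> = (- (1 / ?c)) * contour_integral \<gamma> (\<lambda>z. \<Sum>\<delta>\<leftarrow>\<Delta>. f z * contour_integral \<delta> (\<lambda>w. q w / (w - z)))"
      by (rule contour_integral_lmul, rule contour_integral_sum_list(2), rule int\<gamma>[OF \<gamma>])
    also have "contour_integral \<gamma> (\<lambda>z. \<Sum>\<delta>\<leftarrow>\<Delta>. f z * contour_integral \<delta> (\<lambda>w. q w / (w - z))) =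
        (\<Sum>\<delta>\<leftarrow>\<Delta>. contour_integral \<gamma> (\<lambda>z. f z * contour_integral \<delta> (\<lambda>w. q w / (w - z))))"
      by (rule contour_integral_sum_list(1), rule int\<gamma>[OF \<gamma>])
    also have "\<dots> = (\<Sum>\<delta>\<leftarrow>\<Delta>. (- 1) * contour_integral \<delta> (\<lambda>w. q w * contour_integral \<gamma> (\<lambda>z. f z / (z - w))))"
      using double[OF \<gamma>] by (intro arg_cong[where f = sum_list] map_cong refl) simp
    finally show "contour_integral \<gamma> (\<lambda>z. f z * \<phi> (?R z o\<^sub>C hol_calculus g T)) =
        (1 / ?c) * (\<Sum>\<delta>\<leftarrow>\<Delta>. contour_integral \<delta> (\<lambda>w. q w * contour_integral \<gamma> (\<lambda>z. f z / (z - w))))"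
      unfolding sum_list_const_mult by simp
  qed
  also have "\<dots> = (1 / ?c) * (\<Sum>\<delta>\<leftarrow>\<Delta>. \<Sum>\<gamma>\<leftarrow>\<Gamma>. contour_integral \<delta> (\<lambda>w. q w * contour_integral \<gamma> (\<lambda>z. f z / (z - w))))"
    unfolding sum_list_const_mult by (subst sum_list_interchange) (rule refl)
  also have "(\<Sum>\<delta>\<leftarrow>\<Delta>. \<Sum>\<gamma>\<leftarrow>\<Gamma>. contour_integral \<delta> (\<lambda>w. q w * contour_integral \<gamma> (\<lambda>z. f z / (z - w)))) =
      (\<Sum>\<delta>\<leftarrow>\<Delta>. ?c * contour_integral \<delta> (\<lambda>w. f w * g w * \<phi> (?R w)))"
  proof (intro arg_cong[where f = sum_list] map_cong refl)
    fix \<delta> assume \<delta>: "\<delta> \<in> set \<Delta>"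
    have "(\<Sum>\<gamma>\<leftarrow>\<Gamma>. contour_integral \<delta> (\<lambda>w. q w * contour_integral \<gamma> (\<lambda>z. f z / (z - w)))) =
        contour_integral \<delta> (\<lambda>w. \<Sum>\<gamma>\<leftarrow>\<Gamma>. q w * contour_integral \<gamma> (\<lambda>z. f z / (z - w)))"
      by (rule contour_integral_sum_list(1)[symmetric], rule int\<delta>[OF _ \<delta>])
    also have "\<dots> = contour_integral \<delta> (\<lambda>w. ?c * (f w * g w * \<phi> (?R w)))"
    proof (rule contour_integral_cong[OF refl])
      fix w assume "w \<in> path_image \<delta>"
      then show "(\<Sum>\<gamma>\<leftarrow>\<Gamma>. q w * contour_integral \<gamma> (\<lambda>z. f z / (z - w))) = ?c * (f w * g w * \<phi> (?R w))"
        unfolding sum_list_const_mult formula[OF w_in_V(1)[OF \<delta> \<open>w \<in> path_image \<delta>\<close>]] by (simp add: q_def)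
    qed
    also have "\<dots> = ?c * contour_integral \<delta> (\<lambda>w. f w * g w * \<phi> (?R w))"
      by (rule contour_integral_lmul)
        (rule resolvent_integrand_integrable[OF holomorphic_on_mult[OF fV gV] \<Delta>(1) \<delta> \<Delta>(2)[OF \<delta>] \<phi>])
    finally show "(\<Sum>\<gamma>\<leftarrow>\<Gamma>. contour_integral \<delta> (\<lambda>w. q w * contour_integral \<gamma> (\<lambda>z. f z / (z - w)))) =
      ?c * contour_integral \<delta> (\<lambda>w. f w * g w * \<phi> (?R w))" .
  qed
  finally have "\<phi> (hol_calculus f T o\<^sub>C hol_calculus g T) =
      1 / ?c * (\<Sum>\<delta>\<leftarrow>\<Delta>. contour_integral \<delta> (\<lambda>w. f w * g w * \<phi> (?R w)))"
    unfolding sum_list_const_mult by simp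
  then show "\<phi> (hol_calculus (\<lambda>z. f z * g z) T) = \<phi> (hol_calculus f T o\<^sub>C hol_calculus g T)"
    using functional_hol_calculus[OF \<open>open V\<close> \<open>?K \<subseteq> V\<close> holomorphic_on_mult[OF fV gV] \<Delta>(1) \<phi>]
    by (simp add: resolvent_integral_def)
qed

section \<open>The calculus for constants and for the identity function\<close>

lemma norm_resolvent_le:
  fixes T :: "'a :: complex_banach \<Rightarrow>\<^sub>C\<^sub>L 'a"
  assumes z: "norm T < cmod z"
  shows "norm (resolvent T z) \<le> 1 / (cmod z - norm T)"
proof (rule norm_cblinfun_bound)
  fix x
  let ?y = "resolvent T z x"
  have "z *\<^sub>C ?y = x + T ?y"
    using resolvent_apply(1)[OF norm_less_not_in_spectrum[OF z], of x] by (simp add: algebra_simps)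
  then have "cmod z * norm ?y = norm (x + T ?y)"
    by (simp flip: norm_scaleC)
  then have "cmod z * norm ?y \<le> norm x + norm T * norm ?y"
    using norm_triangle_ineq[of x "T ?y"] norm_apply[of T ?y] by linarith
  then show "norm ?y \<le> 1 / (cmod z - norm T) * norm x"
    using z by (simp add: field_simps)
qed (use z in simp)

lemma surrounds_in_circlepath:
  fixes T :: "'a :: complex_banach \<Rightarrow>\<^sub>C\<^sub>L 'a"
  assumes r: "norm T < r"
  shows "surrounds_in [circlepath 0 r] (spectrum T) UNIV"
proof -
  have "0 < r" using r norm_ge_zero[of T] by linarith
  have "cmod z < r" if "z \<in> spectrum T" for z
    using norm_less_not_in_spectrum[of T z] that r by linarith
  moreover from this have "sphere 0 r \<inter> spectrum T = {}" by fastforce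
  ultimately show ?thesis
    using \<open>0 < r\<close> unfolding surrounds_in_def
    by (auto simp: winding_number_circlepath)
qed

text \<open>On a large circle the resolvent is compared with \<open>1 / z\<close>: the difference is
  the resolvent composed with \<open>T\<close>, divided by \<open>z\<close>, and decays like the
  inverse square of the radius, so its integral tends to 0.\<close>

lemma hol_calculus_one:
  fixes T :: "'a :: complex_banach \<Rightarrow>\<^sub>C\<^sub>L 'a"
  shows "hol_calculus (\<lambda>z. 1) T = id_cblinfun"
proof (rule functionals_separate)
  fix \<phi> :: "('a \<Rightarrow>\<^sub>C\<^sub>L 'a) \<Rightarrow> complex" assume \<phi>: "bounded_clinear \<phi>"
  let ?c = "2 * of_real pi * \<i> :: complex" and ?R = "resolvent T"
  obtain C where C: "0 \<le> C" "\<And>x. norm (\<phi> x) \<le> norm x * C"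
    using bounded_linear.nonneg_bounded[OF bounded_clinear_linear[OF \<phi>]] by blast
  define a where "a = norm (?c * (\<phi> (hol_calculus (\<lambda>z. 1) T) - \<phi> id_cblinfun))"
  have bound: "a * (r - norm T) \<le> 2 * pi * (C * norm T)" if r: "norm T < r" for r
  proof -
    have "0 < r" using r norm_ge_zero[of T] by linarith
    have \<Gamma>: "surrounds_in [circlepath 0 r] (spectrum T) UNIV" by (rule surrounds_in_circlepath[OF r])
    have "\<phi> (hol_calculus (\<lambda>z. 1) T) = resolvent_integral T [circlepath 0 r] (\<lambda>z. 1) \<phi>"
      by (rule functional_hol_calculus[OF open_UNIV subset_UNIV holomorphic_on_const \<Gamma> \<phi>])
    then have val: "?c * \<phi> (hol_calculus (\<lambda>z. 1) T) = contour_integral (circlepath 0 r) (\<lambda>z. \<phi> (?R z))"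
      by (simp add: resolvent_integral_def)
    have img: "path_image (circlepath 0 r) \<subseteq> - spectrum T"
      using surrounds_inD(3)[OF \<Gamma>, of "circlepath 0 r"] by auto
    have op: "open (- spectrum T)" using closed_spectrum by blast
    have i1: "((\<lambda>z. \<phi> (?R z)) has_contour_integral ?c * \<phi> (hol_calculus (\<lambda>z. 1) T)) (circlepath 0 r)"
      unfolding val
      by (intro has_contour_integral_integral contour_integrable_holomorphic_simple[OF functional_resolvent_holomorphic[OF \<phi>] op _ img]) simp
    have "((\<lambda>z. \<phi> id_cblinfun / (z - 0) ) has_contour_integral (2 * of_real pi * \<i> * \<phi> id_cblinfun)) (circlepath 0 r)"
      by (rule Cauchy_integral_circlepath_simple[where f = "\<lambda>_. \<phi> id_cblinfun"]) (use \<open>0 < r\<close> in auto)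
    from has_contour_integral_diff[OF i1 this]
    have i2: "((\<lambda>z. \<phi> (?R z) - \<phi> id_cblinfun / z) has_contour_integral
        (?c * (\<phi> (hol_calculus (\<lambda>z. 1) T) - \<phi> id_cblinfun))) (circlepath 0 r)"
      by (simp add: algebra_simps)
    let ?B = "C * norm T / (r * (r - norm T))"
    have "a \<le> ?B * (2 * pi * r)"
      unfolding a_def
    proof (rule has_contour_integral_bound_circlepath[OF i2])
      show "0 \<le> ?B" using C(1) r \<open>0 < r\<close> by simp
      fix z :: complex assume "cmod (z - 0) = r"
      then have z: "cmod z = r" "z \<noteq> 0" "z \<notin> spectrum T"
        using \<open>0 < r\<close> r norm_less_not_in_spectrum[of T z] by auto
      have "z *\<^sub>C ?R z = id_cblinfun + T o\<^sub>C ?R z"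
        using resolvent_apply(1)[OF z(3)] by (intro cblinfun_eqI) (simp add: algebra_simps)
      then have "z * \<phi> (?R z) = \<phi> id_cblinfun + \<phi> (T o\<^sub>C ?R z)"
        using functional_linear(1,4)[OF \<phi>] by metis
      then have "\<phi> (?R z) - \<phi> id_cblinfun / z = \<phi> (T o\<^sub>C ?R z) / z"
        using z(2) by (simp add: field_simps)
      then have "norm (\<phi> (?R z) - \<phi> id_cblinfun / z) = norm (\<phi> (T o\<^sub>C ?R z)) / r"
        using z(1) by (simp add: norm_divide)
      also have "\<dots> \<le> (norm T * (1 / (r - norm T)) * C) / r"
      proof (rule divide_right_mono)
        have "norm (T o\<^sub>C ?R z) \<le> norm T * (1 / (r - norm T))"
          using norm_resolvent_le[of T z] r z(1) by (intro order_trans[OF norm_compose] mult_left_mono) auto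
        then show "norm (\<phi> (T o\<^sub>C ?R z)) \<le> norm T * (1 / (r - norm T)) * C"
          using C(2)[of "T o\<^sub>C ?R z"] mult_right_mono[OF _ C(1)] order_trans by blast
      qed (use \<open>0 < r\<close> in simp)
      finally show "norm (\<phi> (?R z) - \<phi> id_cblinfun / z) \<le> ?B"
        by (simp add: field_simps)
    qed (use \<open>0 < r\<close> in simp)
    also have "\<dots> = 2 * pi * (C * norm T) / (r - norm T)"
      using \<open>0 < r\<close> by simp
    finally show ?thesis using r by (simp add: pos_le_divide_eq)
  qed
  have "a = 0"
  proof (rule ccontr)
    assume "a \<noteq> 0"
    then have "0 < a" by (simp add: a_def)
    define M where "M = 2 * pi * (C * norm T)"
    have "0 \<le> M" using C(1) by (simp add: M_def)
    \<comment> \<open>At this radius the bound would say that \<open>M + 1\<close> is at most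
      \<open>M\<close>.\<close>
    then have "norm T < norm T + (M + 1) / a" using \<open>0 < a\<close> by simp
    from bound[OF this] show False using \<open>0 < a\<close> by (simp add: M_def[symmetric])
  qed
  then show "\<phi> (hol_calculus (\<lambda>z. 1) T) = \<phi> id_cblinfun"
    by (simp add: a_def)
qed

lemma hol_calculus_const:
  fixes T :: "'a :: complex_banach \<Rightarrow>\<^sub>C\<^sub>L 'a"
  shows "hol_calculus (\<lambda>z. c) T = c *\<^sub>C id_cblinfun"
  using hol_calculus_cmult[of "\<lambda>z. 1" T c] by (simp add: hol_calculus_one analytic_on_const)

text \<open>\<open>z\<close> times the resolvent is the identity plus \<open>T\<close> composed with
  the resolvent. The constant part integrates to 0 over a closed cycle, which reduces the claim to
  \<open>hol_calculus_one\<close>.\<close>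

lemma hol_calculus_ident:
  fixes T :: "'a :: complex_banach \<Rightarrow>\<^sub>C\<^sub>L 'a"
  shows "hol_calculus (\<lambda>z. z) T = T"
proof (rule functionals_separate)
  fix \<phi> :: "('a \<Rightarrow>\<^sub>C\<^sub>L 'a) \<Rightarrow> complex" assume \<phi>: "bounded_clinear \<phi>"
  let ?R = "resolvent T"
  obtain \<Gamma> where \<Gamma>: "surrounds_in \<Gamma> (spectrum T) UNIV" "\<And>\<gamma>. \<gamma> \<in> set \<Gamma> \<Longrightarrow> smooth_loop \<gamma>"
    using calculus_cycle[OF open_UNIV subset_UNIV] by blast
  define \<psi> where "\<psi> A = \<phi> (T o\<^sub>C A)" for A
  have \<psi>: "bounded_clinear \<psi>"
    unfolding \<psi>_def[abs_def] by (rule bounded_clinear_compose[OF \<phi> bounded_clinear_compose_right])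
  have zero: "(\<Sum>\<gamma>\<leftarrow>\<Gamma>. contour_integral \<gamma> (\<lambda>z. \<phi> id_cblinfun)) = 0"
    by (rule Cauchy_cycle[OF open_UNIV holomorphic_on_const]) (use surrounds_inD[OF \<Gamma>(1)] in auto)
  have "(\<Sum>\<gamma>\<leftarrow>\<Gamma>. contour_integral \<gamma> (\<lambda>z. z * \<phi> (?R z))) =
      (\<Sum>\<gamma>\<leftarrow>\<Gamma>. contour_integral \<gamma> (\<lambda>z. \<phi> id_cblinfun) + contour_integral \<gamma> (\<lambda>z. 1 * \<psi> (?R z)))"
  proof (intro arg_cong[where f = sum_list] map_cong refl)
    fix \<gamma> assume \<gamma>: "\<gamma> \<in> set \<Gamma>"
    have "contour_integral \<gamma> (\<lambda>z. z * \<phi> (?R z)) = contour_integral \<gamma> (\<lambda>z. \<phi> id_cblinfun + 1 * \<psi> (?R z))"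
    proof (rule contour_integral_cong[OF refl])
      fix z assume "z \<in> path_image \<gamma>"
      then have z: "z \<notin> spectrum T" using surrounds_inD(3)[OF \<Gamma>(1) \<gamma>] by blast
      have "z *\<^sub>C ?R z = id_cblinfun + T o\<^sub>C ?R z"
        using resolvent_apply(1)[OF z] by (intro cblinfun_eqI) (simp add: algebra_simps)
      then show "z * \<phi> (?R z) = \<phi> id_cblinfun + 1 * \<psi> (?R z)"
        unfolding \<psi>_def using functional_linear(1,4)[OF \<phi>] by (metis mult_1)
    qed
    also have "\<dots> = contour_integral \<gamma> (\<lambda>z. \<phi> id_cblinfun) + contour_integral \<gamma> (\<lambda>z. 1 * \<psi> (?R z))"
      by (rule contour_integral_add[OF smooth_loop_contour_integrable[OF \<Gamma>(2)[OF \<gamma>] continuous_on_const]])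
        (rule resolvent_integrand_integrable[OF holomorphic_on_const \<Gamma>(1) \<gamma> \<Gamma>(2)[OF \<gamma>] \<psi>])
    finally show "contour_integral \<gamma> (\<lambda>z. z * \<phi> (?R z)) = contour_integral \<gamma> (\<lambda>z. \<phi> id_cblinfun) + contour_integral \<gamma> (\<lambda>z. 1 * \<psi> (?R z))" .
  qed
  then have "\<phi> (hol_calculus (\<lambda>z. z) T) = \<psi> (hol_calculus (\<lambda>z. 1) T)"
    unfolding functional_hol_calculus[OF open_UNIV subset_UNIV holomorphic_on_ident \<Gamma>(1) \<phi>]
      functional_hol_calculus[OF open_UNIV subset_UNIV holomorphic_on_const \<Gamma>(1) \<psi>] resolvent_integral_def
    by (simp add: sum_list_addf zero)
  then show "\<phi> (hol_calculus (\<lambda>z. z) T) = \<phi> T"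
    by (simp add: hol_calculus_one \<psi>_def)
qed


section \<open>Weyl points under the functional calculus\<close>

lemma not_injective_in_spectrum:
  fixes T :: "'a :: complex_normed_vector \<Rightarrow>\<^sub>C\<^sub>L 'a"
  assumes "T x = l *\<^sub>C x" "x \<noteq> 0"
  shows "l \<in> spectrum T"
proof (rule ccontr)
  assume "l \<notin> spectrum T"
  from resolvent_apply(2)[OF this, of x] show False using assms by simp
qed

lemma hol_calculus_commute:
  fixes T :: "'a :: complex_banach \<Rightarrow>\<^sub>C\<^sub>L 'a"
  assumes "f analytic_on spectrum T" "g analytic_on spectrum T"
  shows "hol_calculus f T (hol_calculus g T x) = hol_calculus g T (hol_calculus f T x)"
proof -
  have "hol_calculus f T o\<^sub>C hol_calculus g T = hol_calculus g T o\<^sub>C hol_calculus f T"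
    using hol_calculus_mult[OF assms] hol_calculus_mult[OF assms(2,1)] by (simp add: mult.commute)
  then show ?thesis by (metis apply_compose)
qed

lemma hol_calculus_commute_self:
  fixes T :: "'a :: complex_banach \<Rightarrow>\<^sub>C\<^sub>L 'a"
  assumes "f analytic_on spectrum T"
  shows "hol_calculus f T (T x) = T (hol_calculus f T x)"
  using hol_calculus_commute[OF assms, of "\<lambda>z. z" x] by (simp add: hol_calculus_ident analytic_on_ident)

lemma hol_calculus_diff_const:
  fixes T :: "'a :: complex_banach \<Rightarrow>\<^sub>C\<^sub>L 'a"
  assumes "f analytic_on spectrum T"
  shows "hol_calculus (\<lambda>z. f z - c) T = hol_calculus f T - c *\<^sub>C id_cblinfun"
  using hol_calculus_add[OF assms, of "\<lambda>_. - c"] hol_calculus_const[of "- c" T]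
  by (simp add: analytic_on_const complex_vector.scale_minus_left)

lemma hol_calculus_factor:
  fixes T :: "'a :: complex_banach \<Rightarrow>\<^sub>C\<^sub>L 'a"
  assumes f: "f analytic_on spectrum T" and l: "l \<in> spectrum T"
  obtains g where "g analytic_on spectrum T"
    "\<And>x. (hol_calculus f T - f l *\<^sub>C id_cblinfun) x = (T - l *\<^sub>C id_cblinfun) (hol_calculus g T x)"
proof -
  obtain U where U: "open U" "spectrum T \<subseteq> U" "f holomorphic_on U"
    using analytic_on_neighbourhood[OF f f] by blast
  define g where "g z = (if z = l then deriv f l else (f z - f l) / (z - l))" for z
  have g: "g holomorphic_on U"
    unfolding g_def[abs_def] by (rule pole_lemma_open[OF U(3,1)])
  then have ga: "g analytic_on spectrum T" using U(1,2) analytic_on_holomorphic by blast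
  have id: "(\<lambda>z. z - l) analytic_on spectrum T"
    by (intro analytic_intros)
  have "(\<lambda>z. (z - l) * g z) holomorphic_on U" by (intro holomorphic_intros g)
  then have "hol_calculus (\<lambda>z. (z - l) * g z) T = hol_calculus (\<lambda>z. f z - f l) T"
    by (rule hol_calculus_cong[OF U(1,2)]) (simp add: g_def)
  then have "hol_calculus f T - f l *\<^sub>C id_cblinfun = (T - l *\<^sub>C id_cblinfun) o\<^sub>C hol_calculus g T"
    unfolding hol_calculus_mult[OF id ga] hol_calculus_diff_const[OF f] hol_calculus_diff_const[OF analytic_on_ident]
      hol_calculus_ident by simp
  then show thesis using that[OF ga] by (metis apply_compose)
qed

text \<open>\<open>C\<close> and \<open>C'\<close> act as the two commuting factors \<open>D\<close>
  and \<open>G\<close> of \<open>S\<close> on the range of \<open>1 - P\<close>, and as the identity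
  on the range of \<open>P\<close>. Their product in either order is the invertible
  \<open>A\<close>, so \<open>C\<close> is invertible, and \<open>D\<close> differs from it by
  finite rank.\<close>

theorem weyl_point_from_calculus:
  fixes T :: "'a :: complex_banach \<Rightarrow>\<^sub>C\<^sub>L 'a"
  assumes T: "SVEP T" and f: "f analytic_on spectrum T" and l: "l \<in> spectrum T"
    and S: "fin_perturbed (hol_calculus f T - f l *\<^sub>C id_cblinfun)"
  shows "fin_perturbed (T - l *\<^sub>C id_cblinfun)"
proof -
  define S where "S = hol_calculus f T - f l *\<^sub>C id_cblinfun"
  have S_fin: "fin_perturbed S" using assms(4) by (simp add: S_def)
  have comm: "hol_calculus g T (S x) = S (hol_calculus g T x)" if "g analytic_on spectrum T" for g x
    using hol_calculus_commute[OF that f, of x] by (simp add: S_def)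
  have TS: "T (S x) = S (T x)" for x
    using hol_calculus_commute_self[OF f, of x] by (simp add: S_def)
  have factor: "\<exists>G :: 'a \<Rightarrow>\<^sub>C\<^sub>L 'a. (\<forall>y. S y = (T - k *\<^sub>C id_cblinfun) (G y)) \<and> (\<forall>y. G (S y) = S (G y))"
    if x: "T x = k *\<^sub>C x" "x \<noteq> 0" "S x = 0" for k x
  proof -
    obtain g where g: "g analytic_on spectrum T"
      "\<And>x. (hol_calculus f T - f k *\<^sub>C id_cblinfun) x = (T - k *\<^sub>C id_cblinfun) (hol_calculus g T x)"
      using hol_calculus_factor[OF f not_injective_in_spectrum[OF x(1,2)]] by blast
    \<comment> \<open>On an eigenvector \<open>f(T)\<close> acts as the scalar \<open>f k\<close>.
      Since \<open>S\<close> kills it, \<open>f k = f l\<close>; thus \<open>S\<close> is also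
      \<open>f(T) - f k\<close> and has the factor \<open>T - k\<close>.\<close>
    have "(T - k *\<^sub>C id_cblinfun) (hol_calculus g T x) = hol_calculus g T ((T - k *\<^sub>C id_cblinfun) x)"
      using hol_calculus_commute_self[OF g(1), of x] by simp
    then have "hol_calculus f T x = f k *\<^sub>C x"
      using g(2)[of x] x(1) by simp
    then have "(f k - f l) *\<^sub>C x = 0"
      using x(3) by (simp add: S_def complex_vector.scale_left_diff_distrib)
    then have "f k = f l" using x(2) by simp
    then show ?thesis
      using g comm[OF g(1)] by (intro exI[of _ "hol_calculus g T"]) (auto simp: S_def)
  qed
  obtain m where m: "\<And>x. S x = 0 \<Longrightarrow> x \<in> range (cblinfun_apply (opow S m)) \<Longrightarrow> x = 0"
    by (rule SVEP_finite_ascent[OF T S_fin TS factor]) (assumption+, rule that)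
  obtain P where P: "finite_rank P" "\<And>x. P (P x) = P x" "\<And>x. opow S (Suc m) (P x) = 0"
    "\<forall>B :: 'a \<Rightarrow>\<^sub>C\<^sub>L 'a. (\<forall>y. B (S y) = S (B y)) \<longrightarrow> (\<forall>x. B (P x) = P (B x))"
    "invertible_cblinfun (S o\<^sub>C (id_cblinfun - P) + P)"
    by (rule fin_perturbed_splitting[OF S_fin m]) (assumption+, rule that)
  obtain g where g: "g analytic_on spectrum T" "\<And>x. S x = (T - l *\<^sub>C id_cblinfun) (hol_calculus g T x)"
    using hol_calculus_factor[OF f l] unfolding S_def by blast
  define D where "D = T - l *\<^sub>C id_cblinfun"
  define G where "G = hol_calculus g T"
  have SDG: "S x = D (G x)" for x using g(2) by (simp add: D_def G_def)
  have GD: "G (D x) = D (G x)" for x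
    using hol_calculus_commute_self[OF g(1), of x] by (simp add: D_def G_def)
  have GS: "G (S x) = S (G x)" for x using comm[OF g(1)] by (simp add: G_def)
  have DS: "D (S x) = S (D x)" for x using TS by (simp add: D_def)
  have PG: "P (G x) = G (P x)" and PD: "P (D x) = D (P x)" for x
    using P(4) GS DS by simp_all
  define A where "A = S o\<^sub>C (id_cblinfun - P) + P"
  have A: "invertible_cblinfun A" using P(5) by (simp add: A_def)
  define C where "C = D o\<^sub>C (id_cblinfun - P) + P"
  define C' where "C' = G o\<^sub>C (id_cblinfun - P) + P"
  have CC: "C (C' x) = A x" "C' (C x) = A x" for x
    by (simp_all add: C_def C'_def A_def SDG GD PG PD P(2))
  have "invertible_cblinfun C"
  proof (rule inverse_unique(2))
    have "cblinfun_inverse A (C x) = C (cblinfun_inverse A x)" for x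
      by (rule commute_inverse[OF A]) (metis CC)
    then show "(C' o\<^sub>C cblinfun_inverse A) o\<^sub>C C = id_cblinfun" "C o\<^sub>C (C' o\<^sub>C cblinfun_inverse A) = id_cblinfun"
      using A by (auto intro!: cblinfun_eqI simp: CC)
  qed
  moreover have "D = C + (D o\<^sub>C P - P)"
    by (rule cblinfun_eqI) (simp add: C_def)
  ultimately have "fin_perturbed D"
    using fin_perturbed_add[OF invertible_fin_perturbed finite_rank_diff[OF finite_rank_compose_left[OF P(1)] P(1)]]
    by metis
  then show ?thesis by (simp add: D_def)
qed

text \<open>On the complement of the range of \<open>P\<close> the resolvent of \<open>T\<close> continues analytically to \<open>l\<close>, so the Riesz
  projection of \<open>l\<close> vanishes there.\<close>

lemma weyl_point_isolated:
  fixes T :: "'a :: complex_banach \<Rightarrow>\<^sub>C\<^sub>L 'a"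
  assumes T: "SVEP T" and l: "fin_perturbed (T - l *\<^sub>C id_cblinfun)"
  obtains r where "0 < r" "spectrum T \<inter> cball l r \<subseteq> {l}"
    "finite_rank (hol_calculus (\<lambda>z. if z \<in> ball l r then 1 else 0) T)"
proof -
  define S where "S = T - l *\<^sub>C id_cblinfun"
  have S: "fin_perturbed S" using l by (simp add: S_def)
  have T_S: "T x = S x + l *\<^sub>C x" for x by (simp add: S_def)
  have TS: "T (S x) = S (T x)" for x by (simp add: T_S)
  have factor: "\<exists>G :: 'a \<Rightarrow>\<^sub>C\<^sub>L 'a. (\<forall>y. S y = (T - k *\<^sub>C id_cblinfun) (G y)) \<and> (\<forall>y. G (S y) = S (G y))"
    if x: "T x = k *\<^sub>C x" "x \<noteq> 0" "S x = 0" for k x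
  proof -
    have "(k - l) *\<^sub>C x = 0" using x by (simp add: S_def complex_vector.scale_left_diff_distrib)
    then have "k = l" using x(2) by simp
    then show ?thesis by (intro exI[of _ id_cblinfun]) (simp add: S_def)
  qed
  obtain m where m: "\<And>x. S x = 0 \<Longrightarrow> x \<in> range (cblinfun_apply (opow S m)) \<Longrightarrow> x = 0"
    by (rule SVEP_finite_ascent[OF T S TS factor]) (assumption+, rule that)
  obtain P where P: "finite_rank P" "\<And>x. P (P x) = P x" "\<And>x. opow S (Suc m) (P x) = 0"
    "\<forall>B :: 'a \<Rightarrow>\<^sub>C\<^sub>L 'a. (\<forall>y. B (S y) = S (B y)) \<longrightarrow> (\<forall>x. B (P x) = P (B x))"
    "invertible_cblinfun (S o\<^sub>C (id_cblinfun - P) + P)"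
    by (rule fin_perturbed_splitting[OF S m]) (assumption+, rule that)
  define A where "A = S o\<^sub>C (id_cblinfun - P) + P"
  have A: "invertible_cblinfun A" using P(5) by (simp add: A_def)
  have SP: "S (P x) = P (S x)" for x using P(4) by simp
  have A_apply: "A x = S (x - P x) + P x" for x by (simp add: A_def)
  have AP: "A (P x) = P x" for x by (simp add: A_apply P(2))
  have PA: "P (A x) = A (P x)" for x by (simp add: A_apply P(2) flip: SP)
  have "0 \<notin> spectrum A"
  proof -
    have "(0 :: complex) *\<^sub>C id_cblinfun - A = (-1) *\<^sub>C A"
      by (rule cblinfun_eqI) (simp add: complex_vector.scale_minus_left)
    then show ?thesis using A invertible_scaleC_iff[of "-1" A] by (simp add: not_in_spectrum_iff)
  qed
  then obtain r0 where r0: "0 < r0" "ball 0 r0 \<subseteq> - spectrum A"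
    using closed_spectrum[of A] unfolding closed_def open_contains_ball by blast
  have A_res: "z - l \<notin> spectrum A" if "z \<in> ball l r0" for z
    using r0(2) that by (auto simp: dist_norm norm_minus_commute subset_iff)
  have isolated: "z \<notin> spectrum T" if z: "z \<in> ball l r0" "z \<noteq> l" for z
  proof -
    have eq: "z *\<^sub>C id_cblinfun - T = ((z - l) *\<^sub>C id_cblinfun - A) + (P - S o\<^sub>C P)"
      by (rule cblinfun_eqI) (simp add: A_apply T_S complex_vector.scale_left_diff_distrib)
    have "fin_perturbed (z *\<^sub>C id_cblinfun - T)"
      unfolding eq using A_res[OF z(1)]
      by (intro fin_perturbed_add invertible_fin_perturbed finite_rank_diff finite_rank_compose_left P(1))
        (simp add: not_in_spectrum_iff)
    then show ?thesis
      unfolding not_in_spectrum_iff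
    proof (rule fin_perturbed_inj_invertible)
      fix x assume "(z *\<^sub>C id_cblinfun - T) x = 0"
      then have Sx: "S x = (z - l) *\<^sub>C x"
        by (simp add: S_def complex_vector.scale_left_diff_distrib)
      \<comment> \<open>\<open>P x\<close> is an eigenvector of \<open>S\<close> or 0, but
        \<open>S\<close> is nilpotent on the range of \<open>P\<close>; so \<open>P x = 0\<close>,
        and off that range \<open>S\<close> coincides with \<open>A\<close>.\<close>
      then have "S (P x) = (z - l) *\<^sub>C P x" by (simp add: SP)
      then have "opow S n (P x) = (z - l) ^ n *\<^sub>C P x" for n
        by (induction n) (simp_all add: scaleC_scaleC mult.commute)
      then have "(z - l) ^ Suc m *\<^sub>C P x = 0" using P(3)[of x] by metis
      then have "P x = 0" using z(2) by simp
      then have "A x = (z - l) *\<^sub>C x" using Sx by (simp add: A_apply)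
      then show "x = 0"
        using A_res[OF z(1)] not_injective_in_spectrum[of A x "z - l"] by blast
    qed
  qed
  define r where "r = r0 / 2"
  have r: "0 < r" "cball l r \<subseteq> ball l r0" using r0(1) by (auto simp: r_def)
  then have r_ball: "ball l r \<subseteq> ball l r0" using ball_subset_cball by blast
  have spec: "spectrum T \<inter> cball l r \<subseteq> {l}" using isolated r(2) by blast
  define e where "e z = (if z \<in> ball l r then 1 else 0 :: complex)" for z
  \<comment> \<open>Removing the circle makes the indicator function of the disc holomorphic; the
    spectrum does not meet the circle.\<close>
  define U where "U = ball l r \<union> - cball l r"
  have U: "open U" unfolding U_def by (intro open_Un open_ball open_Compl closed_cball)
  have "spectrum T \<subseteq> U" using spec r(1) by (auto simp: U_def)
  have hol_U: "h holomorphic_on U" if "h holomorphic_on ball l r" "h holomorphic_on - cball l r" for h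
    unfolding U_def using that by (intro holomorphic_on_Un open_ball) auto
  have e: "e holomorphic_on U"
  proof (rule hol_U)
    show "e holomorphic_on ball l r"
      by (rule holomorphic_transform[OF holomorphic_on_const[of 1]]) (simp add: e_def)
    show "e holomorphic_on - cball l r"
      by (rule holomorphic_transform[OF holomorphic_on_const[of 0]]) (auto simp: e_def)
  qed
  define E where "E = hol_calculus e T"
  have "E o\<^sub>C (id_cblinfun - P) = 0"
  proof (rule functionals_separate)
    fix \<phi> :: "('a \<Rightarrow>\<^sub>C\<^sub>L 'a) \<Rightarrow> complex" assume \<phi>: "bounded_clinear \<phi>"
    define \<psi> where "\<psi> B = \<phi> (B o\<^sub>C (id_cblinfun - P))" for B
    have \<psi>: "bounded_clinear \<psi>"
      unfolding \<psi>_def[abs_def] by (rule bounded_clinear_compose[OF \<phi> bounded_clinear_compose_left])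
    obtain \<Gamma> where \<Gamma>: "surrounds_in \<Gamma> (spectrum T) U"
      using calculus_cycle[OF U \<open>spectrum T \<subseteq> U\<close>] by blast
    define h where "h z = (if z \<in> ball l r then \<psi> (resolvent A (z - l)) else 0)" for z
    have res_eq: "resolvent T z o\<^sub>C (id_cblinfun - P) = resolvent A (z - l) o\<^sub>C (id_cblinfun - P)"
      if z: "z \<in> ball l r" "z \<notin> spectrum T" for z
    proof (rule cblinfun_eqI)
      fix x
      define y where "y = x - P x"
      define u where "u = resolvent A (z - l) y"
      have zA: "z - l \<notin> spectrum A" using A_res z(1) r_ball by blast
      have "P y = 0" by (simp add: y_def P(2))
      then have Pu: "P u = 0"
        unfolding u_def using resolvent_commute[OF zA, of P y] PA by simp
      have "(z - l) *\<^sub>C u - A u = y" unfolding u_def by (rule resolvent_apply(1)[OF zA])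
      then have "z *\<^sub>C u - T u = y"
        using Pu by (simp add: A_apply T_S complex_vector.scale_left_diff_distrib algebra_simps)
      then have "resolvent T z y = u" using resolvent_apply(2)[OF z(2), of u] by simp
      then show "(resolvent T z o\<^sub>C (id_cblinfun - P)) x = (resolvent A (z - l) o\<^sub>C (id_cblinfun - P)) x"
        by (simp add: u_def y_def)
    qed
    have "h holomorphic_on U"
    proof (rule hol_U)
      have "(\<lambda>z. z - l) ` ball l r \<subseteq> - spectrum A" using A_res r_ball by blast
      then have "(\<lambda>w. \<psi> (resolvent A w)) \<circ> (\<lambda>z. z - l) holomorphic_on ball l r"
        by (intro holomorphic_on_compose_gen[OF _ functional_resolvent_holomorphic[OF \<psi>]] holomorphic_intros)
      then show "h holomorphic_on ball l r"
        by (rule holomorphic_transform) (simp add: h_def)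
      show "h holomorphic_on - cball l r"
        by (rule holomorphic_transform[OF holomorphic_on_const[of 0]]) (auto simp: h_def)
    qed
    have "(\<Sum>\<gamma>\<leftarrow>\<Gamma>. contour_integral \<gamma> (\<lambda>z. e z * \<psi> (resolvent T z))) = (\<Sum>\<gamma>\<leftarrow>\<Gamma>. contour_integral \<gamma> h)"
    proof (intro arg_cong[where f = sum_list] map_cong refl contour_integral_cong)
      fix \<gamma> z assume "\<gamma> \<in> set \<Gamma>" "z \<in> path_image \<gamma>"
      then have "z \<notin> spectrum T" using surrounds_inD(3)[OF \<Gamma>] by blast
      then show "e z * \<psi> (resolvent T z) = h z"
        using res_eq[of z] by (simp add: e_def h_def \<psi>_def)
    qed
    also have "\<dots> = 0"
      by (rule Cauchy_cycle[OF U \<open>h holomorphic_on U\<close>])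
        (use surrounds_inD[OF \<Gamma>] \<Gamma> in \<open>auto simp: surrounds_in_def\<close>)
    finally have "\<psi> E = 0"
      unfolding E_def functional_hol_calculus[OF U \<open>spectrum T \<subseteq> U\<close> e \<Gamma> \<psi>] resolvent_integral_def by simp
    then show "\<phi> (E o\<^sub>C (id_cblinfun - P)) = \<phi> 0"
      by (simp add: \<psi>_def functional_linear(3)[OF \<phi>])
  qed
  then have "E (x - P x) = 0" for x
    by (metis apply_compose apply_diff_left apply_id apply_zero_left)
  then have "E = E o\<^sub>C P" by (intro cblinfun_eqI) simp
  then have "finite_rank E" using finite_rank_compose_left[OF P(1)] by metis
  then show thesis using that[OF r(1) spec] by (simp add: E_def e_def[abs_def])
qed

lemma hol_calculus_invertible:
  fixes T :: "'a :: complex_banach \<Rightarrow>\<^sub>C\<^sub>L 'a"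
  assumes f: "f analytic_on spectrum T" and nz: "\<And>z. z \<in> spectrum T \<Longrightarrow> f z \<noteq> 0"
  shows "invertible_cblinfun (hol_calculus f T)"
proof -
  obtain V where V: "open V" "spectrum T \<subseteq> V" "f holomorphic_on V"
    using analytic_on_neighbourhood[OF f f] by blast
  define U where "U = V \<inter> f -` (- {0})"
  have U: "open U"
    unfolding U_def by (rule continuous_open_preimage[OF holomorphic_on_imp_continuous_on[OF V(3)] V(1)]) auto
  have "spectrum T \<subseteq> U" using V(2) nz by (auto simp: U_def)
  have inv: "(\<lambda>z. inverse (f z)) analytic_on spectrum T"
    by (rule analytic_on_inverse[OF f nz])
  have "(\<lambda>z. f z * inverse (f z)) holomorphic_on U"
    using V(3) by (intro holomorphic_intros holomorphic_on_subset[OF V(3)]) (auto simp: U_def)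
  then have "hol_calculus (\<lambda>z. f z * inverse (f z)) T = hol_calculus (\<lambda>z. 1) T"
    by (rule hol_calculus_cong[OF U \<open>spectrum T \<subseteq> U\<close>]) (auto simp: U_def)
  then have 1: "hol_calculus f T o\<^sub>C hol_calculus (\<lambda>z. inverse (f z)) T = id_cblinfun"
    unfolding hol_calculus_mult[OF f inv] hol_calculus_one .
  then have "hol_calculus (\<lambda>z. inverse (f z)) T o\<^sub>C hol_calculus f T = id_cblinfun"
    using hol_calculus_commute[OF f inv] by (intro cblinfun_eqI) (metis apply_compose)
  then show ?thesis by (rule inverse_unique(2)[OF _ 1])
qed

text \<open>Induction on the number of zeros of \<open>f - c\<close>: redefining \<open>f\<close> near one of them removes it and changes \<open>f(T)\<close> by an operator
  of finite rank.\<close>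

lemma fin_perturbed_hol_calculus:
  fixes T :: "'a :: complex_banach \<Rightarrow>\<^sub>C\<^sub>L 'a"
  assumes T: "SVEP T"
  shows "f analytic_on spectrum T \<Longrightarrow> finite {z \<in> spectrum T. f z = c} \<Longrightarrow>
    (\<And>l. l \<in> spectrum T \<Longrightarrow> f l = c \<Longrightarrow> fin_perturbed (T - l *\<^sub>C id_cblinfun)) \<Longrightarrow>
    fin_perturbed (hol_calculus f T - c *\<^sub>C id_cblinfun)"
proof (induction "card {z \<in> spectrum T. f z = c}" arbitrary: f)
  case 0
  then have nz: "f z - c \<noteq> 0" if "z \<in> spectrum T" for z using that by auto
  have "(\<lambda>z. f z - c) analytic_on spectrum T"
    using 0 by (intro analytic_intros)
  from hol_calculus_invertible[OF this nz] show ?case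
    unfolding hol_calculus_diff_const[OF 0(2)] by (rule invertible_fin_perturbed)
next
  case (Suc n)
  note f = Suc.prems(1)
  obtain l where l: "l \<in> spectrum T" "f l = c"
    using Suc.hyps(2) by (metis (mono_tags, lifting) card.empty emptyI equals0I mem_Collect_eq nat.distinct(1))
  obtain r where r: "0 < r" "spectrum T \<inter> cball l r \<subseteq> {l}"
    "finite_rank (hol_calculus (\<lambda>z. if z \<in> ball l r then 1 else 0) T)"
    using weyl_point_isolated[OF T Suc.prems(3)[OF l]] by blast
  obtain V where V: "open V" "spectrum T \<subseteq> V" "f holomorphic_on V"
    using analytic_on_neighbourhood[OF f f] by blast
  define U where "U = ball l r \<inter> V \<union> (- cball l r \<inter> V)"
  have U: "open U" unfolding U_def using V(1) by (intro open_Un open_Int open_ball open_Compl closed_cball)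
  have "spectrum T \<subseteq> U" using r(1,2) V(2) by (auto simp: U_def)
  define e where "e z = (if z \<in> ball l r then 1 else 0 :: complex)" for z
  \<comment> \<open>Any constant other than \<open>c\<close> removes the zero at
    \<open>l\<close>.\<close>
  define f1 where "f1 z = (if z \<in> ball l r then c + 1 else f z)" for z
  have hol_U: "h holomorphic_on U" if "h holomorphic_on ball l r \<inter> V" "h holomorphic_on - cball l r \<inter> V" for h
    unfolding U_def using that V(1) by (intro holomorphic_on_Un open_Int open_ball open_Compl closed_cball)
  have e: "e holomorphic_on U"
  proof (rule hol_U)
    show "e holomorphic_on ball l r \<inter> V"
      by (rule holomorphic_transform[OF holomorphic_on_const[of 1]]) (simp add: e_def)
    show "e holomorphic_on - cball l r \<inter> V"
      by (rule holomorphic_transform[OF holomorphic_on_const[of 0]]) (auto simp: e_def)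
  qed
  have f1: "f1 holomorphic_on U"
  proof (rule hol_U)
    show "f1 holomorphic_on ball l r \<inter> V"
      by (rule holomorphic_transform[OF holomorphic_on_const[of "c + 1"]]) (simp add: f1_def)
    show "f1 holomorphic_on - cball l r \<inter> V"
      by (rule holomorphic_transform[OF holomorphic_on_subset[OF V(3)]]) (auto simp: f1_def)
  qed
  have fU: "f holomorphic_on U" by (rule holomorphic_on_subset[OF V(3)]) (auto simp: U_def)
  have an: "h analytic_on spectrum T" if "h holomorphic_on U" for h
    using that U \<open>spectrum T \<subseteq> U\<close> analytic_on_holomorphic by blast
  have zeros: "{z \<in> spectrum T. f1 z = c} = {z \<in> spectrum T. f z = c} - {l}"
    using r(1,2) l by (auto simp: f1_def)
  have "n = card {z \<in> spectrum T. f1 z = c}"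
    unfolding zeros using Suc.hyps(2) Suc.prems(2) l by simp
  then have IH: "fin_perturbed (hol_calculus f1 T - c *\<^sub>C id_cblinfun)"
  proof (rule Suc.hyps(1))
    show "f1 analytic_on spectrum T" by (rule an[OF f1])
    show "finite {z \<in> spectrum T. f1 z = c}" unfolding zeros using Suc.prems(2) by simp
    show "fin_perturbed (T - k *\<^sub>C id_cblinfun)" if "k \<in> spectrum T" "f1 k = c" for k
      using Suc.prems(3)[of k] that zeros by blast
  qed
  \<comment> \<open>\<open>f\<close> is \<open>f1 + d * e\<close> on \<open>U\<close>, and
    \<open>e(T)\<close> is the Riesz projection at \<open>l\<close>, which has finite rank.\<close>
  define d where "d z = f z - f1 z" for z
  have d: "d holomorphic_on U" unfolding d_def[abs_def] by (intro holomorphic_intros fU f1)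
  have "(\<lambda>z. f1 z + d z * e z) holomorphic_on U" by (intro holomorphic_intros f1 d e)
  then have "hol_calculus (\<lambda>z. f1 z + d z * e z) T = hol_calculus f T"
    by (rule hol_calculus_cong[OF U \<open>spectrum T \<subseteq> U\<close>]) (simp add: d_def e_def f1_def)
  then have "hol_calculus f T = hol_calculus f1 T + hol_calculus d T o\<^sub>C hol_calculus e T"
    using hol_calculus_add[OF an[OF f1] an[OF holomorphic_on_mult[OF d e]]] hol_calculus_mult[OF an[OF d] an[OF e]] by simp
  then have "hol_calculus f T - c *\<^sub>C id_cblinfun = (hol_calculus f1 T - c *\<^sub>C id_cblinfun) + hol_calculus d T o\<^sub>C hol_calculus e T"
    by simp
  moreover have "finite_rank (hol_calculus d T o\<^sub>C hol_calculus e T)"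
    using r(3) by (intro finite_rank_compose_left) (simp add: e_def[abs_def])
  ultimately show ?case using fin_perturbed_add[OF IH] by metis
qed

text \<open>Infinitely many zeros of \<open>f - c\<close> in the compact spectrum would accumulate
  at a zero, which would then be a Weyl point that is not isolated in the spectrum.\<close>

theorem calculus_from_weyl_points:
  fixes T :: "'a :: complex_banach \<Rightarrow>\<^sub>C\<^sub>L 'a"
  assumes T: "SVEP T" and f: "f analytic_on spectrum T"
    and points: "\<And>l. l \<in> spectrum T \<Longrightarrow> f l = c \<Longrightarrow> fin_perturbed (T - l *\<^sub>C id_cblinfun)"
  shows "fin_perturbed (hol_calculus f T - c *\<^sub>C id_cblinfun)"
proof (rule fin_perturbed_hol_calculus[OF T f _ points])
  let ?Z = "{z \<in> spectrum T. f z = c}"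
  show "finite ?Z"
  proof (rule ccontr)
    assume inf: "infinite ?Z"
    have "compact (spectrum T)" by (rule compact_spectrum)
    then obtain l where l: "l \<in> spectrum T" "l islimpt ?Z"
      using inf compact_eq_Bolzano_Weierstrass[of "spectrum T"] by (metis (no_types, lifting) mem_Collect_eq subsetI)
    have "continuous_on (spectrum T) f"
      using analytic_imp_holomorphic[OF f] by (rule holomorphic_on_imp_continuous_on)
    then have "closed ?Z"
      using continuous_closed_preimage_constant closed_spectrum by blast
    then have "f l = c" using l(2) closed_limpt by blast
    then obtain r where r: "0 < r" "spectrum T \<inter> cball l r \<subseteq> {l}"
      using weyl_point_isolated[OF T points[OF l(1)]] by metis
    obtain z where "z \<in> ?Z" "z \<noteq> l" "dist z l < r"
      using l(2) r(1) unfolding islimpt_approachable by blast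
    then show False using r(2) by (auto simp: dist_commute)
  qed
qed

section \<open>The spectral mapping theorem under SVEP of the operator itself\<close>

lemma weyl_spectrum_iff:
  fixes T :: "'a :: complex_banach \<Rightarrow>\<^sub>C\<^sub>L 'a"
  shows "z \<in> weyl_spectrum T \<longleftrightarrow> \<not> fin_perturbed (T - z *\<^sub>C id_cblinfun)"
  by (simp add: weyl_spectrum_def weyl_iff_fin_perturbed)

lemma weyl_spectrum_subset_spectrum:
  fixes T :: "'a :: complex_banach \<Rightarrow>\<^sub>C\<^sub>L 'a"
  shows "weyl_spectrum T \<subseteq> spectrum T"
  by (auto simp: weyl_spectrum_iff spectrum_def intro: invertible_fin_perturbed)

theorem weyl_spectrum_hol_calculus_SVEP:
  fixes T :: "'a :: complex_banach \<Rightarrow>\<^sub>C\<^sub>L 'a"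
  assumes T: "SVEP T" and f: "f analytic_on spectrum T"
  shows "weyl_spectrum (hol_calculus f T) = f ` weyl_spectrum T"
proof
  show "weyl_spectrum (hol_calculus f T) \<subseteq> f ` weyl_spectrum T"
  proof
    fix c assume c: "c \<in> weyl_spectrum (hol_calculus f T)"
    then obtain l where "f l = c" "\<not> fin_perturbed (T - l *\<^sub>C id_cblinfun)"
      using calculus_from_weyl_points[OF T f, of c] unfolding weyl_spectrum_iff by blast
    then show "c \<in> f ` weyl_spectrum T" by (auto simp: weyl_spectrum_iff)
  qed
  show "f ` weyl_spectrum T \<subseteq> weyl_spectrum (hol_calculus f T)"
  proof
    fix c assume "c \<in> f ` weyl_spectrum T"
    then obtain l where l: "l \<in> weyl_spectrum T" "c = f l" by blast
    have "l \<in> spectrum T" using l(1) weyl_spectrum_subset_spectrum by blast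
    then show "c \<in> weyl_spectrum (hol_calculus f T)"
      using l weyl_point_from_calculus[OF T f] unfolding weyl_spectrum_iff by blast
  qed
qed


section \<open>The adjoint\<close>

lemma banach_adjoint_eq: "banach_adjoint T \<psi> = \<psi> o\<^sub>C T"
  by (rule cblinfun_eqI) (simp add: banach_adjoint_apply)

lemma bounded_clinear_banach_adjoint:
  "bounded_clinear (banach_adjoint :: ('a :: complex_normed_vector \<Rightarrow>\<^sub>C\<^sub>L 'b :: complex_normed_vector) \<Rightarrow> _)"
proof (rule bounded_clinearI[where K = 1])
  fix S T :: "'a \<Rightarrow>\<^sub>C\<^sub>L 'b" and c
  show "banach_adjoint (S + T) = banach_adjoint S + banach_adjoint T"
    by (intro cblinfun_eqI) (simp add: banach_adjoint_apply)
  show "banach_adjoint (c *\<^sub>C T) = c *\<^sub>C banach_adjoint T"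
    by (intro cblinfun_eqI) (simp add: banach_adjoint_apply scaleC_complex_def)
  show "norm (banach_adjoint T) \<le> norm T * 1"
  proof (rule norm_cblinfun_bound)
    show "norm (banach_adjoint T \<psi>) \<le> norm T * 1 * norm \<psi>" for \<psi>
      unfolding banach_adjoint_eq using norm_compose[of \<psi> T] by (simp add: mult.commute)
  qed simp
qed

lemma banach_adjoint_add: "banach_adjoint (S + T) = banach_adjoint S + banach_adjoint T"
  by (intro cblinfun_eqI) (simp add: banach_adjoint_apply)

lemma banach_adjoint_diff: "banach_adjoint (S - T) = banach_adjoint S - banach_adjoint T"
  by (intro cblinfun_eqI) (simp add: banach_adjoint_apply)

lemma banach_adjoint_scaleC_id: "banach_adjoint (c *\<^sub>C id_cblinfun) = c *\<^sub>C id_cblinfun"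
  by (intro cblinfun_eqI) (simp add: banach_adjoint_apply scaleC_complex_def)

lemma banach_adjoint_compose: "banach_adjoint (S o\<^sub>C T) = banach_adjoint T o\<^sub>C banach_adjoint S"
  by (intro cblinfun_eqI) (simp add: banach_adjoint_apply)

lemma banach_adjoint_id: "banach_adjoint id_cblinfun = id_cblinfun"
  by (intro cblinfun_eqI) (simp add: banach_adjoint_apply)

lemma banach_adjoint_inverse:
  assumes "invertible_cblinfun A"
  shows "cblinfun_inverse (banach_adjoint A) = banach_adjoint (cblinfun_inverse A)"
    and "invertible_cblinfun (banach_adjoint A)"
proof -
  have "banach_adjoint (cblinfun_inverse A) o\<^sub>C banach_adjoint A = id_cblinfun"
    "banach_adjoint A o\<^sub>C banach_adjoint (cblinfun_inverse A) = id_cblinfun"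
    unfolding banach_adjoint_compose[symmetric] using invertible_inverse[OF assms] banach_adjoint_id by metis+
  then show "cblinfun_inverse (banach_adjoint A) = banach_adjoint (cblinfun_inverse A)"
    "invertible_cblinfun (banach_adjoint A)"
    by (rule inverse_unique)+
qed

lemma functional_as_cdual:
  fixes \<phi> :: "'a :: complex_normed_vector \<Rightarrow> complex"
  assumes "bounded_clinear \<phi>"
  obtains \<psi> :: "'a cdual" where "\<And>x. \<psi> x = \<phi> x"
  using that[of "CBlinfun \<phi>"] CBlinfun_apply[OF assms] by blast

text \<open>Pulling a norming functional back through the inverse of the adjoint bounds
  \<open>A\<close> from below, so \<open>A\<close> is injective with closed range. A functional that
  vanishes on the range lies in the kernel of the adjoint and is 0, so the range is everything. The
  2 is that of \<open>norming_functional\<close>.\<close>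

lemma invertible_if_adjoint_invertible:
  fixes A :: "'a :: complex_banach \<Rightarrow>\<^sub>C\<^sub>L 'a"
  assumes A: "invertible_cblinfun (banach_adjoint A)"
  shows "invertible_cblinfun A"
proof (rule bij_invertible)
  define L where "L = norm (cblinfun_inverse (banach_adjoint A))"
  have below: "norm x \<le> 2 * L * norm (A x)" for x
  proof -
    obtain \<phi> :: "'a \<Rightarrow> complex" where \<phi>: "bounded_clinear \<phi>" "norm x \<le> norm (\<phi> x)" "\<And>y. norm (\<phi> y) \<le> 2 * norm y"
      using norming_functional[of x] by blast
    obtain \<psi> :: "'a cdual" where \<psi>: "\<And>y. \<psi> y = \<phi> y"
      using functional_as_cdual[OF \<phi>(1)] by blast
    have "norm \<psi> \<le> 2"
      using norm_cblinfun_bound[of 2 \<psi>] \<phi>(3) by (simp add: \<psi>)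
    define \<xi> where "\<xi> = cblinfun_inverse (banach_adjoint A) \<psi>"
    have "norm \<xi> \<le> L * norm \<psi>"
      unfolding \<xi>_def L_def by (rule norm_apply)
    also have "\<dots> \<le> L * 2"
      using \<open>norm \<psi> \<le> 2\<close> by (intro mult_left_mono) (simp_all add: L_def)
    finally have "norm \<xi> \<le> 2 * L" by simp
    have "\<psi> x = \<xi> (A x)"
      using inverse_apply(2)[OF A, of \<psi>] banach_adjoint_apply[of A \<xi> x] by (simp add: \<xi>_def)
    then have "norm x \<le> norm (\<xi> (A x))" using \<phi>(2) \<psi> by simp
    also have "\<dots> \<le> norm \<xi> * norm (A x)" by (rule norm_apply)
    also have "\<dots> \<le> 2 * L * norm (A x)"
      by (rule mult_right_mono[OF \<open>norm \<xi> \<le> 2 * L\<close>]) simp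
    finally show ?thesis .
  qed
  have inj: "inj (cblinfun_apply A)"
  proof (rule injI)
    fix x y assume "A x = A y"
    then have "norm (x - y) \<le> 0" using below[of "x - y"] by simp
    then show "x = y" by simp
  qed
  have "L \<ge> 0" by (simp add: L_def)
  have "complete (cblinfun_apply A ` UNIV)"
  proof (rule complete_isometric_image)
    \<comment> \<open>The added 1 avoids a division by zero when \<open>L\<close> is 0.\<close>
    show "0 < 1 / (2 * L + 1)" using \<open>L \<ge> 0\<close> by simp
    show "\<forall>x\<in>UNIV. 1 / (2 * L + 1) * norm x \<le> norm (A x)"
    proof
      fix x
      have "norm x \<le> (2 * L + 1) * norm (A x)"
        using below[of x] by (simp add: distrib_right add_increasing2)
      then show "1 / (2 * L + 1) * norm x \<le> norm (A x)"
        using \<open>L \<ge> 0\<close> by (simp add: field_simps)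
    qed
  qed (auto intro: bounded_linear_apply complete_UNIV)
  then have "closed (range (cblinfun_apply A))" by (rule complete_imp_closed)
  have "y \<in> range (cblinfun_apply A)" for y
  proof (rule ccontr)
    assume "y \<notin> range (cblinfun_apply A)"
    then obtain \<phi> :: "'a \<Rightarrow> complex" where \<phi>: "bounded_clinear \<phi>" "\<And>x. x \<in> range (cblinfun_apply A) \<Longrightarrow> \<phi> x = 0" "\<phi> y = 1"
      using closed_subspace_functional[OF csubspace_range \<open>closed (range (cblinfun_apply A))\<close>] by blast
    obtain \<psi> :: "'a cdual" where \<psi>: "\<And>y. \<psi> y = \<phi> y"
      using functional_as_cdual[OF \<phi>(1)] by blast
    have "banach_adjoint A \<psi> = 0"
      by (rule cblinfun_eqI) (simp add: banach_adjoint_apply \<psi> \<phi>(2))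
    then have "\<psi> = 0" using inverse_apply(1)[OF A, of \<psi>] by simp
    then show False using \<psi>[of y] \<phi>(3) by simp
  qed
  then show "bij (cblinfun_apply A)" using inj by (auto simp: bij_def)
qed

text \<open>Expanding \<open>F x\<close> in a basis of the range of \<open>F\<close> with dual
  functionals shows that the adjoint takes its values in the span of the functionals
  \<open>\<xi> b\<close>.\<close>

lemma finite_rank_adjoint:
  fixes F :: "'a :: complex_normed_vector \<Rightarrow>\<^sub>C\<^sub>L 'b :: complex_normed_vector"
  assumes F: "finite_rank F"
  shows "finite_rank (banach_adjoint F)"
proof -
  obtain B where B: "finite B" "range (cblinfun_apply F) \<subseteq> cspan B"
    using F unfolding finite_rank_def by blast
  obtain N where N: "finite N" "N \<subseteq> range (cblinfun_apply F)" "\<not> cdependent N" "range (cblinfun_apply F) \<subseteq> cspan N"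
    using finite_cbasis[OF B] by metis
  obtain \<phi> :: "'b \<Rightarrow> 'b \<Rightarrow> complex" where \<phi>: "\<And>b. b \<in> N \<Longrightarrow> bounded_clinear (\<phi> b)"
      "\<And>b c. b \<in> N \<Longrightarrow> c \<in> N \<Longrightarrow> \<phi> b c = (if b = c then 1 else 0)"
    using dual_basis[OF N(1,3)] by blast
  define \<xi> where "\<xi> b = CBlinfun (\<lambda>x. \<phi> b (F x))" for b
  have \<xi>: "\<xi> b x = \<phi> b (F x)" if "b \<in> N" for b x
    unfolding \<xi>_def by (rule CBlinfun_apply, rule bounded_clinear_compose[OF \<phi>(1)[OF that] bounded_clinear_apply])
  have expand: "y = (\<Sum>b\<in>N. \<phi> b y *\<^sub>C b)" if y: "y \<in> cspan N" for y
  proof -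
    obtain u where u: "y = (\<Sum>c\<in>N. u c *\<^sub>C c)"
      using y cspan_finite_sum[OF N(1)] by blast
    have "\<phi> b y = u b" if b: "b \<in> N" for b
    proof -
      have "\<phi> b y = (\<Sum>c\<in>N. \<phi> b (u c *\<^sub>C c))"
        unfolding u using bounded_clinear_linear[OF \<phi>(1)[OF b]] bounded_linear.linear linear_sum by blast
      also have "\<dots> = (\<Sum>c\<in>N. if b = c then u c else 0)"
        using \<phi>(2)[OF b] functional_linear(4)[OF \<phi>(1)[OF b]] by (intro sum.cong) auto
      finally show ?thesis using b N(1) by simp
    qed
    then show ?thesis using u by simp
  qed
  have "banach_adjoint F \<psi> = (\<Sum>b\<in>N. \<psi> b *\<^sub>C \<xi> b)" for \<psi>
  proof (rule cblinfun_eqI)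
    fix x
    have "F x = (\<Sum>b\<in>N. \<phi> b (F x) *\<^sub>C b)" using N(4) by (intro expand) blast
    then have "\<psi> (F x) = (\<Sum>b\<in>N. \<phi> b (F x) * \<psi> b)"
      by (metis (no_types, lifting) apply_scaleC apply_sum scaleC_complex_def sum.cong)
    moreover have "(\<Sum>b\<in>N. \<psi> b *\<^sub>C \<xi> b) x = (\<Sum>b\<in>N. (\<psi> b *\<^sub>C \<xi> b) x)"
      using linear_sum[OF bounded_linear.linear[OF bounded_clinear_linear[OF bounded_clinear_apply_left]]] .
    ultimately show "banach_adjoint F \<psi> x = (\<Sum>b\<in>N. \<psi> b *\<^sub>C \<xi> b) x"
      by (simp add: banach_adjoint_apply \<xi> scaleC_complex_def mult.commute)
  qed
  then have "range (cblinfun_apply (banach_adjoint F)) \<subseteq> cspan (\<xi> ` N)"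
    by (auto intro!: complex_vector.span_sum complex_vector.span_scale intro: complex_vector.span_base)
  then show ?thesis unfolding finite_rank_def using N(1) by blast
qed

lemma fin_perturbed_adjoint:
  assumes "fin_perturbed S"
  shows "fin_perturbed (banach_adjoint S)"
proof -
  obtain A F where "invertible_cblinfun A" "finite_rank F" "S = A + F"
    using assms unfolding fin_perturbed_def by blast
  then show ?thesis
    unfolding fin_perturbed_def
    using banach_adjoint_inverse(2) finite_rank_adjoint banach_adjoint_add by blast
qed

text \<open>The other half of the Fredholm alternative.\<close>

lemma fin_perturbed_surj_inj:
  assumes S: "fin_perturbed S" and surj: "range (cblinfun_apply S) = UNIV"
  shows "null_space S \<subseteq> {0}"
proof -
  obtain C where C: "finite C" "quotient_basis (range (cblinfun_apply S)) C" "nullity S = enat (card C)"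
    using fin_perturbed_structure[OF S] by blast
  have "C = {}"
  proof (rule ccontr)
    assume "C \<noteq> {}"
    then obtain c where c: "c \<in> C" by blast
    have "(1 :: complex) = 0"
      using quotient_basis_independent[OF C(2), of "{c}" "\<lambda>_. 1" c] c surj by simp
    then show False by simp
  qed
  obtain B where B: "finite B" "null_space S \<subseteq> cspan B"
    using fin_perturbed_null_space[OF S] by blast
  obtain N where N: "finite N" "null_space S \<subseteq> cspan N" "card N = cdim (null_space S)"
    using finite_cbasis[OF B] by metis
  have "cdim (null_space S) = 0"
    using C(3) \<open>C = {}\<close> edim_finite[OF B] by (simp add: nullity_def)
  then have "N = {}" using N(1,3) by simp
  then show ?thesis using N(2) by simp
qed

text \<open>By induction on the nullity of \<open>S\<^sup>*\<close>: a rank one perturbation \<open>\<xi> \<otimes> x\<close> of \<open>S\<close>, with \<open>\<xi>\<close> outside the range of \<open>S\<^sup>*\<close>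
  and \<open>x\<close> not annihilated by the kernel of \<open>S\<^sup>*\<close>, makes that kernel smaller.\<close>

lemma fin_perturbed_if_adjoint:
  fixes S :: "'a :: complex_banach \<Rightarrow>\<^sub>C\<^sub>L 'a"
  shows "fin_perturbed (banach_adjoint S) \<Longrightarrow> fin_perturbed S"
proof (induction "cdim (null_space (banach_adjoint S))" arbitrary: S rule: less_induct)
  case less
  let ?S = "banach_adjoint S"
  note S = less.prems
  show ?case
  proof (cases "null_space ?S \<subseteq> {0}")
    case True
    have "invertible_cblinfun ?S"
      by (rule fin_perturbed_inj_invertible[OF S]) (use True in \<open>auto simp: null_space_def\<close>)
    then show ?thesis
      by (rule invertible_fin_perturbed[OF invertible_if_adjoint_invertible])
  next
    case False
    then obtain \<psi> where \<psi>: "?S \<psi> = 0" "\<psi> \<noteq> 0" by (auto simp: null_space_def)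
    then obtain x where "\<psi> x \<noteq> 0" by (metis apply_zero_left cblinfun_eqI)
    have "range (cblinfun_apply ?S) \<noteq> UNIV"
      using fin_perturbed_surj_inj[OF S] False by blast
    then obtain \<xi> where \<xi>: "\<xi> \<notin> range (cblinfun_apply ?S)" by blast
    obtain F :: "'a \<Rightarrow>\<^sub>C\<^sub>L 'a" where F: "finite_rank F" "\<And>y. F y = (\<Sum>i\<in>{()}. \<xi> y *\<^sub>C x)"
      using finite_rank_operator[of "{()}" "\<lambda>_. cblinfun_apply \<xi>" "\<lambda>_. x"] bounded_clinear_apply by auto
    have F_adj: "banach_adjoint F \<eta> = \<eta> x *\<^sub>C \<xi>" for \<eta>
      by (rule cblinfun_eqI) (simp add: banach_adjoint_apply F(2) scaleC_complex_def)
    have adj: "banach_adjoint (S + F) = ?S + banach_adjoint F" by (rule banach_adjoint_add)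
    have fin: "fin_perturbed (banach_adjoint (S + F))"
      unfolding adj by (rule fin_perturbed_add[OF S finite_rank_adjoint[OF F(1)]])
    \<comment> \<open>A kernel element with \<open>\<eta> x\<close> different from 0 would exhibit
      \<open>\<xi>\<close> as a value of the adjoint of \<open>S\<close>. So the new kernel lies in
      the old one, and it misses \<open>\<psi>\<close>.\<close>
    have null: "?S \<eta> = 0 \<and> \<eta> x = 0" if \<eta>: "\<eta> \<in> null_space (banach_adjoint (S + F))" for \<eta>
    proof -
      have eq: "?S \<eta> + \<eta> x *\<^sub>C \<xi> = 0"
        using \<eta> by (simp add: null_space_def adj F_adj)
      have "\<eta> x = 0"
      proof (rule ccontr)
        assume nz: "\<eta> x \<noteq> 0"
        have "?S ((- inverse (\<eta> x)) *\<^sub>C \<eta>) = \<xi>"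
          using eq nz unfolding apply_scaleC
          by (simp add: eq_neg_iff_add_eq_0[symmetric] scaleC_scaleC complex_vector.scale_minus_left complex_vector.scale_minus_right)
        then show False using \<xi> by (metis rangeI)
      qed
      with eq show ?thesis by simp
    qed
    obtain B where B: "finite B" "null_space ?S \<subseteq> cspan B"
      using fin_perturbed_null_space[OF S] by blast
    have "cdim (null_space (banach_adjoint (S + F))) < cdim (null_space ?S)"
    proof (rule ccontr)
      assume "\<not> ?thesis"
      then have "null_space (banach_adjoint (S + F)) = null_space ?S"
        using null by (intro csubspace_dim_equal[OF csubspace_null_space _ B]) (auto simp: null_space_def)
      then have "\<psi> x = 0" using \<psi>(1) null[of \<psi>] by (simp add: null_space_def)
      then show False using \<open>\<psi> x \<noteq> 0\<close> by simp
    qed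
    then have "fin_perturbed (S + F)" by (rule less.hyps) (rule fin)
    then have "fin_perturbed ((S + F) + (- F))"
      by (rule fin_perturbed_add) (rule finite_rank_minus[OF F(1)])
    then show ?thesis by simp
  qed
qed

lemma adjoint_minus_scaleC_id:
  "banach_adjoint (T - z *\<^sub>C id_cblinfun) = banach_adjoint T - z *\<^sub>C id_cblinfun"
  by (simp add: banach_adjoint_diff banach_adjoint_scaleC_id)

lemma weyl_spectrum_adjoint:
  fixes T :: "'a :: complex_banach \<Rightarrow>\<^sub>C\<^sub>L 'a"
  shows "weyl_spectrum (banach_adjoint T) = weyl_spectrum T"
  using fin_perturbed_adjoint[of "T - z *\<^sub>C id_cblinfun" for z] fin_perturbed_if_adjoint[of "T - z *\<^sub>C id_cblinfun" for z]
  unfolding adjoint_minus_scaleC_id by (auto simp: weyl_spectrum_iff)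

lemma spectrum_adjoint:
  fixes T :: "'a :: complex_banach \<Rightarrow>\<^sub>C\<^sub>L 'a"
  shows "spectrum (banach_adjoint T) = spectrum T"
  using banach_adjoint_inverse(2)[of "T - z *\<^sub>C id_cblinfun" for z]
    invertible_if_adjoint_invertible[of "T - z *\<^sub>C id_cblinfun" for z]
  unfolding adjoint_minus_scaleC_id by (auto simp: spectrum_def)

lemma resolvent_adjoint:
  assumes "z \<notin> spectrum T"
  shows "resolvent (banach_adjoint T) z = banach_adjoint (resolvent T z)"
  using banach_adjoint_inverse(1)[OF assms[unfolded not_in_spectrum_iff]]
  by (simp add: resolvent_def banach_adjoint_diff banach_adjoint_scaleC_id)

text \<open>The spectra coincide, so one cycle serves both operators. As the adjoint is
  complex-linear in the operator, a functional composed with it is again a functional, and the two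
  integrands agree because the resolvent of the adjoint is the adjoint of the resolvent.\<close>

lemma hol_calculus_adjoint:
  fixes T :: "'a :: complex_banach \<Rightarrow>\<^sub>C\<^sub>L 'a"
  assumes f: "f analytic_on spectrum T"
  shows "hol_calculus f (banach_adjoint T) = banach_adjoint (hol_calculus f T)"
proof (rule functionals_separate)
  fix \<phi> :: "('a cdual \<Rightarrow>\<^sub>C\<^sub>L 'a cdual) \<Rightarrow> complex" assume \<phi>: "bounded_clinear \<phi>"
  obtain U where U: "open U" "spectrum T \<subseteq> U" "f holomorphic_on U"
    using analytic_on_neighbourhood[OF f f] by blast
  obtain \<Gamma> where \<Gamma>: "surrounds_in \<Gamma> (spectrum T) U"
    using calculus_cycle[OF U(1,2)] by blast
  have \<psi>: "bounded_clinear (\<lambda>A. \<phi> (banach_adjoint A))"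
    by (rule bounded_clinear_compose[OF \<phi> bounded_clinear_banach_adjoint])
  have "(\<Sum>\<gamma>\<leftarrow>\<Gamma>. contour_integral \<gamma> (\<lambda>z. f z * \<phi> (resolvent (banach_adjoint T) z))) =
      (\<Sum>\<gamma>\<leftarrow>\<Gamma>. contour_integral \<gamma> (\<lambda>z. f z * \<phi> (banach_adjoint (resolvent T z))))"
  proof (intro arg_cong[where f = sum_list] map_cong refl contour_integral_cong)
    fix \<gamma> z assume "\<gamma> \<in> set \<Gamma>" "z \<in> path_image \<gamma>"
    then have "z \<notin> spectrum T" using surrounds_inD(3)[OF \<Gamma>] by blast
    then show "f z * \<phi> (resolvent (banach_adjoint T) z) = f z * \<phi> (banach_adjoint (resolvent T z))"
      by (simp add: resolvent_adjoint)
  qed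
  then show "\<phi> (hol_calculus f (banach_adjoint T)) = \<phi> (banach_adjoint (hol_calculus f T))"
    using functional_hol_calculus[of U "banach_adjoint T" f \<Gamma> \<phi>] functional_hol_calculus[OF U \<Gamma> \<psi>] U \<Gamma> \<phi>
    by (simp add: spectrum_adjoint resolvent_integral_def)
qed

theorem corollary2p6:
  fixes T :: "'a :: complex_banach \<Rightarrow>\<^sub>C\<^sub>L 'a"
  assumes "edim (UNIV :: 'a set) = \<infinity>"
    and "SVEP T \<or> SVEP (banach_adjoint T)"
  shows "\<forall>f. f analytic_on spectrum T \<longrightarrow>
           weyl_spectrum (hol_calculus f T) = f ` weyl_spectrum T"
proof (intro allI impI)
  fix f assume f: "f analytic_on spectrum T"
  from assms(2) show "weyl_spectrum (hol_calculus f T) = f ` weyl_spectrum T"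
  proof
    assume "SVEP T"
    then show ?thesis using f by (rule weyl_spectrum_hol_calculus_SVEP)
  next
    assume "SVEP (banach_adjoint T)"
    then have "weyl_spectrum (hol_calculus f (banach_adjoint T)) = f ` weyl_spectrum (banach_adjoint T)"
      by (rule weyl_spectrum_hol_calculus_SVEP) (simp add: spectrum_adjoint f)
    then show ?thesis
      by (simp add: hol_calculus_adjoint[OF f] weyl_spectrum_adjoint)
  qed
qed

end
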